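(* Let $\mu(dx)=p(x)\,dx$ be a non-degenerate self-decomposable distribution on $\mathbb R_+=[0,\infty)$ with Lévy measure $\nu(dx)=\frac{k(x)}{x}dx$ on $(0,\infty)$, where $k(x)>0$ for all $x>0$. Let $0\le\alpha\le1$ and assume that $p(x)\sim x^{-\alpha-1}l(x)$ with $l$ slowly varying as $x\to\infty$. For $x>1$ define $l^*(x)=\int_1^x\frac{l(u)}{u}du$ and $l_*(x)=\int_x^\infty\frac{l(u)}{u}du$. Then the following hold. (i) Let $0<\alpha<1$ and $$K(\alpha):=\frac{(2\alpha-1)(\Gamma(1-\alpha))^2}{2\alpha\,\Gamma(2-2\alpha)}.$$ Then, as $x\to\infty$, $$\bar\nu(x)=\bar\mu(x)\left(1-K(\alpha)x^{-\alpha}l(x)+o(x^{-\alpha}l(x))\right),$$ and, for every $t>0$, as $x\to\infty$, $$\overline{\mu^{t*}}(x)=t\bar\mu(x)\left(1+(t-1)K(\alpha)x^{-\alpha}l(x)+o(x^{-\alpha}l(x))\right).$$ (ii) Let $\alpha=1$ and assume $l^*(\infty)=\infty$. Then, as $x\to\infty$, $$\bar\nu(x)=\bar\mu(x)\left(1-\frac{l^*(x)}{x}+o\Big(\frac{l^*(x)}{x}\Big)\right),$$ and, for every $t>0$, as $x\to\infty$, $$\overline{\mu^{t*}}(x)=t\bar\mu(x)\left(1+(t-1)\frac{l^*(x)}{x}+o\Big(\frac{l^*(x)}{x}\Big)\right).$$ (iii) Let $\alpha=1$ and assume $l^*(\infty)<\infty$. Then, as $x\to\infty$, $$\bar\nu(x)=\bar\mu(x)\left(1-\frac{m(\mu)}{x}+o\Big(\frac1x\Big)\right),$$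 and, for every $t>0$, as $x\to\infty$, $$\overline{\mu^{t*}}(x)=t\bar\mu(x)\left(1+(t-1)\frac{m(\mu)}{x}+o\Big(\frac1x\Big)\right).$$ (iv) Let $\alpha=0$. Then, as $x\to\infty$, $$\bar\nu(x)=\bar\mu(x)\left(1+\frac{l_*(x)}{2}+o(l_*(x))\right),$$ and, for every $t>0$, as $x\to\infty$, $$\overline{\mu^{t*}}(x)=t\bar\mu(x)\left(1-(t-1)\frac{l_*(x)}{2}+o(l_*(x))\right).$$
   Context: For a measure $\xi$ on $\mathbb R$, $\bar\xi(x):=\xi((x,\infty))$ for $x>0$. $m(\mu)$ denotes the mean of $\mu$. $f(x)\sim g(x)$ means $\lim_{x\to\infty}f(x)/g(x)=1$, and $f(x)=o(g(x))$ means $f(x)/g(x)\to0$ as $x\to\infty$. $l$ is a positive measurable function with $l(\lambda x)/l(x)\to1$ as $x\to\infty$ for every $\lambda>0$, locally integrable on $[1,\infty)$ so that $l^*$ is well defined; $l^*(\infty):=\lim_{x\to\infty}l^*(x)$; $l_*$ is used only when $\alpha=0$. An infinitely divisible distribution $\mu$ on $\mathbb R$ has characteristic function $$\widehat\mu(z)=\exp\Big(\int_{-\infty}^{\infty}\big(e^{izx}-1-\tfrac{izx}{1+x^2}\big)\nu(dx)+i\gamma z-\tfrac12 az^2\Big),$$ with $\gamma\in\mathbb R$, $a\ge0$ and Lévy measure $\nu$ satisfying $\nu(\{0\})=0$, $\int\frac{x^2}{1+x^2}\nu(dx)<\infty$. For $t>0$, $\mu^{t*}$ is the $t$-th convolution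 power, i.e. the infinitely divisible distribution whose characteristic function is the $t$-th power of $\widehat\mu$ (the exponent above multiplied by $t$). $\mu$ is self-decomposable if for every $b\in(0,1)$ there is a distribution $\rho_b$ on $\mathbb R$ with $\widehat\mu(z)=\widehat\mu(bz)\widehat{\rho_b}(z)$; equivalently, $\nu(dx)=\frac{k(x)}{|x|}dx$ with $k$ nonnegative, increasing (non-strictly) on $(-\infty,0)$ and decreasing (non-strictly) on $(0,\infty)$. Non-degenerate means not a delta measure; every non-degenerate self-decomposable distribution is absolutely continuous and unimodal, and $p$ denotes its unimodal density (increasing on $(-\infty,a)$ and decreasing on $(a,\infty)$ for some $a$). *)

theory Defs
  imports "HOL-Probability.Probability" "HOL-Library.Landau_Symbols"
begin

text \<open>Distributions on the real line are Borel probability measures (locale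
  \<^locale>\<open>real_distribution\<close>); characteristic functions are \<^const>\<open>char\<close>.\<close>

definition levy_measure :: "real measure \<Rightarrow> bool" where
  "levy_measure \<nu> \<longleftrightarrow>
     sets \<nu> = sets borel \<and> emeasure \<nu> {0} = 0 \<and>
     (\<integral>\<^sup>+x. ennreal (x\<^sup>2 / (1 + x\<^sup>2)) \<partial>\<nu>) < \<infinity>"

definition levy_exponent :: "real \<Rightarrow> real \<Rightarrow> real measure \<Rightarrow> real \<Rightarrow> complex" where
  "levy_exponent \<gamma> a \<nu> z =
     (CLINT x|\<nu>. iexp (z * x) - 1 - \<i> * complex_of_real (z * x / (1 + x\<^sup>2)))
     + \<i> * complex_of_real (\<gamma> * z) - complex_of_real (a * z\<^sup>2 / 2)"

definition levy_triplet :: "real measure \<Rightarrow> real \<Rightarrow> real \<Rightarrow> real measure \<Rightarrow> bool" where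
  "levy_triplet \<mu> \<gamma> a \<nu> \<longleftrightarrow>
     real_distribution \<mu> \<and> levy_measure \<nu> \<and> 0 \<le> a \<and>
     (\<forall>z. char \<mu> z = exp (levy_exponent \<gamma> a \<nu> z))"

text \<open>\<open>is_conv_power t \<mu> \<rho>\<close> says that \<open>\<rho>\<close> is the \<open>t\<close>-th convolution power of the infinitely
  divisible distribution \<open>\<mu>\<close>.  For \<open>t > 0\<close> such a \<open>\<rho>\<close> exists and is unique, by the
  Levy-Khintchine theorem.  The power of the characteristic function is taken through the
  exponent, i.e. with the distinguished logarithm, not with the principal one.\<close>

definition is_conv_power :: "real \<Rightarrow> real measure \<Rightarrow> real measure \<Rightarrow> bool" where
  "is_conv_power t \<mu> \<rho> \<longleftrightarrow>
     real_distribution \<rho> \<and>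
     (\<exists>\<gamma> a \<nu>. levy_triplet \<mu> \<gamma> a \<nu> \<and>
        (\<forall>z. char \<rho> z = exp (complex_of_real t * levy_exponent \<gamma> a \<nu> z)))"

definition self_decomposable :: "real measure \<Rightarrow> bool" where
  "self_decomposable \<mu> \<longleftrightarrow>
     real_distribution \<mu> \<and>
     (\<forall>b. 0 < b \<and> b < 1 \<longrightarrow>
        (\<exists>\<rho>. real_distribution \<rho> \<and> (\<forall>z. char \<mu> z = char \<mu> (b * z) * char \<rho> z)))"

definition degenerate :: "real measure \<Rightarrow> bool" where
  "degenerate \<mu> \<longleftrightarrow> (\<exists>c. \<mu> = return borel c)"

text \<open>The value of the density at the mode \<open>c\<close> is irrelevant: the density may be unbounded
  near \<open>c\<close>.\<close>

definition unimodal_density :: "real measure \<Rightarrow> (real \<Rightarrow> real) \<Rightarrow> bool" where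
  "unimodal_density \<mu> p \<longleftrightarrow>
     p \<in> borel_measurable borel \<and> (\<forall>x. 0 \<le> p x) \<and>
     \<mu> = density lborel (\<lambda>x. ennreal (p x)) \<and>
     (\<exists>c. mono_on {..<c} p \<and> antimono_on {c<..} p)"

definition tail :: "real measure \<Rightarrow> real \<Rightarrow> real" where
  "tail \<xi> x = measure \<xi> {x<..}"

definition mean :: "real measure \<Rightarrow> real" where
  "mean \<mu> = (LINT x|\<mu>. x)"

text \<open>Slowly varying functions live on \<open>(0,\<infinity>)\<close>; their values elsewhere are unconstrained.\<close>

definition slowly_varying :: "(real \<Rightarrow> real) \<Rightarrow> bool" where
  "slowly_varying l \<longleftrightarrow>
     l \<in> borel_measurable (restrict_space borel {0<..}) \<and> (\<forall>x>0. 0 < l x) \<and>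
     (\<forall>c>0. ((\<lambda>x. l (c * x) / l x) \<longlongrightarrow> 1) at_top)"

definition l_upper :: "(real \<Rightarrow> real) \<Rightarrow> real \<Rightarrow> real" where
  "l_upper l x = (LBINT u:{1..x}. l u / u)"

definition l_upper_infinity :: "(real \<Rightarrow> real) \<Rightarrow> ereal" where
  "l_upper_infinity l = Lim at_top (\<lambda>x. ereal (l_upper l x))"

definition l_lower :: "(real \<Rightarrow> real) \<Rightarrow> real \<Rightarrow> real" where
  "l_lower l x = (LBINT u:{x<..}. l u / u)"

definition K_const :: "real \<Rightarrow> real" where
  "K_const \<alpha> = (2 * \<alpha> - 1) * (Gamma (1 - \<alpha>))\<^sup>2 / (2 * \<alpha> * Gamma (2 - 2 * \<alpha>))"

end

theory Submission
  imports Defs "HOL-Complex_Analysis.Complex_Analysis" "HOL-Real_Asymp.Real_Asymp"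
begin

text \<open>
  Write \<open>R\<close> for the tail of a convolution power \<open>\<mu>\<^sup>t\<close>, \<open>G\<close> for the tail of \<open>\<nu>\<close>, and
  \<open>\<kappa>(dx) = k(x)dx + b \<delta>\<^sub>0(dx)\<close>, where \<open>b \<ge> 0\<close> is the drift.  Everything rests on one exact relation,
  the size-bias identity \<open>z \<mu>\<^sup>t(dz) = t (\<mu>\<^sup>t * \<kappa>)(dz)\<close>, which is the logarithmic derivative of the
  Laplace transform.  It involves no powers of \<open>\<nu>\<close>, so no compound Poisson series have to be summed.

  With \<open>M(x) = \<kappa>[0,x]\<close> and \<open>S(x) = \<integral> R(x - y) \<kappa>(dy)\<close> over \<open>[0,x]\<close>, the identity on \<open>[0,x]\<close> says that the
  truncated mean of \<open>\<mu>\<^sup>t\<close> is \<open>t (M(x) - S(x))\<close>, while that of \<open>\<nu>\<close> is \<open>M(x) - b\<close>.  Truncated means turn into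
  tails by integrating their increments against \<open>1/w\<^sup>2\<close>, and this gives the exact formula
  \<open>R(x) - t G(x) = t (S(x)/x - \<integral>\<^sub>x\<^sup>\<infinity> S(w)/w\<^sup>2 dw)\<close>.
  The right-hand side is quadratic in the tails, so first-order knowledge of \<open>R\<close>, \<open>G\<close> and \<open>k\<close> on the right
  yields second-order knowledge on the left.

  First order: because \<open>k\<close> decreases, \<open>S(x)/x\<close> is of smaller order than the tails at fixed fractions of \<open>x\<close>.
  For \<open>t = 1\<close>, where \<open>R\<close> is regularly varying because \<open>p\<close> is, this gives \<open>G \<sim> R\<close>, so \<open>G\<close> is regularly varying too; a second use gives
  \<open>R \<sim> t G\<close> for every \<open>t\<close>.  Monotonicity of \<open>k(x)/x\<close> then yields \<open>k(x)/G(x) \<rightarrow> \<alpha>\<close>.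

  Second order: for \<open>\<alpha> < 1\<close>, scaling shows \<open>S(x) \<sim> t \<alpha> B(1-\<alpha>,1-\<alpha>) x G(x)\<^sup>2\<close>; for \<open>\<alpha> > 0\<close> Karamata's
  theorem for the monotone function \<open>G(w)\<^sup>2/w\<close> evaluates the integral, and the two terms combine to the constant
  \<open>t\<^sup>2 (2\<alpha>-1) B(1-\<alpha>,1-\<alpha>)/2\<close>.  For \<open>\<alpha> = 1\<close> the two ends of the convolution each contribute \<open>t G(x) M(x)\<close>,
  and \<open>M\<close> tends to the mean or is asymptotic to \<open>l\<^sup>*\<close>.  For \<open>\<alpha> = 0\<close> the term \<open>S(x)/x\<close> is negligible and the
  integral alone contributes \<open>t G(x)\<^sup>2/2\<close>.

  In all cases \<open>R = t G + t\<^sup>2 E\<close> with the same \<open>E\<close> for all \<open>t\<close>, up to errors of smaller order than the scale of the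
  expansion.  The case \<open>t = 1\<close> is the statement on \<open>\<nu>\<close>; subtracting \<open>t\<close> times it leaves \<open>t (t - 1) E\<close>, the statement on \<open>\<mu>\<^sup>t\<close>.
\<close>

section \<open>Parameter integrals and the upper half-plane\<close>

text \<open>By the mean value inequality the bound on the derivatives dominates the difference quotients.\<close>

lemma has_field_derivative_lebesgue_integral:
  fixes f f' :: "complex \<Rightarrow> 'a \<Rightarrow> complex" and g :: "'a \<Rightarrow> real"
  assumes r: "0 < r"
    and int: "\<And>z. z \<in> ball w r \<Longrightarrow> integrable M (f z)"
    and meas: "f' w \<in> borel_measurable M"
    and g: "integrable M g"
    and der: "AE x in M. \<forall>z\<in>ball w r. ((\<lambda>z. f z x) has_field_derivative f' z x) (at z) \<and> norm (f' z x) \<le> g x"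
  shows "((\<lambda>z. \<integral>x. f z x \<partial>M) has_field_derivative (\<integral>x. f' w x \<partial>M)) (at w)"
proof -
  have at: "at w = at w within ball w r"
    using r by (intro at_within_open[symmetric]) auto
  have [measurable]: "f z \<in> borel_measurable M" if "z \<in> ball w r" for z
    using int[OF that] by auto
  show ?thesis
    unfolding has_field_derivative_iff at tendsto_at_iff_sequentially
  proof (intro allI impI)
    fix X assume X: "\<forall>i. X i \<in> ball w r - {w}" and lim: "X \<longlonglongrightarrow> w"
    have w: "w \<in> ball w r" using r by simp
    have eq: "((\<lambda>y. ((\<integral>x. f y x \<partial>M) - (\<integral>x. f w x \<partial>M)) / (y - w)) \<circ> X) i
        = (\<integral>x. (f (X i) x - f w x) / (X i - w) \<partial>M)" for i
      using X int w by (simp add: Bochner_Integration.integral_diff)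
    have "(\<lambda>i. \<integral>x. (f (X i) x - f w x) / (X i - w) \<partial>M) \<longlonglongrightarrow> (\<integral>x. f' w x \<partial>M)"
    proof (rule integral_dominated_convergence[where w = g])
      show "f' w \<in> borel_measurable M" by (rule meas)
      show "(\<lambda>x. (f (X i) x - f w x) / (X i - w)) \<in> borel_measurable M" for i
        using X w by (intro borel_measurable_divide borel_measurable_diff) auto
      show "integrable M g" by (rule g)
      show "AE x in M. (\<lambda>i. (f (X i) x - f w x) / (X i - w)) \<longlonglongrightarrow> f' w x"
        using der
      proof eventually_elim
        case (elim x)
        then have "((\<lambda>y. (f y x - f w x) / (y - w)) \<longlongrightarrow> f' w x) (at w within ball w r)"
          using w has_field_derivative_at_within[of "\<lambda>z. f z x" "f' w x" w "ball w r"]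
          unfolding has_field_derivative_iff by blast
        then show ?case
          using X lim by (auto simp: tendsto_at_iff_sequentially comp_def)
      qed
      show "AE x in M. norm ((f (X i) x - f w x) / (X i - w)) \<le> g x" for i
        using der
      proof eventually_elim
        case (elim x)
        have "norm (f (X i) x - f w x) \<le> g x * norm (X i - w)"
          using elim X w
          by (intro field_differentiable_bound[of "ball w r" "\<lambda>z. f z x" "\<lambda>z. f' z x"])
             (auto intro: has_field_derivative_at_within)
        moreover have "X i \<noteq> w" using X by auto
        ultimately show ?case by (simp add: norm_divide divide_simps)
      qed
    qed
    then show "((\<lambda>y. ((\<integral>x. f y x \<partial>M) - (\<integral>x. f w x \<partial>M)) / (y - w)) \<circ> X) \<longlonglongrightarrow> (\<integral>x. f' w x \<partial>M)"
      by (simp add: eq[abs_def])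
  qed
qed

text \<open>Continued by \<open>0\<close> to the lower half-plane, \<open>f\<close> stays continuous, hence is
  holomorphic across the real line. It vanishes on a half-plane, so everywhere.\<close>

lemma upper_half_plane_eq_0:
  fixes f :: "complex \<Rightarrow> complex"
  assumes cont: "continuous_on {z. 0 \<le> Im z} f"
    and holo: "f holomorphic_on {z. 0 < Im z}"
    and real0: "\<And>x. f (complex_of_real x) = 0"
    and z: "0 \<le> Im z"
  shows "f z = 0"
proof -
  define h where "h = (\<lambda>z. if 0 \<le> Im z then f z else 0)"
  have [simp]: "\<i> \<bullet> z = Im z" for z :: complex by (simp add: inner_complex_def)
  have "continuous_on ({z. 0 \<le> Im z} \<union> {z. Im z \<le> 0}) h"
    unfolding h_def
  proof (rule continuous_on_cases)
    show "closed {z. 0 \<le> Im z}" "closed {z. Im z \<le> 0}"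
      by (auto simp: closed_halfspace_Im_ge closed_halfspace_Im_le)
    show "\<forall>x. x \<in> {z. 0 \<le> Im z} \<and> \<not> 0 \<le> Im x \<or> x \<in> {z. Im z \<le> 0} \<and> 0 \<le> Im x \<longrightarrow> f x = 0"
    proof (safe)
      fix x :: complex assume "Im x \<le> 0" "0 \<le> Im x"
      then have "x = complex_of_real (Re x)" by (simp add: complex_eq_iff)
      then show "f x = 0" using real0 by metis
    qed
  qed (use cont in auto)
  moreover have "{z. 0 \<le> Im z} \<union> {z. Im z \<le> 0} = UNIV" by auto
  ultimately have hc: "continuous_on UNIV h" by simp
  have h1: "h holomorphic_on UNIV"
  proof (rule holomorphic_on_paste_across_line[of _ "\<i>" _ 0])
    show "h holomorphic_on UNIV \<inter> {z. \<i> \<bullet> z < 0}"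
      by (rule holomorphic_transform[of "\<lambda>_. 0"]) (auto simp: h_def)
    show "h holomorphic_on UNIV \<inter> {z. 0 < \<i> \<bullet> z}"
      by (rule holomorphic_transform[of f]) (use holo in \<open>auto simp: h_def\<close>)
  qed (use hc in auto)
  have "h z = 0"
  proof (rule analytic_continuation_open[of "{z. Im z < 0}" UNIV h "\<lambda>_. 0"])
    show "{z. Im z < 0} \<noteq> {}" by (auto intro: exI[of _ "-\<i>"])
  qed (use h1 in \<open>auto simp: h_def open_halfspace_Im_lt\<close>)
  then show ?thesis using z by (simp add: h_def)
qed

lemma continuous_on_lebesgue_integral_dominated:
  fixes f :: "'b :: first_countable_topology \<Rightarrow> 'a \<Rightarrow> complex" and g :: "'a \<Rightarrow> real"
  assumes meas: "\<And>z. z \<in> S \<Longrightarrow> f z \<in> borel_measurable M"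
    and g: "integrable M g"
    and bound: "\<And>z. z \<in> S \<Longrightarrow> AE x in M. norm (f z x) \<le> g x"
    and cont: "\<And>x. continuous_on S (\<lambda>z. f z x)"
  shows "continuous_on S (\<lambda>z. \<integral>x. f z x \<partial>M)"
  unfolding continuous_on_def
proof
  fix w assume w: "w \<in> S"
  show "((\<lambda>z. \<integral>x. f z x \<partial>M) \<longlongrightarrow> (\<integral>x. f w x \<partial>M)) (at w within S)"
    unfolding tendsto_at_iff_sequentially comp_def
  proof (intro allI impI)
    fix X assume X: "\<forall>i. X i \<in> S - {w}" and lim: "X \<longlonglongrightarrow> w"
    show "(\<lambda>i. \<integral>x. f (X i) x \<partial>M) \<longlonglongrightarrow> (\<integral>x. f w x \<partial>M)"
    proof (rule integral_dominated_convergence[where w = g])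
      show "AE x in M. (\<lambda>i. f (X i) x) \<longlonglongrightarrow> f w x"
        using cont w X lim
        by (auto simp: continuous_on_def tendsto_at_iff_sequentially comp_def)
    qed (use X w meas g bound in auto)
  qed
qed

section \<open>Fourier-Laplace transforms and the Levy symbol\<close>

text \<open>For a measure on the half-line this is defined for \<open>Im \<zeta> \<ge> 0\<close>. On the real line
  it is the characteristic function, and at \<open>\<zeta> = is\<close> it is the Laplace transform at
  \<open>s\<close>.\<close>

definition fourier_laplace :: "real measure \<Rightarrow> complex \<Rightarrow> complex" where
  "fourier_laplace M \<zeta> = (CLINT x|M. exp (\<i> * \<zeta> * of_real x))"

text \<open>The continuation of \<^const>\<open>levy_exponent\<close> to the upper half-plane, for a Levy measure on
  \<open>(0,\<infinity>)\<close>.\<close>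

definition levy_symbol :: "real \<Rightarrow> real \<Rightarrow> real measure \<Rightarrow> complex \<Rightarrow> complex" where
  "levy_symbol \<gamma> a \<nu> \<zeta> =
     (CLINT x|\<nu>. exp (\<i> * \<zeta> * of_real x) - 1 - \<i> * \<zeta> * of_real (x / (1 + x\<^sup>2)))
     + \<i> * of_real \<gamma> * \<zeta> - of_real a * \<zeta>\<^sup>2 / 2"

lemma fourier_laplace_of_real: "fourier_laplace M (of_real z) = char M z"
  by (simp add: fourier_laplace_def char_def algebra_simps)

lemma levy_symbol_of_real: "levy_symbol \<gamma> a \<nu> (of_real z) = levy_exponent \<gamma> a \<nu> z"
  by (simp add: levy_symbol_def levy_exponent_def algebra_simps)

lemma norm_exp_minus_1_le:
  fixes w :: complex
  assumes "Re w \<le> 0"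
  shows "norm (exp w - 1) \<le> norm w"
proof -
  have "convex {w::complex. Re w \<le> 0}" by (rule convex_halfspace_Re_le)
  then have "norm (exp w - exp 0) \<le> 1 * norm (w - 0)"
    by (rule field_differentiable_bound[where f' = exp])
       (use assms in \<open>auto intro!: derivative_eq_intros\<close>)
  then show ?thesis by simp
qed

lemma norm_exp_minus_linear_le:
  fixes w :: complex
  assumes "Re w \<le> 0"
  shows "norm (exp w - 1 - w) \<le> (norm w)\<^sup>2"
proof -
  have "convex ({v::complex. Re v \<le> 0} \<inter> cball 0 (norm w))"
    by (intro convex_Int convex_halfspace_Re_le convex_cball)
  then have "norm ((exp w - w) - (exp 0 - 0)) \<le> norm w * norm (w - 0)"
  proof (rule field_differentiable_bound[where f' = "\<lambda>v. exp v - 1"])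
    fix v assume "v \<in> {v. Re v \<le> 0} \<inter> cball 0 (cmod w)"
    then show "norm (exp v - 1) \<le> norm w"
      using norm_exp_minus_1_le[of v] by auto
  qed (use assms in \<open>auto intro!: derivative_eq_intros\<close>)
  then show ?thesis by (simp add: power2_eq_square algebra_simps)
qed

text \<open>The kernel is dominated by the function whose integrability defines Levy measures: near \<open>0\<close>
  it is of second order in \<open>x\<close>, and away from \<open>0\<close> it is bounded because the sign
  condition keeps the exponential in the unit disc. The condition covers real \<open>\<zeta>\<close> with
  arbitrary \<open>x\<close> as well as \<open>\<zeta>\<close> in the half-plane with
  \<open>x > 0\<close>.\<close>

lemma levy_kernel_bound:
  assumes "norm \<zeta> \<le> R" and "0 \<le> Im \<zeta> * x"
  shows "norm (exp (\<i> * \<zeta> * of_real x) - 1 - \<i> * \<zeta> * of_real (x / (1 + x\<^sup>2)))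
         \<le> (2 * R\<^sup>2 + 2 * R + 4) * (x\<^sup>2 / (1 + x\<^sup>2))"
proof -
  define w where "w = \<i> * \<zeta> * of_real x"
  define h where "h = x\<^sup>2 / (1 + x\<^sup>2)"
  have R: "0 \<le> R" using assms(1) norm_ge_zero order_trans by blast
  have re: "Re w \<le> 0" using assms(2) by (simp add: w_def mult.commute)
  have nw: "norm w \<le> R * \<bar>x\<bar>"
    using assms(1) by (simp add: w_def norm_mult mult_right_mono)
  have pos: "0 < 1 + x\<^sup>2" by (simp add: add_pos_nonneg)
  have h0: "0 \<le> h" by (simp add: h_def)
  have eq: "\<i> * \<zeta> * of_real (x / (1 + x\<^sup>2)) = w * of_real (1 / (1 + x\<^sup>2))"
    by (simp add: w_def)
  show ?thesis
  proof (cases "\<bar>x\<bar> \<le> 1")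
    case True
    then have x2: "x\<^sup>2 \<le> 1" by (simp add: abs_square_le_1)
    then have hx: "x\<^sup>2 \<le> 2 * h"
      using pos mult_right_mono[of "1 + x\<^sup>2" 2 "x\<^sup>2"] by (simp add: h_def field_simps)
    have split: "exp w - 1 - w * of_real (1 / (1 + x\<^sup>2)) = (exp w - 1 - w) + w * of_real h"
    proof -
      have e: "1 / (1 + x\<^sup>2) = 1 - h" using pos by (simp add: h_def field_simps)
      show ?thesis unfolding e of_real_diff of_real_1 by (simp add: algebra_simps)
    qed
    have "norm (exp w - 1 - w * of_real (1 / (1 + x\<^sup>2))) \<le> norm (exp w - 1 - w) + norm (w * of_real h)"
      unfolding split by (rule norm_triangle_ineq)
    also have "\<dots> \<le> (R * \<bar>x\<bar>)\<^sup>2 + R * 1 * h"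
    proof (intro add_mono)
      show "norm (exp w - 1 - w) \<le> (R * \<bar>x\<bar>)\<^sup>2"
        using norm_exp_minus_linear_le[OF re] power_mono[OF nw norm_ge_zero, of 2] by linarith
      have "norm w \<le> R * 1"
        using nw mult_left_mono[OF True R] by linarith
      then show "norm (w * of_real h) \<le> R * 1 * h"
        using h0 by (simp add: norm_mult mult_right_mono)
    qed
    also have "(R * \<bar>x\<bar>)\<^sup>2 = R\<^sup>2 * x\<^sup>2" by (simp add: power_mult_distrib)
    also have "R\<^sup>2 * x\<^sup>2 \<le> R\<^sup>2 * (2 * h)" using hx by (intro mult_left_mono) auto
    also have "R\<^sup>2 * (2 * h) + R * 1 * h \<le> (2 * R\<^sup>2 + 2 * R + 4) * h"
      using mult_nonneg_nonneg[OF R h0] h0 by (simp add: algebra_simps)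
    finally show ?thesis unfolding eq w_def[symmetric] h_def[symmetric] by simp
  next
    case False
    then have x1: "1 \<le> \<bar>x\<bar>" by simp
    have x2: "1 \<le> x\<^sup>2" using one_le_power[OF x1, of 2] by simp
    then have hx: "1 \<le> 2 * h" using pos by (simp add: h_def field_simps)
    have "norm (w * of_real (1 / (1 + x\<^sup>2))) \<le> R * \<bar>x\<bar> * (1 / (1 + x\<^sup>2))"
      unfolding norm_mult norm_of_real using nw pos R by (intro mult_mono) auto
    also have "\<dots> = R * (\<bar>x\<bar> / (1 + x\<^sup>2))" by simp
    also have "\<dots> \<le> R * 1"
    proof (intro mult_left_mono R)
      have "\<bar>x\<bar> * 1 \<le> \<bar>x\<bar> * \<bar>x\<bar>" using x1 by (intro mult_left_mono) auto
      then have "\<bar>x\<bar> \<le> x\<^sup>2" by (simp add: power2_eq_square)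
      then show "\<bar>x\<bar> / (1 + x\<^sup>2) \<le> 1" using pos by (simp add: divide_le_eq)
    qed
    finally have b2: "norm (w * of_real (1 / (1 + x\<^sup>2))) \<le> R" by simp
    have b1: "norm (exp w - 1) \<le> 2"
    proof -
      have "norm (exp w) \<le> 1" using re by simp
      then show ?thesis using norm_triangle_ineq4[of "exp w" 1] by (simp only: norm_one)
    qed
    have "norm (exp w - 1 - w * of_real (1 / (1 + x\<^sup>2))) \<le> 2 + R"
      using norm_triangle_ineq4[of "exp w - 1" "w * of_real (1 / (1 + x\<^sup>2))"] b1 b2 by linarith
    also have "\<dots> \<le> (2 + R) * (2 * h)"
      using mult_left_mono[OF hx, of "2 + R"] R by simp
    also have "\<dots> \<le> (2 * R\<^sup>2 + 2 * R + 4) * h"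
      using h0 mult_nonneg_nonneg[of "R\<^sup>2" h] by (simp add: algebra_simps)
    finally show ?thesis unfolding eq w_def[symmetric] h_def[symmetric] by simp
  qed
qed

text \<open>Differentiating in \<open>\<zeta>\<close> brings down a factor \<open>x\<close>. For large
  \<open>x\<close> it is absorbed by the exponential decay at rate \<open>d\<close>, which is why the
  derivative is taken inside the half-plane.\<close>

lemma levy_kernel_deriv_bound:
  assumes R: "norm \<zeta> \<le> R" and d: "0 < d" "d \<le> Im \<zeta>" and x: "0 < x"
  shows "norm (\<i> * of_real x * (exp (\<i> * \<zeta> * of_real x) - of_real (1 / (1 + x\<^sup>2))))
         \<le> (2 * (R + 1) + 2 * (1 / d + 1)) * (x\<^sup>2 / (1 + x\<^sup>2))"
proof -
  define w where "w = \<i> * \<zeta> * of_real x"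
  define h where "h = x\<^sup>2 / (1 + x\<^sup>2)"
  have R0: "0 \<le> R" using R norm_ge_zero order_trans by blast
  have re: "Re w \<le> 0" using d x by (simp add: w_def)
  have nw: "norm w \<le> R * x"
    using R x by (simp add: w_def norm_mult mult_right_mono)
  have pos: "0 < 1 + x\<^sup>2" by (simp add: add_pos_nonneg)
  have h0: "0 \<le> h" by (simp add: h_def)
  have n: "norm (\<i> * of_real x * (exp w - of_real (1 / (1 + x\<^sup>2)))) = x * norm (exp w - of_real (1 / (1 + x\<^sup>2)))"
    using x by (simp add: norm_mult)
  have "x * norm (exp w - of_real (1 / (1 + x\<^sup>2))) \<le> (2 * (R + 1) + 2 * (1 / d + 1)) * h"
  proof (cases "x \<le> 1")
    case True
    then have x2: "x\<^sup>2 \<le> 1" using x by (simp add: abs_square_le_1)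
    then have hx: "x\<^sup>2 \<le> 2 * h"
      using pos mult_right_mono[of "1 + x\<^sup>2" 2 "x\<^sup>2"] by (simp add: h_def field_simps)
    have h1: "1 / (1 + x\<^sup>2) = 1 - h" using pos by (simp add: h_def field_simps)
    have e: "exp w - of_real (1 / (1 + x\<^sup>2)) = (exp w - 1) + of_real h"
      unfolding h1 of_real_diff of_real_1 by (simp add: algebra_simps)
    have "norm (exp w - of_real (1 / (1 + x\<^sup>2))) \<le> R * x + h"
      unfolding e using norm_triangle_ineq[of "exp w - 1" "of_real h"] norm_exp_minus_1_le[OF re] nw h0
      by simp
    moreover have "h \<le> x" 
    proof -
      have "x \<le> 1 + x\<^sup>2" using True zero_le_power2[of x] by linarith
      then have "x * x \<le> x * (1 + x\<^sup>2)" using x by (intro mult_left_mono) auto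
      then show ?thesis using pos by (simp add: h_def power2_eq_square divide_le_eq)
    qed
    ultimately have "x * norm (exp w - of_real (1 / (1 + x\<^sup>2))) \<le> x * (R * x + x)"
      using x by (intro mult_left_mono) auto
    also have "\<dots> = (R + 1) * x\<^sup>2" by (simp add: power2_eq_square algebra_simps)
    also have "\<dots> \<le> (R + 1) * (2 * h)" using hx R0 by (intro mult_left_mono) auto
    also have "\<dots> \<le> (2 * (R + 1) + 2 * (1 / d + 1)) * h"
      using h0 d by (simp add: algebra_simps)
    finally show ?thesis .
  next
    case False
    then have x2: "1 \<le> x\<^sup>2" using x by (simp add: one_le_power)
    then have hx: "1 \<le> 2 * h" using pos by (simp add: h_def field_simps)
    have "x * norm (exp w) \<le> 1 / d"
    proof -
      have "d * x \<le> exp (d * x)" using exp_ge_add_one_self[of "d * x"] by linarith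
      then have "x * exp (- (d * x)) \<le> 1 / d"
        using d by (simp add: exp_minus field_simps)
      moreover have "norm (exp w) \<le> exp (- (d * x))"
        using d x by (simp add: w_def)
      ultimately show ?thesis
        using x mult_left_mono[of "norm (exp w)" "exp (- (d * x))" x] by linarith
    qed
    moreover have "x * (1 / (1 + x\<^sup>2)) \<le> 1"
    proof -
      have "x * 1 \<le> x * x" using False x by (intro mult_left_mono) auto
      then show ?thesis using pos by (simp add: power2_eq_square)
    qed
    moreover have "norm (exp w - of_real (1 / (1 + x\<^sup>2))) \<le> norm (exp w) + 1 / (1 + x\<^sup>2)"
      using norm_triangle_ineq4[of "exp w" "of_real (1 / (1 + x\<^sup>2))"] pos by (simp only: norm_of_real) simp
    then have "x * norm (exp w - of_real (1 / (1 + x\<^sup>2))) \<le> x * (norm (exp w) + 1 / (1 + x\<^sup>2))"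
      using x by (intro mult_left_mono) auto
    moreover have "x * (norm (exp w) + 1 / (1 + x\<^sup>2)) = x * norm (exp w) + x * (1 / (1 + x\<^sup>2))"
      by (rule distrib_left)
    ultimately have "x * norm (exp w - of_real (1 / (1 + x\<^sup>2))) \<le> 1 / d + 1"
      by linarith
    also have "\<dots> \<le> (1 / d + 1) * (2 * h)"
      using mult_left_mono[OF hx, of "1 / d + 1"] d by simp
    also have "\<dots> \<le> (2 * (R + 1) + 2 * (1 / d + 1)) * h"
      using h0 R0 by (simp add: algebra_simps)
    finally show ?thesis .
  qed
  then show ?thesis unfolding w_def[symmetric] h_def[symmetric] n .
qed

text \<open>Lets the dominating function depend on a bound for the parameter.\<close>

lemma bounded_localize_continuous_on:
  fixes f :: "complex \<Rightarrow> complex"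
  assumes "\<And>R. 0 < R \<Longrightarrow> continuous_on (S \<inter> ball 0 R) f"
  shows "continuous_on S f"
  unfolding continuous_on_def
proof
  fix z assume z: "z \<in> S"
  define R where "R = norm z + 1"
  have R: "0 < R" "z \<in> ball 0 R" by (auto simp: R_def add_nonneg_pos)
  have "(f \<longlongrightarrow> f z) (at z within S \<inter> ball 0 R)"
    using assms[OF R(1)] z R(2) by (auto simp: continuous_on_def)
  also have "at z within S \<inter> ball 0 R = at z within S"
    using R(2) by (intro at_within_nhd[of z "ball 0 R"]) auto
  finally show "(f \<longlongrightarrow> f z) (at z within S)" .
qed

lemma fourier_laplace_props:
  assumes M: "finite_measure M" and sets: "sets M = sets borel" and pos: "AE x in M. 0 \<le> x"
  shows fourier_laplace_integrable:
      "\<And>\<zeta>. 0 \<le> Im \<zeta> \<Longrightarrow> integrable M (\<lambda>x. exp (\<i> * \<zeta> * complex_of_real x))"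
    and fourier_laplace_bound: "\<And>\<zeta>. 0 \<le> Im \<zeta> \<Longrightarrow> norm (fourier_laplace M \<zeta>) \<le> measure M (space M)"
    and fourier_laplace_continuous: "continuous_on {\<zeta>. 0 \<le> Im \<zeta>} (fourier_laplace M)"
    and fourier_laplace_has_derivative:
      "\<And>\<zeta>. 0 < Im \<zeta> \<Longrightarrow> (fourier_laplace M has_field_derivative
          (CLINT x|M. \<i> * of_real x * exp (\<i> * \<zeta> * of_real x))) (at \<zeta>)"
proof -
  interpret finite_measure M by (rule M)
  have [measurable_cong]: "sets M = sets borel" by (rule sets)
  have bd: "AE x in M. norm (exp (\<i> * \<zeta> * complex_of_real x)) \<le> 1" if "0 \<le> Im \<zeta>" for \<zeta>
    using pos by eventually_elim (use that in simp)
  show int: "integrable M (\<lambda>x. exp (\<i> * \<zeta> * complex_of_real x))" if "0 \<le> Im \<zeta>" for \<zeta>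
    by (rule integrable_const_bound[OF bd[OF that]]) measurable
  show "norm (fourier_laplace M \<zeta>) \<le> measure M (space M)" if "0 \<le> Im \<zeta>" for \<zeta>
  proof -
    have "norm (fourier_laplace M \<zeta>) \<le> (\<integral>x. norm (exp (\<i> * \<zeta> * complex_of_real x)) \<partial>M)"
      unfolding fourier_laplace_def by (rule integral_norm_bound)
    also have "\<dots> \<le> (\<integral>x. 1 \<partial>M)"
      by (intro integral_mono_AE integrable_norm int that bd) simp
    finally show ?thesis by simp
  qed
  show "continuous_on {\<zeta>. 0 \<le> Im \<zeta>} (fourier_laplace M)"
    unfolding fourier_laplace_def[abs_def]
    by (rule continuous_on_lebesgue_integral_dominated[where g = "\<lambda>_. 1"])
       (use bd in \<open>auto intro!: continuous_intros\<close>)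
  show "(fourier_laplace M has_field_derivative
          (CLINT x|M. \<i> * of_real x * exp (\<i> * \<zeta> * of_real x))) (at \<zeta>)" if \<zeta>: "0 < Im \<zeta>" for \<zeta>
    unfolding fourier_laplace_def[abs_def]
  proof (rule has_field_derivative_lebesgue_integral[where r = "Im \<zeta> / 2" and g = "\<lambda>_. 2 / Im \<zeta>"])
    have im: "Im \<zeta> / 2 \<le> Im z" if "z \<in> ball \<zeta> (Im \<zeta> / 2)" for z
      using that abs_Im_le_cmod[of "\<zeta> - z"] by (auto simp: dist_norm)
    show "integrable M (\<lambda>x. exp (\<i> * z * complex_of_real x))" if "z \<in> ball \<zeta> (Im \<zeta> / 2)" for z
      using im[OF that] \<zeta> by (intro int) auto
    show "AE x in M. \<forall>z\<in>ball \<zeta> (Im \<zeta> / 2).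
       ((\<lambda>z. exp (\<i> * z * complex_of_real x)) has_field_derivative
         \<i> * of_real x * exp (\<i> * z * of_real x)) (at z) \<and>
       norm (\<i> * of_real x * exp (\<i> * z * of_real x)) \<le> 2 / Im \<zeta>"
      using pos
    proof eventually_elim
      case (elim x)
      show ?case
      proof safe
        fix z assume z: "z \<in> ball \<zeta> (Im \<zeta> / 2)"
        show "((\<lambda>z. exp (\<i> * z * complex_of_real x)) has_field_derivative
           \<i> * of_real x * exp (\<i> * z * of_real x)) (at z)"
          by (auto intro!: derivative_eq_intros)
        define d where "d = Im \<zeta> / 2"
        have d: "0 < d" "d \<le> Im z" using \<zeta> im[OF z] by (auto simp: d_def)
        have "d * x \<le> exp (d * x)" using exp_ge_add_one_self[of "d * x"] by linarith
        then have "x * exp (- (d * x)) \<le> 1 / d"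
          using d by (simp add: exp_minus field_simps)
        moreover have "exp (- (Im z * x)) \<le> exp (- (d * x))"
          using d elim by (simp add: mult_right_mono)
        ultimately have "x * exp (- (Im z * x)) \<le> 1 / d"
          using elim mult_left_mono[of "exp (- (Im z * x))" "exp (- (d * x))" x] by linarith
        then show "norm (\<i> * of_real x * exp (\<i> * z * of_real x)) \<le> 2 / Im \<zeta>"
          using elim by (simp add: norm_mult d_def)
      qed
    qed
  qed (use \<zeta> in auto)
qed

lemma levy_measure_integrable:
  assumes "levy_measure \<nu>"
  shows "integrable \<nu> (\<lambda>x. x\<^sup>2 / (1 + x\<^sup>2))"
  using assms unfolding levy_measure_def
  by (intro integrableI_nonneg) (auto cong: measurable_cong_sets)

lemma levy_kernel_integrable:
  assumes \<nu>: "levy_measure \<nu>" and pos: "AE x in \<nu>. 0 \<le> Im \<zeta> * x"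
  shows "integrable \<nu> (\<lambda>x. exp (\<i> * \<zeta> * of_real x) - 1 - \<i> * \<zeta> * of_real (x / (1 + x\<^sup>2)))"
proof -
  have [measurable_cong]: "sets \<nu> = sets borel" using \<nu> by (simp add: levy_measure_def)
  show ?thesis
  proof (rule Bochner_Integration.integrable_bound)
    show "integrable \<nu> (\<lambda>x. (2 * (norm \<zeta>)\<^sup>2 + 2 * norm \<zeta> + 4) * (x\<^sup>2 / (1 + x\<^sup>2)))"
      using levy_measure_integrable[OF \<nu>] by (rule integrable_mult_right)
    show "AE x in \<nu>. norm (exp (\<i> * \<zeta> * of_real x) - 1 - \<i> * \<zeta> * of_real (x / (1 + x\<^sup>2)))
        \<le> norm ((2 * (norm \<zeta>)\<^sup>2 + 2 * norm \<zeta> + 4) * (x\<^sup>2 / (1 + x\<^sup>2)))"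
      using pos
    proof eventually_elim
      case (elim x)
      then show ?case using levy_kernel_bound[of \<zeta> "norm \<zeta>" x]
        by (auto intro: order_trans)
    qed
  qed measurable
qed

lemma levy_symbol_continuous:
  assumes \<nu>: "levy_measure \<nu>" and pos: "\<And>z. z \<in> S \<Longrightarrow> AE x in \<nu>. 0 \<le> Im z * x"
  shows "continuous_on S (levy_symbol \<gamma> a \<nu>)"
proof (rule bounded_localize_continuous_on)
  fix R :: real assume "0 < R"
  have [measurable_cong]: "sets \<nu> = sets borel" using \<nu> by (simp add: levy_measure_def)
  show "continuous_on (S \<inter> ball 0 R) (levy_symbol \<gamma> a \<nu>)"
    unfolding levy_symbol_def[abs_def]
  proof (intro continuous_intros continuous_on_lebesgue_integral_dominated
      [where g = "\<lambda>x. (2 * R\<^sup>2 + 2 * R + 4) * (x\<^sup>2 / (1 + x\<^sup>2))"])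
    show "integrable \<nu> (\<lambda>x. (2 * R\<^sup>2 + 2 * R + 4) * (x\<^sup>2 / (1 + x\<^sup>2)))"
      using levy_measure_integrable[OF \<nu>] by (rule integrable_mult_right)
    fix z assume z: "z \<in> S \<inter> ball 0 R"
    have "AE x in \<nu>. 0 \<le> Im z * x" using pos z by auto
    then show "AE x in \<nu>. norm (exp (\<i> * z * of_real x) - 1 - \<i> * z * of_real (x / (1 + x\<^sup>2)))
        \<le> (2 * R\<^sup>2 + 2 * R + 4) * (x\<^sup>2 / (1 + x\<^sup>2))"
      by eventually_elim (use z in \<open>intro levy_kernel_bound; auto\<close>)
  qed auto
qed

definition levy_symbol_deriv :: "real \<Rightarrow> real \<Rightarrow> real measure \<Rightarrow> complex \<Rightarrow> complex" where
  "levy_symbol_deriv \<gamma> a \<nu> \<zeta> =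
     (CLINT x|\<nu>. \<i> * of_real x * (exp (\<i> * \<zeta> * of_real x) - of_real (1 / (1 + x\<^sup>2))))
     + \<i> * of_real \<gamma> - of_real a * \<zeta>"

lemma levy_symbol_has_derivative:
  assumes \<nu>: "levy_measure \<nu>" and pos: "AE x in \<nu>. 0 < x" and \<zeta>: "0 < Im \<zeta>"
  shows "(levy_symbol \<gamma> a \<nu> has_field_derivative levy_symbol_deriv \<gamma> a \<nu> \<zeta>) (at \<zeta>)"
proof -
  have [measurable_cong]: "sets \<nu> = sets borel" using \<nu> by (simp add: levy_measure_def)
  define R where "R = norm \<zeta> + Im \<zeta> / 2"
  define d where "d = Im \<zeta> / 2"
  have im: "d \<le> Im z" and nm: "norm z \<le> R" if "z \<in> ball \<zeta> d" for z
    using that abs_Im_le_cmod[of "\<zeta> - z"] norm_triangle_sub[of z \<zeta>]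
    by (auto simp: dist_norm d_def R_def norm_minus_commute)
  have d: "0 < d" using \<zeta> by (simp add: d_def)
  have "((\<lambda>\<zeta>. CLINT x|\<nu>. exp (\<i> * \<zeta> * of_real x) - 1 - \<i> * \<zeta> * of_real (x / (1 + x\<^sup>2)))
     has_field_derivative (CLINT x|\<nu>. \<i> * of_real x * (exp (\<i> * \<zeta> * of_real x) - of_real (1 / (1 + x\<^sup>2))))) (at \<zeta>)"
  proof (rule has_field_derivative_lebesgue_integral
      [where r = d and g = "\<lambda>x. (2 * (R + 1) + 2 * (1 / d + 1)) * (x\<^sup>2 / (1 + x\<^sup>2))"])
    show "integrable \<nu> (\<lambda>x. exp (\<i> * z * of_real x) - 1 - \<i> * z * of_real (x / (1 + x\<^sup>2)))"
      if "z \<in> ball \<zeta> d" for z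
    proof (rule levy_kernel_integrable[OF \<nu>])
      show "AE x in \<nu>. 0 \<le> Im z * x" using pos by eventually_elim (use im[OF that] d in simp)
    qed
    show "integrable \<nu> (\<lambda>x. (2 * (R + 1) + 2 * (1 / d + 1)) * (x\<^sup>2 / (1 + x\<^sup>2)))"
      using levy_measure_integrable[OF \<nu>] by (rule integrable_mult_right)
    show "AE x in \<nu>. \<forall>z\<in>ball \<zeta> d.
         ((\<lambda>z. exp (\<i> * z * of_real x) - 1 - \<i> * z * of_real (x / (1 + x\<^sup>2)))
           has_field_derivative \<i> * of_real x * (exp (\<i> * z * of_real x) - of_real (1 / (1 + x\<^sup>2)))) (at z) \<and>
         norm (\<i> * of_real x * (exp (\<i> * z * of_real x) - of_real (1 / (1 + x\<^sup>2))))
           \<le> (2 * (R + 1) + 2 * (1 / d + 1)) * (x\<^sup>2 / (1 + x\<^sup>2))"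
      using pos
    proof eventually_elim
      case (elim x)
      have e: "\<i> * z * of_real (x / (1 + x\<^sup>2)) = z * (\<i> * of_real x * of_real (1 / (1 + x\<^sup>2)))" for z
        by (simp add: algebra_simps)
      show ?case
      proof (intro ballI conjI)
        fix z assume z: "z \<in> ball \<zeta> d"
        show "((\<lambda>z. exp (\<i> * z * of_real x) - 1 - \<i> * z * of_real (x / (1 + x\<^sup>2)))
           has_field_derivative \<i> * of_real x * (exp (\<i> * z * of_real x) - of_real (1 / (1 + x\<^sup>2)))) (at z)"
          unfolding e
          by (rule derivative_eq_intros refl | simp only: mult_1 mult_zero_left)+ (simp add: algebra_simps)
      qed (intro levy_kernel_deriv_bound nm d im elim)
    qed
  qed (use d in auto)
  then show ?thesis
    unfolding levy_symbol_def[abs_def] levy_symbol_deriv_def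
    by (auto intro!: derivative_eq_intros)
qed

text \<open>Both sides continue analytically to the upper half-plane and agree on its boundary. Inside the
  half-plane the exponential factor makes the first moment finite, so the identity can be differentiated
  there even if \<open>\<rho>\<close> has no mean.\<close>

lemma char_eq_exp_levy_symbol:
  assumes rho: "real_distribution \<rho>" "AE x in \<rho>. 0 \<le> x"
    and \<nu>: "levy_measure \<nu>" "AE x in \<nu>. 0 < x"
    and ch: "\<And>z. char \<rho> z = exp (complex_of_real t * levy_exponent \<gamma> a \<nu> z)"
  shows fourier_laplace_eq_exp_levy_symbol:
      "\<And>\<zeta>. 0 \<le> Im \<zeta> \<Longrightarrow> fourier_laplace \<rho> \<zeta> = exp (of_real t * levy_symbol \<gamma> a \<nu> \<zeta>)"
    and fourier_laplace_deriv_eq: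
      "\<And>\<zeta>. 0 < Im \<zeta> \<Longrightarrow> (CLINT x|\<rho>. \<i> * of_real x * exp (\<i> * \<zeta> * of_real x))
        = of_real t * levy_symbol_deriv \<gamma> a \<nu> \<zeta> * fourier_laplace \<rho> \<zeta>"
proof -
  interpret real_distribution \<rho> by (rule rho)
  have fm: "finite_measure \<rho>" by unfold_locales
  note fl = fourier_laplace_props[OF fm events_eq_borel rho(2)]
  let ?E = "\<lambda>\<zeta>. exp (of_real t * levy_symbol \<gamma> a \<nu> \<zeta>)"
  have Ed: "(?E has_field_derivative of_real t * levy_symbol_deriv \<gamma> a \<nu> \<zeta> * ?E \<zeta>) (at \<zeta>)" if "0 < Im \<zeta>" for \<zeta>
    by (auto intro!: derivative_eq_intros levy_symbol_has_derivative[OF \<nu> that] simp: mult_ac)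
  show eq: "fourier_laplace \<rho> \<zeta> = ?E \<zeta>" if "0 \<le> Im \<zeta>" for \<zeta>
  proof -
    have "fourier_laplace \<rho> \<zeta> - ?E \<zeta> = 0"
    proof (rule upper_half_plane_eq_0[where f = "\<lambda>\<zeta>. fourier_laplace \<rho> \<zeta> - ?E \<zeta>"])
      have "AE x in \<nu>. 0 \<le> Im z * x" if "0 \<le> Im z" for z
        using \<nu>(2) by eventually_elim (use that in simp)
      then show "continuous_on {z. 0 \<le> Im z} (\<lambda>\<zeta>. fourier_laplace \<rho> \<zeta> - ?E \<zeta>)"
        by (intro continuous_intros fl(3) levy_symbol_continuous[OF \<nu>(1)]) auto
      show "(\<lambda>\<zeta>. fourier_laplace \<rho> \<zeta> - ?E \<zeta>) holomorphic_on {z. 0 < Im z}"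
      proof (rule holomorphic_onI)
        fix z :: complex assume "z \<in> {z. 0 < Im z}"
        then have z: "0 < Im z" by simp
        show "(\<lambda>\<zeta>. fourier_laplace \<rho> \<zeta> - ?E \<zeta>) field_differentiable at z within {z. 0 < Im z}"
          using DERIV_diff[OF fl(4)[OF z] Ed[OF z]] field_differentiable_at_within field_differentiable_def by blast
      qed
    qed (use that ch in \<open>auto simp: fourier_laplace_of_real levy_symbol_of_real\<close>)
    then show ?thesis by simp
  qed
  fix \<zeta> :: complex assume \<zeta>: "0 < Im \<zeta>"
  have "(?E has_field_derivative (CLINT x|\<rho>. \<i> * of_real x * exp (\<i> * \<zeta> * of_real x))) (at \<zeta>)"
  proof (rule has_field_derivative_transform_within_open[OF fl(4)[OF \<zeta>], where S = "{z. 0 < Im z}"])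
    show "open {z. 0 < Im z}" by (rule open_halfspace_Im_gt)
  qed (use \<zeta> eq in auto)
  from DERIV_unique[OF this Ed[OF \<zeta>]] eq[of \<zeta>] \<zeta>
  show "(CLINT x|\<rho>. \<i> * of_real x * exp (\<i> * \<zeta> * of_real x))
        = of_real t * levy_symbol_deriv \<gamma> a \<nu> \<zeta> * fourier_laplace \<rho> \<zeta>"
    by simp
qed

text \<open>The total masses agree at \<open>z = 0\<close>; after normalization this is the uniqueness theorem for
  characteristic functions.\<close>

lemma finite_measure_eqI_fourier:
  assumes M: "finite_measure M" "sets M = sets borel"
    and N: "finite_measure N" "sets N = sets borel"
    and eq: "\<And>z. fourier_laplace M (complex_of_real z) = fourier_laplace N (complex_of_real z)"
  shows "M = N"
proof -
  interpret M: finite_measure M by (rule M)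
  interpret N: finite_measure N by (rule N)
  have [measurable_cong]: "sets M = sets borel" "sets N = sets borel" by (rule M, rule N)
  define c where "c = measure M (space M)"
  have cN: "c = measure N (space N)"
  proof -
    have "complex_of_real (measure M (space M)) = complex_of_real (measure N (space N))"
      using eq[of 0] by (simp add: fourier_laplace_def scaleR_conv_of_real)
    then show ?thesis by (simp add: c_def)
  qed
  show ?thesis
  proof (cases "c = 0")
    case True
    have "emeasure M A = 0" "emeasure N A = 0" for A
    proof -
      have "emeasure M A \<le> emeasure M (space M)" "emeasure N A \<le> emeasure N (space N)"
        by (auto intro: emeasure_space)
      moreover have "emeasure M (space M) = 0" "emeasure N (space N) = 0"
        using True cN by (auto simp: c_def M.emeasure_eq_measure N.emeasure_eq_measure)
      ultimately show "emeasure M A = 0" "emeasure N A = 0" by simp_all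
    qed
    then show ?thesis using M N by (intro measure_eqI) auto
  next
    case False
    then have c: "0 < c" by (simp add: c_def less_le)
    have rd: "real_distribution (density L (\<lambda>_. ennreal (1 / c)))"
      if L: "finite_measure L" "sets L = sets borel" "measure L (space L) = c" for L
    proof -
      interpret L: finite_measure L by (rule L)
      show ?thesis
      proof (intro real_distribution.intro real_distribution_axioms.intro prob_spaceI)
        show "emeasure (density L (\<lambda>_. ennreal (1 / c))) (space (density L (\<lambda>_. ennreal (1 / c)))) = 1"
          using c L(3) by (simp add: emeasure_density_const L.emeasure_eq_measure flip: ennreal_mult)
      qed (use L sets_eq_imp_space_eq[OF L(2)] in auto)
    qed
    have ch: "char (density L (\<lambda>_. ennreal (1 / c))) z = fourier_laplace L (of_real z) / c"
      if L: "sets L = sets borel" for L z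
    proof -
      have [measurable_cong]: "sets L = sets borel" by (rule L)
      have "char (density L (\<lambda>_. ennreal (1 / c))) z = (CLINT x|L. (1 / c) *\<^sub>R exp (\<i> * of_real z * of_real x))"
        unfolding char_def using c by (subst integral_density) (auto simp: mult_ac)
      also have "\<dots> = (1 / c) *\<^sub>R fourier_laplace L (of_real z)"
        unfolding fourier_laplace_def by (rule integral_scaleR_right) 
      finally show ?thesis by (simp add: scaleR_conv_of_real)
    qed
    have "density M (\<lambda>_. ennreal (1 / c)) = density N (\<lambda>_. ennreal (1 / c))"
    proof (rule Levy_uniqueness)
      show "char (density M (\<lambda>_. ennreal (1 / c))) = char (density N (\<lambda>_. ennreal (1 / c)))"
        using eq by (simp add: fun_eq_iff ch M N)
    qed (use rd M N cN in \<open>auto simp: c_def\<close>)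
    then have "density (density M (\<lambda>_. ennreal (1 / c))) (\<lambda>_. ennreal c) = density (density N (\<lambda>_. ennreal (1 / c))) (\<lambda>_. ennreal c)"
      by simp
    then show ?thesis
      using c by (simp add: density_density_eq density_1 flip: ennreal_mult)
  qed
qed

section \<open>Infinitely divisible laws on the half-line\<close>

text \<open>The difference of two exponents of the same law is continuous, takes values in
  \<open>2 \<pi> i \<int>\<close> and vanishes at \<open>0\<close>. Hence the convolution powers do not
  depend on the triplet through which they are expressed.\<close>

lemma levy_exponent_unique:
  assumes 1: "levy_triplet \<mu> \<gamma> a \<nu>" and 2: "levy_triplet \<mu> \<gamma>' a' \<nu>'"
  shows "levy_exponent \<gamma> a \<nu> z = levy_exponent \<gamma>' a' \<nu>' z"
proof -
  define d where "d z = levy_exponent \<gamma> a \<nu> z - levy_exponent \<gamma>' a' \<nu>' z" for z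
  have cont: "continuous_on UNIV (levy_exponent g c n)" if "levy_measure n" for g c n
  proof -
    have "continuous_on \<real> (levy_symbol g c n)"
      by (rule levy_symbol_continuous[OF that]) (auto elim!: Reals_cases)
    then have "continuous_on UNIV (\<lambda>z. levy_symbol g c n (complex_of_real z))"
      by (rule continuous_on_compose2) (auto intro!: continuous_intros)
    then show ?thesis by (simp add: levy_symbol_of_real)
  qed
  have cd: "continuous_on UNIV d"
    unfolding d_def[abs_def] using 1 2 by (intro continuous_intros cont) (auto simp: levy_triplet_def)
  have e1: "exp (d z) = 1" for z
    using 1 2 by (simp add: d_def exp_diff levy_triplet_def)
  have "d constant_on UNIV"
  proof (rule continuous_discrete_range_constant)
    fix x :: real
    show "\<exists>e>0. \<forall>y. y \<in> UNIV \<and> d y \<noteq> d x \<longrightarrow> e \<le> norm (d y - d x)"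
    proof (intro exI[of _ "2 * pi"] conjI allI impI)
      fix y assume ne: "y \<in> UNIV \<and> d y \<noteq> d x"
      have "exp (d y - d x) = 1" by (simp add: exp_diff e1)
      then obtain n :: int where n: "Re (d y - d x) = 0" "Im (d y - d x) = of_int (2 * n) * pi"
        by (auto simp only: exp_eq_1)
      with ne have "n \<noteq> 0" by (auto simp: complex_eq_iff)
      then have "1 \<le> \<bar>real_of_int n\<bar>" by linarith
      then have "2 * pi * 1 \<le> 2 * pi * \<bar>real_of_int n\<bar>" by (intro mult_left_mono) auto
      also have "\<dots> = \<bar>Im (d y - d x)\<bar>" unfolding n by (simp add: abs_mult)
      also have "\<dots> \<le> norm (d y - d x)" by (rule abs_Im_le_cmod)
      finally show "2 * pi \<le> norm (d y - d x)" by simp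
    qed simp
  qed (use cd in auto)
  then have "d z = d 0" by (auto simp: constant_on_def)
  also have "d 0 = 0" by (simp add: d_def levy_exponent_def)
  finally show ?thesis by (simp add: d_def)
qed

text \<open>At \<open>\<zeta> = is\<close> the derivative of the exponent is, up to the factor \<open>i\<close>, the
  mean of the law with density proportional to \<open>e\<^sup>-\<^sup>s\<^sup>x\<close> with respect to
  \<open>\<mu>\<close>, which is nonnegative. This reads
  \<open>a s + \<integral> x (1/(1+x\<^sup>2) - e\<^sup>-\<^sup>s\<^sup>x) \<nu>(dx) \<le> \<gamma>\<close>.
  Both terms are nonnegative for large \<open>s\<close>, so \<open>a = 0\<close>, and monotone convergence
  gives the bound on the remaining integral.\<close>

lemma levy_triplet_half_line:
  fixes \<mu> \<nu> :: "real measure"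
  assumes trip: "levy_triplet \<mu> \<gamma> a \<nu>" and mu: "AE x in \<mu>. 0 \<le> x" and nu: "AE x in \<nu>. 0 < x"
  shows "a = 0" and "integrable \<nu> (\<lambda>x. x / (1 + x\<^sup>2))" and "(LINT x|\<nu>. x / (1 + x\<^sup>2)) \<le> \<gamma>"
proof -
  have rd: "real_distribution \<mu>" and lm: "levy_measure \<nu>" and a: "0 \<le> a"
    and ch: "char \<mu> z = exp (levy_exponent \<gamma> a \<nu> z)" for z
    using trip by (auto simp: levy_triplet_def)
  interpret real_distribution \<mu> by (rule rd)
  have [measurable_cong]: "sets \<nu> = sets borel" using lm by (simp add: levy_measure_def)
  have ch1: "char \<mu> z = exp (complex_of_real 1 * levy_exponent \<gamma> a \<nu> z)" for z by (simp add: ch)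
  define J where "J s x = x * (1 / (1 + x\<^sup>2) - exp (- s * x))" for s x :: real
  have J_int: "integrable \<nu> (J s)" if s: "1 \<le> s" for s
  proof (rule Bochner_Integration.integrable_bound)
    show "integrable \<nu> (\<lambda>x. (2 * (s + 1) + 2 * (1 / 1 + 1)) * (x\<^sup>2 / (1 + x\<^sup>2)))"
      using levy_measure_integrable[OF lm] by (rule integrable_mult_right)
    show "AE x in \<nu>. norm (J s x) \<le> norm ((2 * (s + 1) + 2 * (1 / 1 + 1)) * (x\<^sup>2 / (1 + x\<^sup>2)))"
      using nu
    proof eventually_elim
      case (elim x)
      have "\<i> * (\<i> * of_real s) * of_real x = of_real (- s * x)" by (simp add: algebra_simps)
      then have "\<i> * of_real x * (exp (\<i> * (\<i> * of_real s) * of_real x) - of_real (1 / (1 + x\<^sup>2))) = - \<i> * of_real (J s x)"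
        unfolding J_def by (simp only: exp_of_real of_real_diff[symmetric] of_real_mult[symmetric])
          (simp add: algebra_simps)
      moreover have "norm (\<i> * of_real x * (exp (\<i> * (\<i> * of_real s) * of_real x) - of_real (1 / (1 + x\<^sup>2))))
         \<le> (2 * (s + 1) + 2 * (1 / 1 + 1)) * (x\<^sup>2 / (1 + x\<^sup>2))"
        using s elim by (intro levy_kernel_deriv_bound) (auto simp: norm_mult)
      ultimately have "norm (J s x) \<le> (2 * (s + 1) + 2 * (1 / 1 + 1)) * (x\<^sup>2 / (1 + x\<^sup>2))"
        by (simp add: norm_mult)
      then show ?case by (rule order_trans) (simp only: real_norm_def abs_ge_self)
    qed
    show "J s \<in> borel_measurable \<nu>" unfolding J_def[abs_def] by measurable
  qed
  have J_nonneg: "0 \<le> J s x" if "2 \<le> s" "0 < x" for s x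
  proof -
    \<comment> \<open>\<open>1 + x\<^sup>2 \<le> (1 + x)\<^sup>2 \<le> e\<^sup>2\<^sup>x\<close>; this is where \<open>s \<ge> 2\<close> enters.\<close>
    have "(1 + x)\<^sup>2 \<le> (exp x)\<^sup>2" using that exp_ge_add_one_self[of x] by (intro power_mono) auto
    then have "1 + x\<^sup>2 \<le> exp (2 * x)"
      using that by (simp add: power2_eq_square algebra_simps flip: exp_add mult_2)
    also have "exp (2 * x) \<le> exp (s * x)" using that by simp
    finally have "exp (- s * x) \<le> 1 / (1 + x\<^sup>2)"
      using that by (simp add: exp_minus field_simps add_pos_nonneg)
    then show ?thesis using that by (simp add: J_def)
  qed
  \<comment> \<open>The differentiated exponential formula at \<open>\<zeta> = is\<close>, where both transforms are real.\<close>
  have main: "a * s + (LINT x|\<nu>. J s x) \<le> \<gamma>" if s: "2 \<le> s" for s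
  proof -
    have im: "0 < Im (\<i> * of_real s)" using s by simp
    have e: "\<i> * (\<i> * of_real s) * of_real x = complex_of_real (- s * x)" for x by (simp add: algebra_simps)
    have D: "levy_symbol_deriv \<gamma> a \<nu> (\<i> * of_real s) = \<i> * of_real (\<gamma> - a * s - (LINT x|\<nu>. J s x))"
    proof -
      have "(CLINT x|\<nu>. \<i> * of_real x * (exp (\<i> * (\<i> * of_real s) * of_real x) - of_real (1 / (1 + x\<^sup>2))))
          = (CLINT x|\<nu>. (- \<i>) * of_real (J s x))"
        unfolding e exp_of_real of_real_diff[symmetric] J_def
        by (intro Bochner_Integration.integral_cong) (auto simp: algebra_simps)
      also have "\<dots> = - \<i> * of_real (LINT x|\<nu>. J s x)"
        by (simp only: integral_mult_right_zero integral_complex_of_real)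
      finally show ?thesis unfolding levy_symbol_deriv_def by (simp add: algebra_simps)
    qed
    have fl: "fourier_laplace \<mu> (\<i> * of_real s) = of_real (LINT x|\<mu>. exp (- s * x))"
      unfolding fourier_laplace_def e exp_of_real by (rule integral_complex_of_real)
    have lhs: "(CLINT x|\<mu>. \<i> * of_real x * exp (\<i> * (\<i> * of_real s) * of_real x)) = \<i> * of_real (LINT x|\<mu>. x * exp (- s * x))"
      unfolding e exp_of_real by (simp add: mult.assoc flip: of_real_mult)
    have "complex_of_real (LINT x|\<mu>. x * exp (- s * x))
        = of_real ((\<gamma> - a * s - (LINT x|\<nu>. J s x)) * (LINT x|\<mu>. exp (- s * x)))"
      using fourier_laplace_deriv_eq[OF rd mu lm nu ch1 im] unfolding D lhs fl
      by (simp only: of_real_1 mult_1_left mult.assoc mult_cancel_left complex_i_not_zero of_real_mult) simp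
    then have "(LINT x|\<mu>. x * exp (- s * x)) = (\<gamma> - a * s - (LINT x|\<nu>. J s x)) * (LINT x|\<mu>. exp (- s * x))"
      by (simp only: of_real_eq_iff)
    moreover have "0 \<le> (LINT x|\<mu>. x * exp (- s * x))"
      using mu by (intro integral_nonneg_AE) auto
    moreover have "0 < (LINT x|\<mu>. exp (- s * x))"
    proof -
      have int: "integrable \<mu> (\<lambda>x. exp (- s * x))"
        using mu s by (intro integrable_const_bound[of _ 1]) auto
      have "(LINT x|\<mu>. exp (- s * x)) \<noteq> 0"
      proof
        assume "(LINT x|\<mu>. exp (- s * x)) = 0"
        then have "AE x in \<mu>. exp (- s * x) = 0"
          using int by (subst (asm) integral_nonneg_eq_0_iff_AE) auto
        then show False using AE_E_prob by (simp add: AE_const)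
      qed
      moreover have "0 \<le> (LINT x|\<mu>. exp (- s * x))" by (intro integral_nonneg_AE) auto
      ultimately show ?thesis by linarith
    qed
    ultimately have "0 \<le> \<gamma> - a * s - (LINT x|\<nu>. J s x)"
      by (metis zero_le_mult_iff linorder_not_le)
    then show ?thesis by simp
  qed
  have J0: "0 \<le> (LINT x|\<nu>. J s x)" if "2 \<le> s" for s
    using nu by (intro integral_nonneg_AE) (auto intro!: J_nonneg that elim!: eventually_mono)
  show "a = 0"
  proof (rule ccontr)
    assume "a \<noteq> 0"
    then have a: "0 < a" using a by simp
    \<comment> \<open>An \<open>s\<close> with \<open>a s > \<gamma>\<close>.\<close>
    have "a * max 2 ((\<bar>\<gamma>\<bar> + 1) / a) \<le> \<gamma>"
      using main[of "max 2 ((\<bar>\<gamma>\<bar> + 1) / a)"] J0[of "max 2 ((\<bar>\<gamma>\<bar> + 1) / a)"] by linarith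
    moreover have "a * ((\<bar>\<gamma>\<bar> + 1) / a) \<le> a * max 2 ((\<bar>\<gamma>\<bar> + 1) / a)"
      using a by (intro mult_left_mono) auto
    ultimately show False using a by simp
  qed
  have mono: "J s x \<le> J s' x" if "s \<le> s'" "0 < x" for s s' x
    using that by (simp add: J_def)
  define I where "I i = (LINT x|\<nu>. J (real (i + 2)) x)" for i
  have Ile: "I i \<le> \<gamma>" for i
    using main[of "real (i + 2)"] mult_nonneg_nonneg[OF a, of "real (i + 2)"] by (simp add: I_def)
  have "incseq I"
    unfolding I_def incseq_def
  proof (intro allI impI integral_mono_AE J_int)
    fix m n :: nat assume "m \<le> n"
    then show "AE x in \<nu>. J (real (m + 2)) x \<le> J (real (n + 2)) x"
      using nu by (auto intro!: mono elim!: eventually_mono)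
  qed auto
  then obtain L where L: "I \<longlonglongrightarrow> L" and "\<And>i. I i \<le> L"
    using incseq_convergent[of I \<gamma>] Ile by blast
  have conv: "has_bochner_integral \<nu> (\<lambda>x. x / (1 + x\<^sup>2)) L"
  proof (rule has_bochner_integral_monotone_convergence[where f = "\<lambda>i. J (real (i + 2))"])
    show "AE x in \<nu>. mono (\<lambda>n. J (real (n + 2)) x)"
      using nu by eventually_elim (auto intro!: monoI mono)
    show "AE x in \<nu>. (\<lambda>i. J (real (i + 2)) x) \<longlonglongrightarrow> x / (1 + x\<^sup>2)"
      using nu
    proof eventually_elim
      case (elim x)
      then have "(\<lambda>i. x * (1 / (1 + x\<^sup>2) - exp (- real (i + 2) * x))) \<longlonglongrightarrow> x * (1 / (1 + x\<^sup>2) - 0)"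
        by (intro tendsto_intros) real_asymp
      then show ?case by (simp add: J_def)
    qed
    show "(\<lambda>i. integral\<^sup>L \<nu> (J (real (i + 2)))) \<longlonglongrightarrow> L" using L by (simp add: I_def[abs_def])
  qed (auto intro!: J_int)
  then show "integrable \<nu> (\<lambda>x. x / (1 + x\<^sup>2))" by (rule has_bochner_integral_iff[THEN iffD1, THEN conjunct1])
  have "(LINT x|\<nu>. x / (1 + x\<^sup>2)) = L" using conv by (simp add: has_bochner_integral_iff)
  also have "L \<le> \<gamma>" using L Ile by (intro LIMSEQ_le_const2[OF L]) auto
  finally show "(LINT x|\<nu>. x / (1 + x\<^sup>2)) \<le> \<gamma>" .
qed

text \<open>When the compensator is integrable it can be moved into the drift. If the drift is nonnegative, all
  terms have nonpositive real part on the half-plane, so that the exponentials of the positive multiples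
  of the symbol stay in the unit disc.\<close>

lemma levy_symbol_drift_form:
  fixes \<nu> :: "real measure" and \<gamma> :: real
  assumes lm: "levy_measure \<nu>" and nu: "AE x in \<nu>. 0 < x"
    and int: "integrable \<nu> (\<lambda>x. x / (1 + x\<^sup>2))"
  defines "b \<equiv> \<gamma> - (LINT x|\<nu>. x / (1 + x\<^sup>2))"
  shows "\<And>\<zeta>. 0 \<le> Im \<zeta> \<Longrightarrow> levy_symbol \<gamma> 0 \<nu> \<zeta> = \<i> * of_real b * \<zeta> + (CLINT x|\<nu>. exp (\<i> * \<zeta> * of_real x) - 1)"
    and "\<And>\<zeta>. 0 < Im \<zeta> \<Longrightarrow> integrable \<nu> (\<lambda>x. of_real x * exp (\<i> * \<zeta> * of_real x))"
    and "\<And>\<zeta>. 0 < Im \<zeta> \<Longrightarrow> levy_symbol_deriv \<gamma> 0 \<nu> \<zeta> = \<i> * (of_real b + (CLINT x|\<nu>. of_real x * exp (\<i> * \<zeta> * of_real x)))"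
    and "\<And>\<zeta>. 0 \<le> Im \<zeta> \<Longrightarrow> 0 \<le> b \<Longrightarrow> Re (levy_symbol \<gamma> 0 \<nu> \<zeta>) \<le> 0"
proof -
  have [measurable_cong]: "sets \<nu> = sets borel" using lm by (simp add: levy_measure_def)
  have ci: "integrable \<nu> (\<lambda>x. c * complex_of_real (x / (1 + x\<^sup>2)))" for c
    by (intro integrable_mult_right integrable_of_real int)
  have ev: "(CLINT x|\<nu>. c * complex_of_real (x / (1 + x\<^sup>2))) = c * of_real (\<gamma> - b)" for c
    by (simp only: integral_mult_right_zero integral_complex_of_real b_def) simp
  have pos: "AE x in \<nu>. 0 \<le> Im \<zeta> * x" if "0 \<le> Im \<zeta>" for \<zeta>
    using nu by eventually_elim (use that in simp)
  have int1: "integrable \<nu> (\<lambda>x. exp (\<i> * \<zeta> * complex_of_real x) - 1)" if z: "0 \<le> Im \<zeta>" for \<zeta>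
    using Bochner_Integration.integrable_add[OF levy_kernel_integrable[OF lm pos[OF z]] ci[of "\<i> * \<zeta>"]] by simp
  show sym: "levy_symbol \<gamma> 0 \<nu> \<zeta> = \<i> * of_real b * \<zeta> + (CLINT x|\<nu>. exp (\<i> * \<zeta> * of_real x) - 1)" if z: "0 \<le> Im \<zeta>" for \<zeta>
    unfolding levy_symbol_def
    by (subst Bochner_Integration.integral_diff[OF int1[OF z] ci]) (simp add: ev b_def algebra_simps del: of_real_divide)
  show "Re (levy_symbol \<gamma> 0 \<nu> \<zeta>) \<le> 0" if z: "0 \<le> Im \<zeta>" and b: "0 \<le> b" for \<zeta>
  proof -
    have "Re (CLINT x|\<nu>. exp (\<i> * \<zeta> * of_real x) - 1) = (LINT x|\<nu>. Re (exp (\<i> * \<zeta> * of_real x) - 1))"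
      by (rule integral_Re[OF int1[OF z], symmetric])
    also have "\<dots> \<le> (LINT x|\<nu>. 0)"
    proof (rule integral_mono_AE)
      show "AE x in \<nu>. Re (exp (\<i> * \<zeta> * of_real x) - 1) \<le> 0"
        using nu
      proof eventually_elim
        case (elim x)
        have "Re (exp (\<i> * \<zeta> * of_real x)) \<le> norm (exp (\<i> * \<zeta> * of_real x))" by (rule complex_Re_le_cmod)
        also have "\<dots> \<le> 1" using elim z by simp
        finally show ?case by simp
      qed
    qed (rule integrable_Re[OF int1[OF z]], simp)
    finally have "Re (CLINT x|\<nu>. exp (\<i> * \<zeta> * of_real x) - 1) \<le> 0" by simp
    moreover have "0 \<le> b * Im \<zeta>" using z b by simp
    ultimately show ?thesis using z by (simp add: sym)
  qed
  have d: "integrable \<nu> (\<lambda>x. \<i> * of_real x * (exp (\<i> * \<zeta> * of_real x) - of_real (1 / (1 + x\<^sup>2))))" if z: "0 < Im \<zeta>" for \<zeta>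
  proof (rule Bochner_Integration.integrable_bound)
    let ?C = "2 * (norm \<zeta> + 1) + 2 * (1 / Im \<zeta> + 1)"
    show "integrable \<nu> (\<lambda>x. ?C * (x\<^sup>2 / (1 + x\<^sup>2)))"
      using levy_measure_integrable[OF lm] by (rule integrable_mult_right)
    show "AE x in \<nu>. norm (\<i> * of_real x * (exp (\<i> * \<zeta> * of_real x) - of_real (1 / (1 + x\<^sup>2)))) \<le> norm (?C * (x\<^sup>2 / (1 + x\<^sup>2)))"
      using nu
    proof eventually_elim
      case (elim x)
      then show ?case using levy_kernel_deriv_bound[of \<zeta> "norm \<zeta>" "Im \<zeta>" x] z
        unfolding real_norm_def by (meson abs_ge_self order_refl order_trans)
    qed
  qed measurable
  have e: "\<i> * of_real x * (w - of_real (1 / (1 + x\<^sup>2))) = \<i> * (of_real x * w) - \<i> * of_real (x / (1 + x\<^sup>2))" for x w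
    by (simp add: algebra_simps)
  show d2: "integrable \<nu> (\<lambda>x. of_real x * exp (\<i> * \<zeta> * of_real x))" if z: "0 < Im \<zeta>" for \<zeta>
  proof -
    have "integrable \<nu> (\<lambda>x. \<i> * (of_real x * exp (\<i> * \<zeta> * of_real x)))"
      using Bochner_Integration.integrable_add[OF d[OF z, unfolded e] ci[of "\<i>"]] by simp
    then have "integrable \<nu> (\<lambda>x. - \<i> * (\<i> * (of_real x * exp (\<i> * \<zeta> * of_real x))))"
      by (rule integrable_mult_right)
    moreover have "- \<i> * (\<i> * w) = w" for w by (simp flip: mult.assoc)
    ultimately show ?thesis by (simp only:)
  qed
  show "levy_symbol_deriv \<gamma> 0 \<nu> \<zeta> = \<i> * (of_real b + (CLINT x|\<nu>. of_real x * exp (\<i> * \<zeta> * of_real x)))" if z: "0 < Im \<zeta>" for \<zeta>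
    unfolding levy_symbol_deriv_def e
    by (subst Bochner_Integration.integral_diff[OF integrable_mult_right[OF d2[OF z]] ci])
       (simp add: ev b_def algebra_simps del: of_real_divide)
qed

lemma fourier_laplace_imaginary_tendsto_0:
  assumes M: "finite_measure M" "sets M = sets borel" and pos: "AE x in M. 0 < x"
  shows "(\<lambda>n. fourier_laplace M (\<i> * of_nat n)) \<longlonglongrightarrow> 0"
proof -
  interpret finite_measure M by (rule M)
  have [measurable_cong]: "sets M = sets borel" by (rule M)
  have "(\<lambda>n. CLINT x|M. exp (\<i> * (\<i> * of_nat n) * complex_of_real x)) \<longlonglongrightarrow> (CLINT x|M. 0)"
  proof (rule integral_dominated_convergence[where w = "\<lambda>_. 1"])
    show "AE x in M. (\<lambda>n. exp (\<i> * (\<i> * of_nat n) * complex_of_real x)) \<longlonglongrightarrow> 0"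
      using pos
    proof eventually_elim
      case (elim x)
      have "(\<lambda>n. exp (- real n * x)) \<longlonglongrightarrow> 0" using elim by real_asymp
      then have "(\<lambda>n. norm (exp (\<i> * (\<i> * of_nat n) * complex_of_real x))) \<longlonglongrightarrow> 0" by simp
      then show ?case by (rule tendsto_norm_zero_cancel)
    qed
    show "AE x in M. norm (exp (\<i> * (\<i> * of_nat n) * complex_of_real x)) \<le> 1" for n
      using pos by eventually_elim simp
  qed auto
  then show ?thesis by (simp add: fourier_laplace_def)
qed

text \<open>Split \<open>\<rho>\<close> into its restrictions \<open>P\<close> to \<open>[0,\<infinity>)\<close> and
  (reflected) \<open>N\<close> to \<open>(-\<infinity>,0)\<close>. The transform of the negative part
  continues to the lower half-plane, and on the real line it equals \<open>E\<close> minus the transform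
  of \<open>P\<close>, which continues to the upper one. The two continuations form a bounded entire
  function, so they are constant by Liouville's theorem. Along the negative imaginary axis the constant is
  seen to be \<open>0\<close>, and the negative part has no mass.\<close>

lemma half_line_of_bounded_half_plane_extension:
  assumes rho: "real_distribution \<rho>"
    and cont: "continuous_on {z. 0 \<le> Im z} E"
    and holo: "E holomorphic_on {z. 0 < Im z}"
    and bound: "\<And>z. 0 \<le> Im z \<Longrightarrow> norm (E z) \<le> 1"
    and ch: "\<And>x. E (of_real x) = char \<rho> x"
  shows "AE x in \<rho>. 0 \<le> x"
proof -
  interpret real_distribution \<rho> by (rule rho)
  define P where "P = density \<rho> (\<lambda>x. ennreal (indicator {0..} x))"
  define N where "N = distr (density \<rho> (\<lambda>x. ennreal (indicator {..<0} x))) borel uminus"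
  have setsP: "sets P = sets borel" and setsN: "sets N = sets borel" by (simp_all add: P_def N_def)
  have fd: "finite_measure (density \<rho> (\<lambda>x. ennreal (indicator A x)))" if "A \<in> sets borel" for A
    using that by (intro finite_measureI) (simp add: emeasure_density_const emeasure_density ennreal_indicator nn_integral_indicator emeasure_eq_measure)
  have fP: "finite_measure P" unfolding P_def by (rule fd) simp
  have fN: "finite_measure N" unfolding N_def by (rule finite_measure.finite_measure_distr[OF fd]) simp_all
  have posP: "AE x in P. 0 \<le> x" unfolding P_def by (subst AE_density) (auto simp: indicator_def)
  have posN: "AE x in N. 0 < x"
    unfolding N_def by (subst AE_distr_iff) (auto simp: AE_density indicator_def)
  then have posN': "AE x in N. 0 \<le> x" by eventually_elim simp
  note flP = fourier_laplace_props[OF fP setsP posP]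
  note flN = fourier_laplace_props[OF fN setsN posN']
  have P: "fourier_laplace P z = (CLINT x|\<rho>. indicator {0..} x *\<^sub>R exp (\<i> * z * of_real x))" for z
    unfolding P_def fourier_laplace_def by (subst integral_density) auto
  have N: "fourier_laplace N z = (CLINT x|\<rho>. indicator {..<0} x *\<^sub>R exp (- \<i> * z * of_real x))" for z
    unfolding N_def fourier_laplace_def by (subst integral_distr) (auto simp: integral_density)
  have split: "char \<rho> x = fourier_laplace P (of_real x) + fourier_laplace N (- of_real x)" for x
  proof -
    have "char \<rho> x = (CLINT y|\<rho>. indicator {0..} y *\<^sub>R exp (\<i> * of_real x * of_real y) + indicator {..<0} y *\<^sub>R exp (\<i> * of_real x * of_real y))"
      unfolding char_def by (intro Bochner_Integration.integral_cong) (auto simp: indicator_def mult.assoc)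
    also have "\<dots> = (CLINT y|\<rho>. indicator {0..} y *\<^sub>R exp (\<i> * of_real x * of_real y)) + (CLINT y|\<rho>. indicator {..<0} y *\<^sub>R exp (\<i> * of_real x * of_real y))"
      by (intro Bochner_Integration.integral_add integrable_const_bound[of _ 1]) (auto simp: indicator_def)
    finally show ?thesis by (simp add: P N mult.assoc)
  qed
  define h where "h = (\<lambda>z. if 0 \<le> Im z then E z - fourier_laplace P z else fourier_laplace N (- z))"
  have [simp]: "\<i> \<bullet> z = Im z" for z :: complex by (simp add: inner_complex_def)
  have contN: "continuous_on {z. Im z \<le> 0} (\<lambda>z. fourier_laplace N (- z))"
    by (rule continuous_on_compose2[OF flN(3)]) (auto intro!: continuous_intros)
  have "continuous_on ({z. 0 \<le> Im z} \<union> {z. Im z \<le> 0}) h"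
    unfolding h_def
  proof (rule continuous_on_cases)
    show "closed {z. 0 \<le> Im z}" "closed {z. Im z \<le> 0}"
      by (auto simp: closed_halfspace_Im_ge closed_halfspace_Im_le)
    show "\<forall>x. x \<in> {z. 0 \<le> Im z} \<and> \<not> 0 \<le> Im x \<or> x \<in> {z. Im z \<le> 0} \<and> 0 \<le> Im x
        \<longrightarrow> E x - fourier_laplace P x = fourier_laplace N (- x)"
    proof (safe)
      fix x :: complex assume "Im x \<le> 0" "0 \<le> Im x"
      then have "x = complex_of_real (Re x)" by (simp add: complex_eq_iff)
      then show "E x - fourier_laplace P x = fourier_laplace N (- x)"
        using split[of "Re x"] ch[of "Re x"] by (metis add_diff_cancel_left')
    qed
  qed (auto intro!: continuous_intros cont flP(3) contN)
  moreover have "{z. 0 \<le> Im z} \<union> {z. Im z \<le> 0} = UNIV" by auto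
  ultimately have hc: "continuous_on UNIV h" by simp
  have hh: "h holomorphic_on UNIV"
  proof (rule holomorphic_on_paste_across_line[of _ "\<i>" _ 0])
    show "h holomorphic_on UNIV \<inter> {z. \<i> \<bullet> z < 0}"
    proof (rule holomorphic_transform[of "\<lambda>z. fourier_laplace N (- z)"])
      show "(\<lambda>z. fourier_laplace N (- z)) holomorphic_on UNIV \<inter> {z. \<i> \<bullet> z < 0}"
      proof (rule holomorphic_onI)
        fix z :: complex assume "z \<in> UNIV \<inter> {z. \<i> \<bullet> z < 0}"
        then have "0 < Im (- z)" by simp
        from DERIV_chain2[OF flN(4)[OF this] DERIV_minus[OF DERIV_ident]]
        show "(\<lambda>z. fourier_laplace N (- z)) field_differentiable at z within UNIV \<inter> {z. \<i> \<bullet> z < 0}"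
          using field_differentiable_at_within field_differentiable_def by blast
      qed
    qed (auto simp: h_def)
    show "h holomorphic_on UNIV \<inter> {z. 0 < \<i> \<bullet> z}"
    proof (rule holomorphic_transform[of "\<lambda>z. E z - fourier_laplace P z"])
      have "fourier_laplace P holomorphic_on {z. 0 < Im z}"
      proof (rule holomorphic_onI)
        fix z :: complex assume "z \<in> {z. 0 < Im z}"
        then have "0 < Im z" by simp
        from flP(4)[OF this]
        show "fourier_laplace P field_differentiable at z within {z. 0 < Im z}"
          using field_differentiable_at_within field_differentiable_def by blast
      qed
      then show "(\<lambda>z. E z - fourier_laplace P z) holomorphic_on UNIV \<inter> {z. 0 < \<i> \<bullet> z}"
        using holo by (auto intro!: holomorphic_intros)
    qed (auto simp: h_def)
  qed (use hc in auto)
  have "bounded (range h)"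
  proof (rule boundedI)
    fix w assume "w \<in> range h"
    then obtain z where w: "w = h z" by auto
    show "norm w \<le> 1 + measure P (space P) + measure N (space N)"
    proof (cases "0 \<le> Im z")
      case True
      have "norm (E z - fourier_laplace P z) \<le> norm (E z) + norm (fourier_laplace P z)" by (rule norm_triangle_ineq4)
      also have "\<dots> \<le> 1 + measure P (space P)" using True by (intro add_mono bound flP(2))
      also have "\<dots> \<le> 1 + measure P (space P) + measure N (space N)" by simp
      finally show ?thesis using True by (simp add: w h_def)
    next
      case False
      then have "norm (fourier_laplace N (- z)) \<le> measure N (space N)" by (intro flN(2)) simp
      moreover have "0 \<le> measure P (space P)" by simp
      ultimately have "norm (fourier_laplace N (- z)) \<le> 1 + measure P (space P) + measure N (space N)" by linarith
      then show ?thesis using False by (simp add: w h_def)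
    qed
  qed
  then have "h constant_on UNIV" by (rule Liouville_theorem[OF hh])
  then obtain c where c: "\<And>z. h z = c" by (auto simp: constant_on_def)
  have "(\<lambda>n. h (- (\<i> * of_nat (Suc n)))) \<longlonglongrightarrow> 0"
    using LIMSEQ_Suc[OF fourier_laplace_imaginary_tendsto_0[OF fN setsN posN]] by (simp add: h_def)
  then have c0: "c = 0" by (simp add: c LIMSEQ_const_iff)
  have "h 0 = E (of_real 0) - fourier_laplace P 0" by (simp add: h_def)
  also have "E (of_real 0) = 1" by (simp only: ch char_zero)
  finally have "fourier_laplace P 0 = 1" by (simp add: c c0)
  then have "complex_of_real (prob {0..}) = 1"
    by (simp add: P scaleR_conv_of_real)
  then have "prob {0..} = 1" by simp
  then show ?thesis using prob_eq_1[of "{0..}"] by simp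
qed

section \<open>The size-bias identity\<close>

text \<open>A measure with density \<open>k\<close> on \<open>(0,\<infinity>)\<close> and an atom of mass
  \<open>b\<close> at \<open>0\<close> is the image under \<open>max 0\<close> of a measure with a
  Lebesgue density: the interval \<open>(-1,0]\<close> carries the mass of the atom.\<close>

lemma nn_integral_with_atom:
  fixes f :: "real \<Rightarrow> ennreal" and k :: "real \<Rightarrow> real"
  assumes [measurable]: "f \<in> borel_measurable borel" "k \<in> borel_measurable borel"
    and k: "\<And>y. y \<le> 0 \<Longrightarrow> k y = 0"
  shows "(\<integral>\<^sup>+y. f (max 0 y) * ennreal (if 0 < y then k y else if -1 < y then b else 0) \<partial>lborel)
       = (\<integral>\<^sup>+y. f y * ennreal (k y) \<partial>lborel) + f 0 * ennreal b"
proof -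
  have "(\<integral>\<^sup>+y. f (max 0 y) * ennreal (if 0 < y then k y else if -1 < y then b else 0) \<partial>lborel)
      = (\<integral>\<^sup>+y. f y * ennreal (k y) + f 0 * ennreal b * indicator {-1<..0} y \<partial>lborel)"
    by (intro nn_integral_cong) (auto simp: k indicator_def)
  also have "\<dots> = (\<integral>\<^sup>+y. f y * ennreal (k y) \<partial>lborel) + f 0 * ennreal b"
    by (subst nn_integral_add) (auto simp: nn_integral_cmult_indicator)
  finally show ?thesis .
qed

text \<open>On the line \<open>\<zeta> = z + i\<close> the differentiated exponential formula says that the finite
  measures \<open>x e\<^sup>-\<^sup>x \<rho>(dx)\<close> and
  \<open>t e\<^sup>-\<^sup>x (\<rho> * \<kappa>)(dx)\<close> have the same Fourier transform. Here
  \<open>\<kappa>\<close> has density \<open>k\<close> and an atom of mass \<open>b\<close> at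
  \<open>0\<close>; the exponential factor makes both measures finite.\<close>

lemma size_bias_identity:
  fixes \<rho> \<nu> :: "real measure" and k :: "real \<Rightarrow> real" and b t :: real
  assumes rho: "real_distribution \<rho>" "AE x in \<rho>. 0 \<le> x"
    and k_meas[measurable]: "k \<in> borel_measurable borel" and k_nonneg: "\<And>x. 0 \<le> k x" and k_0: "\<And>x. x \<le> 0 \<Longrightarrow> k x = 0"
    and nu: "\<nu> = density lborel (\<lambda>x. ennreal (k x / x))" and lm: "levy_measure \<nu>"
    and int: "integrable \<nu> (\<lambda>x. x / (1 + x\<^sup>2))"
    and b: "b = \<gamma> - (LINT x|\<nu>. x / (1 + x\<^sup>2))" "0 \<le> b" and t: "0 \<le> t"
    and ch: "\<And>z. char \<rho> z = exp (complex_of_real t * levy_exponent \<gamma> 0 \<nu> z)"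
    and g_meas[measurable]: "g \<in> borel_measurable borel"
  shows "(\<integral>\<^sup>+x. g x * ennreal x \<partial>\<rho>)
       = ennreal t * (\<integral>\<^sup>+u. (\<integral>\<^sup>+y. g (u + y) * ennreal (k y) \<partial>lborel) + g u * ennreal b \<partial>\<rho>)"
proof -
  interpret real_distribution \<rho> by (rule rho)
  interpret P: pair_sigma_finite \<rho> lborel ..
  \<comment> \<open>The atom of \<open>\<kappa>\<close> is spread over \<open>(-1,0]\<close>; then \<open>\<kappa>\<close> is the image under \<open>max 0\<close>.\<close>
  define kk where "kk y = (if 0 < y then k y else if -1 < y then b else 0)" for y :: real
  have kk_meas[measurable]: "kk \<in> borel_measurable borel" unfolding kk_def[abs_def] by measurable
  have kk_nonneg: "0 \<le> kk y" for y using k_nonneg b by (simp add: kk_def)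
  have nu_pos: "AE x in \<nu>. 0 < x"
    unfolding nu by (subst AE_density) (auto simp: k_0 not_less intro!: AE_I2 elim: meta_mp intro: ccontr)
  note df2 = levy_symbol_drift_form(2)[OF lm nu_pos int]
  note df3 = levy_symbol_drift_form(3)[OF lm nu_pos int, of _ \<gamma>, folded b(1)]
  let ?z = "\<lambda>z. complex_of_real z + \<i>"
  have kint: "complex_integrable lborel (\<lambda>y. exp (\<i> * ?z z * of_real y) * of_real (k y))"
    and kval: "(CLINT x|\<nu>. of_real x * exp (\<i> * ?z z * of_real x)) = (CLINT y|lborel. exp (\<i> * ?z z * of_real y) * of_real (k y))" for z
  proof -
    have eq: "(k x / x) *\<^sub>R (of_real x * exp (\<i> * ?z z * of_real x)) = exp (\<i> * ?z z * of_real x) * of_real (k x)" for x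
      by (cases "x = 0") (auto simp: k_0 scaleR_conv_of_real)
    have nn: "0 \<le> k x / x" for x using k_nonneg[of x] k_0[of x] by (cases "0 < x") auto
    have "integrable \<nu> (\<lambda>x. of_real x * exp (\<i> * ?z z * of_real x))" by (rule df2) simp
    then show "complex_integrable lborel (\<lambda>y. exp (\<i> * ?z z * of_real y) * of_real (k y))"
      unfolding nu by (subst (asm) integrable_density) (auto simp: eq nn simp del: scaleR_conv_of_real)
    show "(CLINT x|\<nu>. of_real x * exp (\<i> * ?z z * of_real x)) = (CLINT y|lborel. exp (\<i> * ?z z * of_real y) * of_real (k y))"
      unfolding nu by (subst integral_density) (auto simp: eq nn)
  qed
  have K1: "(\<integral>\<^sup>+y. ennreal (exp (- y)) * ennreal (k y) \<partial>lborel) < \<infinity>"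
  proof -
    have "(\<integral>\<^sup>+y. ennreal (norm (exp (\<i> * ?z 0 * of_real y) * of_real (k y))) \<partial>lborel) < \<infinity>"
      using kint[of 0] by (simp add: integrable_iff_bounded)
    then show ?thesis using k_nonneg by (simp add: norm_mult ennreal_mult'')
  qed
  have kkfin: "(\<integral>\<^sup>+y. ennreal (exp (- max 0 y)) * ennreal (kk y) \<partial>lborel) < \<infinity>"
    unfolding kk_def using nn_integral_with_atom[of "\<lambda>y. ennreal (exp (- y))" k b] K1 k_0
    by (simp add: ennreal_mult_less_top)
  have kkint: "complex_integrable lborel (\<lambda>y. exp (\<i> * ?z z * of_real (max 0 y)) * of_real (kk y))"
    and kkval: "(CLINT y|lborel. exp (\<i> * ?z z * of_real (max 0 y)) * of_real (kk y))
        = (CLINT y|lborel. exp (\<i> * ?z z * of_real y) * of_real (k y)) + of_real b" for z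
  proof -
    have e: "exp (\<i> * ?z z * of_real (max 0 y)) * of_real (kk y)
       = exp (\<i> * ?z z * of_real y) * of_real (k y) + indicator {-1<..0} y *\<^sub>R of_real b" for y
      by (auto simp: kk_def k_0 indicator_def)
    have ib: "complex_integrable lborel (\<lambda>y. indicator {-1<..(0::real)} y *\<^sub>R of_real b)"
      by (intro integrable_scaleR_left integrable_real_indicator) auto
    show "complex_integrable lborel (\<lambda>y. exp (\<i> * ?z z * of_real (max 0 y)) * of_real (kk y))"
      unfolding e by (intro Bochner_Integration.integrable_add kint ib)
    show "(CLINT y|lborel. exp (\<i> * ?z z * of_real (max 0 y)) * of_real (kk y))
        = (CLINT y|lborel. exp (\<i> * ?z z * of_real y) * of_real (k y)) + of_real b"
      unfolding e by (subst Bochner_Integration.integral_add[OF kint ib]) (simp add: scaleR_conv_of_real)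
  qed
  \<comment> \<open>\<open>A\<close> is \<open>x e\<^sup>-\<^sup>x \<rho>(dx)\<close>, and \<open>B\<close> is \<open>t e\<^sup>-\<^sup>x (\<rho> * \<kappa>)(dx)\<close>, the image of a weighted product measure under addition.\<close>
  define A where "A = density \<rho> (\<lambda>x. ennreal (x * exp (- x)))"
  define w where "w = (\<lambda>(u, y). t * (exp (- (u + max 0 y)) * kk y))"
  define s where "s = (\<lambda>(u, y::real). u + max 0 y)"
  define B where "B = distr (density (\<rho> \<Otimes>\<^sub>M lborel) (\<lambda>p. ennreal (w p))) borel s"
  have [measurable]: "w \<in> borel_measurable (\<rho> \<Otimes>\<^sub>M lborel)" "s \<in> borel_measurable (\<rho> \<Otimes>\<^sub>M lborel)"
    unfolding w_def s_def by measurable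
  have w_nonneg: "0 \<le> w p" for p using t kk_nonneg by (auto simp: w_def split: prod.split)
  have sets: "sets A = sets borel" "sets B = sets borel" by (simp_all add: A_def B_def)
  have "x * exp (- x) \<le> 1" for x :: real
  proof -
    have "x \<le> exp x" using exp_ge_add_one_self[of x] by linarith
    then show ?thesis by (simp add: exp_minus field_simps)
  qed
  then have xe: "ennreal (x * exp (- x)) \<le> 1" for x
    by (metis ennreal_leI ennreal_1)
  have fA: "finite_measure A"
  proof (rule finite_measureI)
    have "emeasure A (space A) = (\<integral>\<^sup>+x. ennreal (x * exp (- x)) \<partial>\<rho>)"
      unfolding A_def by (simp add: emeasure_density)
    also have "\<dots> \<le> (\<integral>\<^sup>+x. 1 \<partial>\<rho>)" by (intro nn_integral_mono xe)
    also have "\<dots> < \<infinity>" using emeasure_space_1 by (simp add: emeasure_eq_measure)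
    finally show "emeasure A (space A) \<noteq> \<infinity>" by simp
  qed
  have nnB0: "(\<integral>\<^sup>+x. f x \<partial>B) = (\<integral>\<^sup>+u. \<integral>\<^sup>+y. ennreal t * (f (u + max 0 y) * ennreal (exp (- (u + max 0 y))) * ennreal (kk y)) \<partial>lborel \<partial>\<rho>)"
    if [measurable]: "f \<in> borel_measurable borel" for f
  proof -
    have "(\<integral>\<^sup>+x. f x \<partial>B) = (\<integral>\<^sup>+p. ennreal (w p) * f (s p) \<partial>(\<rho> \<Otimes>\<^sub>M lborel))"
      unfolding B_def by (simp add: nn_integral_distr nn_integral_density)
    also have "\<dots> = (\<integral>\<^sup>+u. \<integral>\<^sup>+y. ennreal t * (f (u + max 0 y) * ennreal (exp (- (u + max 0 y))) * ennreal (kk y)) \<partial>lborel \<partial>\<rho>)"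
      by (subst lborel.nn_integral_fst[symmetric]) (auto intro!: nn_integral_cong simp: w_def s_def ennreal_mult t kk_nonneg mult_ac)
    finally show ?thesis .
  qed
  have nnB: "(\<integral>\<^sup>+x. f x \<partial>B) = ennreal t * (\<integral>\<^sup>+u. (\<integral>\<^sup>+y. f (u + y) * ennreal (exp (- (u + y))) * ennreal (k y) \<partial>lborel)
       + f u * ennreal (exp (- u)) * ennreal b \<partial>\<rho>)" if [measurable]: "f \<in> borel_measurable borel" for f
  proof -
    have "(\<integral>\<^sup>+x. f x \<partial>B) = (\<integral>\<^sup>+u. \<integral>\<^sup>+y. ennreal t * (f (u + max 0 y) * ennreal (exp (- (u + max 0 y))) * ennreal (kk y)) \<partial>lborel \<partial>\<rho>)"
      by (rule nnB0) measurable
    also have "\<dots> = (\<integral>\<^sup>+u. ennreal t * ((\<integral>\<^sup>+y. f (u + y) * ennreal (exp (- (u + y))) * ennreal (k y) \<partial>lborel)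
       + f u * ennreal (exp (- u)) * ennreal b) \<partial>\<rho>)"
      using nn_integral_with_atom[of "\<lambda>y. f (u + y) * ennreal (exp (- (u + y)))" k b for u] k_0
      by (intro nn_integral_cong) (subst nn_integral_cmult, measurable, simp add: kk_def)
    finally show ?thesis by (simp add: nn_integral_cmult)
  qed
  have fB: "finite_measure B"
  proof (rule finite_measureI)
    have ex: "ennreal (exp (- (u + v))) = ennreal (exp (- u)) * ennreal (exp (- v))" for u v :: real
      by (simp add: exp_diff exp_minus field_simps flip: ennreal_mult)
    have "emeasure B (space B) = (\<integral>\<^sup>+x. 1 \<partial>B)" by simp
    also have "\<dots> = (\<integral>\<^sup>+u. \<integral>\<^sup>+y. ennreal t * (1 * ennreal (exp (- (u + max 0 y))) * ennreal (kk y)) \<partial>lborel \<partial>\<rho>)"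
      by (rule nnB0) measurable
    also have "\<dots> = (\<integral>\<^sup>+u. \<integral>\<^sup>+y. ennreal t * (ennreal (exp (- u)) * (ennreal (exp (- max 0 y)) * ennreal (kk y))) \<partial>lborel \<partial>\<rho>)"
      unfolding ex by (simp add: mult.assoc)
    also have "\<dots> = ennreal t * ((\<integral>\<^sup>+u. ennreal (exp (- u)) \<partial>\<rho>) * (\<integral>\<^sup>+y. ennreal (exp (- max 0 y)) * ennreal (kk y) \<partial>lborel))"
      by (simp add: nn_integral_cmult nn_integral_multc)
    also have "\<dots> < \<infinity>"
    proof -
      have "(\<integral>\<^sup>+u. ennreal (exp (- u)) \<partial>\<rho>) \<le> (\<integral>\<^sup>+u. 1 \<partial>\<rho>)"
        using rho(2) by (intro nn_integral_mono_AE) auto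
      then have "(\<integral>\<^sup>+u. ennreal (exp (- u)) \<partial>\<rho>) < \<infinity>"
        using emeasure_space_1 le_less_trans by fastforce
      then show ?thesis using kkfin by (simp add: ennreal_mult_less_top)
    qed
    finally show "emeasure B (space B) \<noteq> \<infinity>" by simp
  qed
  \<comment> \<open>The exponential weights shift the argument of the transforms by \<open>i\<close>.\<close>
  have AB: "A = B"
  proof (rule finite_measure_eqI_fourier[OF fA sets(1) fB sets(2)])
    fix z :: real
    have ez: "exp (\<i> * ?z z * of_real x) = exp (- x) *\<^sub>R exp (\<i> * of_real z * of_real x)" for x
    proof -
      have "\<i> * ?z z * of_real x = of_real (- x) + \<i> * of_real z * of_real x" by (simp add: algebra_simps)
      then show ?thesis by (simp only: exp_add exp_of_real scaleR_conv_of_real)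
    qed
    have z: "0 < Im (?z z)" by simp
    have "AE x in \<rho>. 0 \<le> x * exp (- x)" using rho(2) by eventually_elim simp
    then have "fourier_laplace A z = (CLINT x|\<rho>. (x * exp (- x)) *\<^sub>R exp (\<i> * of_real z * of_real x))"
      unfolding fourier_laplace_def A_def by (subst integral_density) auto
    also have "\<dots> = (CLINT x|\<rho>. of_real x * exp (\<i> * ?z z * of_real x))"
      unfolding ez by (simp add: scaleR_conv_of_real mult.assoc)
    also have "\<dots> = of_real t * (of_real b + (CLINT y|lborel. exp (\<i> * ?z z * of_real y) * of_real (k y))) * fourier_laplace \<rho> (?z z)"
    proof -
      have "\<i> * (CLINT x|\<rho>. of_real x * exp (\<i> * ?z z * of_real x)) = (CLINT x|\<rho>. \<i> * of_real x * exp (\<i> * ?z z * of_real x))"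
        by (simp only: mult.assoc integral_mult_right_zero)
      also have "\<dots> = of_real t * (\<i> * (of_real b + (CLINT y|lborel. exp (\<i> * ?z z * of_real y) * of_real (k y)))) * fourier_laplace \<rho> (?z z)"
        by (simp only: fourier_laplace_deriv_eq[OF rho lm nu_pos ch z] df3[OF z] kval)
      finally show ?thesis by (simp add: algebra_simps del: distrib_left_numeral) (metis (no_types, lifting) complex_i_not_zero distrib_left mult.left_commute mult_cancel_left)
    qed
    also have "\<dots> = (CLINT p|(\<rho> \<Otimes>\<^sub>M lborel). w p *\<^sub>R exp (\<i> * of_real z * of_real (s p)))"
    proof -
      have wp: "w p *\<^sub>R exp (\<i> * of_real z * of_real (s p))
         = of_real t * (exp (\<i> * ?z z * of_real (fst p)) * (exp (\<i> * ?z z * of_real (max 0 (snd p))) * of_real (kk (snd p))))" for p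
      proof (cases p)
        case (Pair u y)
        have "exp (\<i> * of_real z * of_real (u + max 0 y)) = exp (\<i> * of_real z * of_real u) * exp (\<i> * of_real z * of_real (max 0 y))"
          by (simp only: of_real_add distrib_left exp_add)
        moreover have "exp (- (u + max 0 y)) = exp (- u) * exp (- max 0 y)" by (simp add: exp_minus exp_diff field_simps)
        ultimately show ?thesis
          unfolding Pair w_def s_def ez by (simp add: scaleR_conv_of_real mult_ac)
      qed
      have i1: "complex_integrable \<rho> (\<lambda>x. exp (\<i> * ?z z * of_real x))"
        using fourier_laplace_integrable[OF finite_measure_axioms events_eq_borel rho(2), of "?z z"] z by simp
      have "complex_integrable (\<rho> \<Otimes>\<^sub>M lborel) (\<lambda>p. exp (\<i> * ?z z * of_real (fst p)) * (exp (\<i> * ?z z * of_real (max 0 (snd p))) * of_real (kk (snd p))))"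
      proof (rule P.Fubini_integrable)
        show "integrable \<rho> (\<lambda>u. LINT y|lborel. norm (exp (\<i> * ?z z * of_real (fst (u, y))) *
            (exp (\<i> * ?z z * of_real (max 0 (snd (u, y)))) * of_real (kk (snd (u, y))))))"
          using i1 by (simp only: norm_mult fst_conv snd_conv integral_mult_right_zero) (intro integrable_mult_left integrable_norm)
        show "AE u in \<rho>. complex_integrable lborel (\<lambda>y. exp (\<i> * ?z z * of_real (fst (u, y))) *
            (exp (\<i> * ?z z * of_real (max 0 (snd (u, y)))) * of_real (kk (snd (u, y)))))"
          unfolding fst_conv snd_conv by (intro AE_I2 integrable_mult_right kkint)
      qed measurable
      then have "(CLINT p|(\<rho> \<Otimes>\<^sub>M lborel). exp (\<i> * ?z z * of_real (fst p)) * (exp (\<i> * ?z z * of_real (max 0 (snd p))) * of_real (kk (snd p))))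
         = (CLINT u|\<rho>. CLINT y|lborel. exp (\<i> * ?z z * of_real u) * (exp (\<i> * ?z z * of_real (max 0 y)) * of_real (kk y)))"
        by (subst P.integral_fst'[symmetric]) auto
      also have "\<dots> = fourier_laplace \<rho> (?z z) * ((CLINT y|lborel. exp (\<i> * ?z z * of_real y) * of_real (k y)) + of_real b)"
        unfolding fourier_laplace_def kkval[symmetric] by (simp only: integral_mult_right_zero integral_mult_left_zero)
      finally show ?thesis unfolding wp by (simp only: integral_mult_right_zero) (simp add: algebra_simps)
    qed
    also have "\<dots> = fourier_laplace B z"
      unfolding fourier_laplace_def B_def
      by (subst integral_distr) (auto simp: integral_density w_nonneg)
    finally show "fourier_laplace A z = fourier_laplace B z" .
  qed
  have "(\<integral>\<^sup>+x. g x * ennreal x \<partial>\<rho>) = (\<integral>\<^sup>+x. ennreal (x * exp (- x)) * (g x * ennreal (exp x)) \<partial>\<rho>)"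
    using rho(2)
  proof (intro nn_integral_cong_AE, eventually_elim)
    case (elim x)
    then have "ennreal x = ennreal (x * exp (- x)) * ennreal (exp x)"
      by (simp add: exp_minus flip: ennreal_mult)
    then show ?case by (simp add: mult_ac)
  qed
  also have "\<dots> = (\<integral>\<^sup>+x. g x * ennreal (exp x) \<partial>A)"
    unfolding A_def by (subst nn_integral_density) auto
  also have "\<dots> = ennreal t * (\<integral>\<^sup>+u. (\<integral>\<^sup>+y. g (u + y) * ennreal (k y) \<partial>lborel) + g u * ennreal b \<partial>\<rho>)"
  proof -
    have "ennreal (exp v) * ennreal (exp (- v)) = 1" for v
      by (simp add: exp_minus flip: ennreal_mult)
    then have e: "h * ennreal (exp v) * ennreal (exp (- v)) * c = h * c" for h c v
      by (simp add: mult.assoc[of h])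
    show ?thesis
      unfolding AB by (subst nnB) (measurable, simp only: e)
  qed
  finally show ?thesis .
qed

section \<open>From truncated means to tails\<close>

lemma nn_integral_inverse_square:
  fixes x :: real
  assumes "0 < x"
  shows "(\<integral>\<^sup>+w. ennreal (1 / w\<^sup>2) * indicator {x..} w \<partial>lborel) = ennreal (1 / x)"
proof -
  have "(\<integral>\<^sup>+w. ennreal (1 / w\<^sup>2) * indicator {x..} w \<partial>lborel) = ennreal (0 - (- 1 / x))"
  proof (rule nn_integral_FTC_atLeast)
    show "((\<lambda>a. - 1 / a) \<longlongrightarrow> (0::real)) at_top" by real_asymp
    show "\<And>w. x \<le> w \<Longrightarrow> ((\<lambda>a. - 1 / a) has_real_derivative 1 / w\<^sup>2) (at w)"
      using assms by (auto intro!: derivative_eq_intros simp: power2_eq_square)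
  qed auto
  then show ?thesis by simp
qed

text \<open>Since \<open>1 = z \<integral>\<^sub>z\<^sup>\<infinity> dw/w\<^sup>2\<close>, a tail is an average of
  increments of truncated means.\<close>

lemma tail_layer_cake:
  fixes N :: "real measure"
  assumes "sigma_finite_measure N" and [measurable_cong]: "sets N = sets borel" and x: "0 < x"
  shows "emeasure N {x<..} = (\<integral>\<^sup>+w. (\<integral>\<^sup>+z. ennreal z * indicator {x<..w} z \<partial>N) * (ennreal (1 / w\<^sup>2) * indicator {x..} w) \<partial>lborel)"
proof -
  interpret N: sigma_finite_measure N by (rule assms)
  interpret P: pair_sigma_finite N lborel ..
  have "(\<integral>\<^sup>+w. (\<integral>\<^sup>+z. ennreal z * indicator {x<..w} z \<partial>N) * (ennreal (1 / w\<^sup>2) * indicator {x..} w) \<partial>lborel)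
      = (\<integral>\<^sup>+w. \<integral>\<^sup>+z. ennreal z * indicator {x<..w} z * (ennreal (1 / w\<^sup>2) * indicator {x..} w) \<partial>N \<partial>lborel)"
    by (intro nn_integral_cong nn_integral_multc[symmetric]) measurable
  also have "\<dots> = (\<integral>\<^sup>+z. \<integral>\<^sup>+w. ennreal z * indicator {x<..w} z * (ennreal (1 / w\<^sup>2) * indicator {x..} w) \<partial>lborel \<partial>N)"
    by (rule P.Fubini') (simp add: indicator_def cong: measurable_cong_sets)
  also have "\<dots> = (\<integral>\<^sup>+z. indicator {x<..} z \<partial>N)"
  proof (rule nn_integral_cong)
    fix z :: real
    show "(\<integral>\<^sup>+w. ennreal z * indicator {x<..w} z * (ennreal (1 / w\<^sup>2) * indicator {x..} w) \<partial>lborel) = indicator {x<..} z"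
    proof (cases "x < z")
      case True
      have "(\<integral>\<^sup>+w. ennreal z * indicator {x<..w} z * (ennreal (1 / w\<^sup>2) * indicator {x..} w) \<partial>lborel)
          = (\<integral>\<^sup>+w. ennreal z * (ennreal (1 / w\<^sup>2) * indicator {z..} w) \<partial>lborel)"
        using True by (intro nn_integral_cong) (auto simp: indicator_def)
      also have "\<dots> = ennreal z * ennreal (1 / z)"
        using True x by (subst nn_integral_cmult) (auto simp: nn_integral_inverse_square)
      finally show ?thesis using True x by (simp flip: ennreal_mult)
    qed (auto simp: indicator_def intro!: nn_integral_0_iff_AE[THEN iffD2])
  qed
  finally show ?thesis by (simp add: nn_integral_indicator)
qed

lemma antimono_on_borel_measurable:
  fixes k :: "real \<Rightarrow> real"
  assumes "antimono_on {a<..} k"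
  shows "(\<lambda>x. indicator {a<..} x * k x) \<in> borel_measurable borel"
proof -
  have "mono_on {a<..} (\<lambda>x. - k x)"
    using assms by (auto simp: monotone_on_def)
  then have "(\<lambda>x. - k x) \<in> borel_measurable (restrict_space borel {a<..})"
    by (intro borel_measurable_mono_on_fnc) 
  then have "(\<lambda>x. - (- k x)) \<in> borel_measurable (restrict_space borel {a<..})"
    by (rule borel_measurable_uminus)
  then show ?thesis
    by (subst (asm) borel_measurable_restrict_space_iff) auto
qed

text \<open>A Levy measure \<open>k(x)/x dx\<close> on the half-line together with a drift \<open>b\<close>;
  \<open>k\<close> is normalized to vanish on \<open>(-\<infinity>,0]\<close>.\<close>

locale levy_tail =
  fixes k :: "real \<Rightarrow> real" and b :: real
  assumes k_antimono: "antimono_on {0<..} k"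
    and k_pos: "\<And>x. 0 < x \<Longrightarrow> 0 < k x"
    and k_zero: "\<And>x. x \<le> 0 \<Longrightarrow> k x = 0"
    and b_nonneg: "0 \<le> b"
    and k_int0: "set_integrable lborel {0..1} k"
    and k_int1: "set_integrable lborel {1..} (\<lambda>y. k y / y)"
begin

text \<open>\<open>G\<close> is the tail of the Levy measure, \<open>M\<close> the distribution function of \<open>\<kappa>(dy) = k(y)dy + b \<delta>\<^sub>0(dy)\<close>,
  and \<open>S R\<close> the convolution of \<open>R\<close> with \<open>\<kappa>\<close>.\<close>

definition G :: "real \<Rightarrow> real" where "G x = (LBINT y:{x..}. k y / y)"
definition M :: "real \<Rightarrow> real" where "M x = b + (LBINT y:{0..x}. k y)"
definition S :: "(real \<Rightarrow> real) \<Rightarrow> real \<Rightarrow> real" where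
  "S R x = (LBINT y:{0..x}. R (x - y) * k y) + b * R x"

lemma k_nonneg: "0 \<le> k x"
  using k_pos[of x] k_zero[of x] by (cases "0 < x") auto

lemma k_mono: "0 < x \<Longrightarrow> x \<le> y \<Longrightarrow> k y \<le> k x"
  using k_antimono by (auto simp: monotone_on_def)

lemma k_measurable [measurable]: "k \<in> borel_measurable borel"
proof -
  have "(\<lambda>x. indicator {0<..} x * k x) = k" using k_zero by (auto simp: indicator_def fun_eq_iff not_less)
  then show ?thesis using antimono_on_borel_measurable[OF k_antimono] by simp
qed

lemma k_integrable: "set_integrable lborel {0..x} k"
proof -
  have "set_integrable lborel {1..max 1 x} k"
  proof (rule set_integrable_bound)
    show "set_integrable lborel {1..max 1 x} (\<lambda>_. k 1)"
      by (simp add: set_integrable_def) 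
    show "AE y in lborel. y \<in> {1..max 1 x} \<longrightarrow> norm (k y) \<le> norm (k 1)"
      using k_mono[of 1] k_nonneg by (auto intro!: AE_I2)
  qed (simp add: set_borel_measurable_def)
  then have "set_integrable lborel ({0..1} \<union> {1..max 1 x}) k"
    by (intro set_integrable_Un k_int0) auto
  then show ?thesis
    by (rule set_integrable_subset) auto
qed

lemma k_div_nonneg: "0 \<le> k x / x"
  using k_nonneg[of x] k_zero[of x] by (cases "0 < x") auto

lemma k_div_integrable: "0 < x \<Longrightarrow> set_integrable lborel {x..} (\<lambda>y. k y / y)"
proof -
  assume x: "0 < x"
  have "set_integrable lborel {x..1} (\<lambda>y. k y / y)"
  proof (rule set_integrable_bound)
    show "set_integrable lborel {x..1} (\<lambda>_. k x / x)"
      by (intro borel_integrable_atLeastAtMost') auto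
    show "AE y in lborel. y \<in> {x..1} \<longrightarrow> norm (k y / y) \<le> norm (k x / x)"
      using k_mono[OF x] k_nonneg x by (auto intro!: AE_I2 frac_le)
  qed (simp add: set_borel_measurable_def)
  then have "set_integrable lborel ({x..1} \<union> {1..}) (\<lambda>y. k y / y)"
    by (intro set_integrable_Un k_int1) auto
  then show ?thesis
    by (rule set_integrable_subset) auto
qed

lemma M_mono: "mono M"
proof
  fix x y :: real assume "x \<le> y"
  have "(LBINT u:{0..x}. k u) \<le> (LBINT u:{0..y}. k u)"
    unfolding set_lebesgue_integral_def
    using k_integrable[of x] k_integrable[of y] k_nonneg \<open>x \<le> y\<close>
    by (intro integral_mono) (auto simp: set_integrable_def indicator_def)
  then show "M x \<le> M y" by (simp add: M_def)
qed

lemma nn_integral_k: "(\<integral>\<^sup>+y. ennreal (k y) * indicator {0..x} y \<partial>lborel) = ennreal (M x - b)"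
proof -
  have "(\<integral>\<^sup>+y. ennreal (indicator {0..x} y *\<^sub>R k y) \<partial>lborel) = ennreal (LBINT y:{0..x}. k y)"
    using k_integrable[of x] k_nonneg unfolding set_lebesgue_integral_def set_integrable_def
    by (intro nn_integral_eq_integral) auto
  moreover have "ennreal (indicator {0..x} y *\<^sub>R k y) = ennreal (k y) * indicator {0..x} y" for y
    by (auto simp: indicator_def)
  ultimately show ?thesis by (simp add: M_def)
qed

lemma M_ge_b: "b \<le> M x"
  unfolding M_def using k_nonneg by (simp add: set_lebesgue_integral_def integral_nonneg_AE)

lemma M_pos: "0 < x \<Longrightarrow> 0 < M x"
proof -
  assume x: "0 < x"
  have "0 < x * k x" using x k_pos[OF x] by simp
  also have "\<dots> = (LBINT y:{0..x}. k x)" using x by (simp add: set_lebesgue_integral_def)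
  also have "\<dots> \<le> (LBINT y:{0..x}. k y)"
  proof (rule set_integral_mono_AE)
    show "set_integrable lborel {0..x} (\<lambda>_. k x)"
      by (intro borel_integrable_atLeastAtMost') auto
    show "AE y\<in>{0..x} in lborel. k x \<le> k y"
      using AE_lborel_singleton[of 0] by eventually_elim (auto intro!: k_mono)
  qed (rule k_integrable)
  finally show ?thesis using b_nonneg by (simp add: M_def)
qed

end

text \<open>What the asymptotic analysis uses of the tail \<open>R\<close> of a \<open>t\<close>-th convolution
  power. The exact formula \<open>tail_diff\<close> is the source of all second-order terms;
  \<open>tail_moment\<close> expresses the integrated tail, and \<open>tail_lower\<close> is a first-order
  lower bound.\<close>

locale conv_tail = levy_tail +
  fixes R :: "real \<Rightarrow> real" and t :: real
  assumes t_pos: "0 < t"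
    and R_antimono: "antimono R" and R_nonneg: "\<And>x. 0 \<le> R x" and R_le_1: "\<And>x. R x \<le> 1"
    and R_lim: "(R \<longlongrightarrow> 0) at_top"
    and S_integrable: "\<And>x. 0 < x \<Longrightarrow> set_integrable lborel {x..} (\<lambda>w. S R w / w\<^sup>2)"
    and tail_diff: "\<And>x. 0 < x \<Longrightarrow> R x - t * G x = t * (S R x / x - (LBINT w:{x..}. S R w / w\<^sup>2))"
    and tail_moment: "\<And>x. 0 < x \<Longrightarrow> (LBINT u:{0..x}. R u) = t * (M x - S R x) + x * R x"
    and tail_lower: "\<And>x A. 0 < x \<Longrightarrow> 0 < A \<Longrightarrow> t * (1 - R A) * (x / (x + A)) * G x \<le> R x"

lemma (in levy_tail) G_eq_tail:
  assumes "0 < x"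
  shows "emeasure (density lborel (\<lambda>x. ennreal (k x / x))) {x<..} = ennreal (G x)"
proof -
  have "emeasure (density lborel (\<lambda>x. ennreal (k x / x))) {x<..} = (\<integral>\<^sup>+y. ennreal (k y / y) * indicator {x<..} y \<partial>lborel)"
    by (simp add: emeasure_density)
  also have "\<dots> = (\<integral>\<^sup>+y. ennreal (indicator {x..} y *\<^sub>R (k y / y)) \<partial>lborel)"
    by (intro nn_integral_cong_AE, use AE_lborel_singleton[of x] in eventually_elim) (auto simp: indicator_def)
  also have "\<dots> = ennreal (G x)"
    unfolding G_def set_lebesgue_integral_def
  proof (rule nn_integral_eq_integral)
    show "integrable lborel (\<lambda>y. indicator {x..} y *\<^sub>R (k y / y))"
      using k_div_integrable[OF assms] by (simp add: set_integrable_def)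
  qed (intro AE_I2 scaleR_nonneg_nonneg k_div_nonneg, simp)
  finally show ?thesis .
qed

lemma (in levy_tail) G_nonneg: "0 \<le> G x"
  unfolding G_def set_lebesgue_integral_def
  by (intro integral_nonneg_AE AE_I2 scaleR_nonneg_nonneg k_div_nonneg) simp

lemma (in levy_tail) G_eq_nn: "0 < x \<Longrightarrow> (\<integral>\<^sup>+y. ennreal (k y / y) * indicator {x<..} y \<partial>lborel) = ennreal (G x)"
  using G_eq_tail[of x] by (simp add: emeasure_density)

lemma (in levy_tail) M_measurable [measurable]: "M \<in> borel_measurable borel"
  by (rule borel_measurable_mono[OF M_mono])

lemma (in levy_tail) M_layer_cake:
  assumes x: "0 < x"
  shows "has_bochner_integral lborel (\<lambda>w. indicator {x..} w *\<^sub>R ((M w - M x) / w\<^sup>2)) (G x)"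
proof -
  define \<nu> where "\<nu> = density lborel (\<lambda>x. ennreal (k x / x))"
  have Minc: "(\<integral>\<^sup>+z. ennreal z * indicator {x<..w} z \<partial>\<nu>) = ennreal (M w - M x)" if "0 < x" "x \<le> w" for x w
  proof -
    have "(\<integral>\<^sup>+z. ennreal z * indicator {x<..w} z \<partial>\<nu>) = (\<integral>\<^sup>+y. ennreal (k y) * indicator {x<..w} y \<partial>lborel)"
      unfolding \<nu>_def
    proof (subst nn_integral_density)
      show "(\<integral>\<^sup>+z. ennreal (k z / z) * (ennreal z * indicator {x<..w} z) \<partial>lborel) = (\<integral>\<^sup>+y. ennreal (k y) * indicator {x<..w} y \<partial>lborel)"
        using that k_div_nonneg by (intro nn_integral_cong) (auto simp: indicator_def simp flip: ennreal_mult)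
    qed auto
    also have "(\<integral>\<^sup>+y. ennreal (k y) * indicator {0..w} y \<partial>lborel) = (\<integral>\<^sup>+y. ennreal (k y) * indicator {0..x} y \<partial>lborel) + (\<integral>\<^sup>+y. ennreal (k y) * indicator {x<..w} y \<partial>lborel)"
      using that by (subst nn_integral_add[symmetric]) (auto intro!: nn_integral_cong simp: indicator_def)
    then have "(\<integral>\<^sup>+y. ennreal (k y) * indicator {x<..w} y \<partial>lborel) = ennreal (M w - b) - ennreal (M x - b)"
      unfolding nn_integral_k by simp
    also have "\<dots> = ennreal (M w - M x)" using M_ge_b by (subst ennreal_minus) auto
    finally show ?thesis .
  qed
    have m: "(\<lambda>x. ennreal (k x / x)) \<in> borel_measurable lborel" by (measurable | simp | auto)
    have fin: "AE x in lborel. ennreal (k x / x) \<noteq> \<infinity>" by (rule AE_I2) simp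
    have sf: "sigma_finite_measure \<nu>"
      unfolding \<nu>_def
      by (rule sigma_finite_measure.sigma_finite_iff_density_finite[OF lborel.sigma_finite_measure_axioms m, THEN iffD2, OF fin])
    have "ennreal (G x) = (\<integral>\<^sup>+w. (\<integral>\<^sup>+z. ennreal z * indicator {x<..w} z \<partial>\<nu>) * (ennreal (1 / w\<^sup>2) * indicator {x..} w) \<partial>lborel)"
      by (subst tail_layer_cake[symmetric]) (use sf G_eq_tail[OF x] in \<open>auto simp: x \<nu>_def\<close>)
    also have "\<dots> = (\<integral>\<^sup>+w. ennreal (indicator {x..} w *\<^sub>R ((M w - M x) / w\<^sup>2)) \<partial>lborel)"
    proof (rule nn_integral_cong)
      fix w
      show "(\<integral>\<^sup>+z. ennreal z * indicator {x<..w} z \<partial>\<nu>) * (ennreal (1 / w\<^sup>2) * indicator {x..} w)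
          = ennreal (indicator {x..} w *\<^sub>R ((M w - M x) / w\<^sup>2))"
      proof (cases "x \<le> w")
        case True
        then show ?thesis using x monoD[OF M_mono True] by (simp add: Minc[OF x True] ennreal_mult[symmetric])
      qed simp
    qed
    finally show ?thesis
      using M_mono G_nonneg by (intro has_bochner_integral_nn_integral) (auto simp: indicator_def mono_def)
  qed

lemma has_bochner_integral_inverse_square:
  fixes x c :: real
  assumes x: "0 < x"
  shows "has_bochner_integral lborel (\<lambda>w. indicator {x..} w *\<^sub>R (c / w\<^sup>2)) (c / x)"
proof -
    have "has_bochner_integral lborel (\<lambda>w. indicator {x..} w *\<^sub>R (1 / w\<^sup>2)) (1 / x)"
      using x nn_integral_inverse_square[OF x]
      by (intro has_bochner_integral_nn_integral) (auto simp: ennreal_indicator[symmetric] mult.commute simp flip: ennreal_mult)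
    from has_bochner_integral_mult_right[OF this, of c] show ?thesis by (simp add: mult.commute)
qed

text \<open>The primitive of \<open>M(w)/w\<^sup>2\<close> is explicit. This replaces integration by parts when the
  index is \<open>0\<close>.\<close>

lemma (in levy_tail) M_div_square_integral:
  assumes x: "0 < x"
  shows "set_integrable lborel {x..} (\<lambda>w. M w / w\<^sup>2)" and "(LBINT w:{x..}. M w / w\<^sup>2) = G x + M x / x"
proof -
  have "has_bochner_integral lborel (\<lambda>w. indicator {x..} w *\<^sub>R ((M w - M x) / w\<^sup>2) + indicator {x..} w *\<^sub>R (M x / w\<^sup>2)) (G x + M x / x)"
    by (intro has_bochner_integral_add M_layer_cake has_bochner_integral_inverse_square x)
  moreover have "indicator {x..} w *\<^sub>R ((M w - M x) / w\<^sup>2) + indicator {x..} w *\<^sub>R (M x / w\<^sup>2) = indicator {x..} w *\<^sub>R (M w / w\<^sup>2)" for w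
    by (simp add: diff_divide_distrib algebra_simps)
  ultimately have "has_bochner_integral lborel (\<lambda>w. indicator {x..} w *\<^sub>R (M w / w\<^sup>2)) (G x + M x / x)" by simp
  then show "set_integrable lborel {x..} (\<lambda>w. M w / w\<^sup>2)" "(LBINT w:{x..}. M w / w\<^sup>2) = G x + M x / x"
    by (auto simp: set_integrable_def set_lebesgue_integral_def has_bochner_integral_iff)
qed

text \<open>On \<open>[0,w]\<close> the size-bias identity evaluates the truncated mean of \<open>\<rho>\<close> as
  \<open>t (M - S)\<close>. The tail formula follows by applying \<open>tail_layer_cake\<close> to
  \<open>\<rho>\<close> and to the Levy measure and subtracting. The lower bound comes from the identity
  with the test function \<open>1/z\<close> on \<open>(x,\<infinity>)\<close>, keeping only those pairs in
  which the jump alone exceeds \<open>x\<close> and the other summand is at most \<open>A\<close>.\<close>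

lemma (in levy_tail) conv_tail_of_size_bias:
  fixes \<rho> :: "real measure" and t :: real
  assumes rho: "real_distribution \<rho>" "AE x in \<rho>. 0 \<le> x" and t: "0 < t"
    and sb: "\<And>g. g \<in> borel_measurable borel \<Longrightarrow> (\<integral>\<^sup>+x. g x * ennreal x \<partial>\<rho>)
       = ennreal t * (\<integral>\<^sup>+u. (\<integral>\<^sup>+y. g (u + y) * ennreal (k y) \<partial>lborel) + g u * ennreal b \<partial>\<rho>)"
  shows "conv_tail k b (tail \<rho>) t"
    and "\<And>w. 0 < w \<Longrightarrow> (\<integral>\<^sup>+z. ennreal z * indicator {..w} z \<partial>\<rho>) = ennreal (t * (M w - S (tail \<rho>) w))"
    and "\<And>w. 0 < w \<Longrightarrow> S (tail \<rho>) w \<le> M w"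
proof -
  interpret real_distribution \<rho> by (rule rho)
  interpret P: pair_sigma_finite \<rho> lborel ..
  define R where "R = tail \<rho>"
  have Rp: "R x = prob {x<..}" for x by (simp add: R_def tail_def)
  have R_anti: "antimono R" by (auto simp: antimono_def Rp intro!: finite_measure_mono)
  have R0: "0 \<le> R x" and R1: "R x \<le> 1" for x by (auto simp: Rp)
  have R_meas[measurable]: "R \<in> borel_measurable borel"
  proof -
    have "mono (\<lambda>x. - R x)" using R_anti by (auto simp: mono_def antimono_def)
    then have "(\<lambda>x. - (- R x)) \<in> borel_measurable borel"
      by (intro borel_measurable_uminus borel_measurable_mono)
    then show ?thesis by simp
  qed
  have compl: "prob {..x} = 1 - R x" for x
  proof -
    have "{x<..} = space \<rho> - {..x}" by auto
    then show ?thesis using prob_compl[of "{..x}"] by (simp add: Rp)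
  qed
  have neg: "prob {..x} = 0" if "x < 0" for x
  proof -
    have "AE y in \<rho>. y \<notin> {..x}" using rho(2) by eventually_elim (use that in auto)
    then show ?thesis using prob_eq_0[of "{..x}"] by simp
  qed
  have R_lim: "(R \<longlongrightarrow> 0) at_top"
  proof -
    have "((\<lambda>x. 1 - cdf \<rho> x) \<longlongrightarrow> 1 - 1) at_top"
      using cdf_lim_at_top_prob by (intro tendsto_intros) auto
    moreover have "1 - cdf \<rho> x = R x" for x by (simp add: cdf_def compl)
    ultimately show ?thesis by simp
  qed
  have Rk_int: "set_integrable lborel {0..w} (\<lambda>y. R (w - y) * k y)" for w
  proof (rule set_integrable_bound[OF k_integrable[of w]])
    show "AE y in lborel. y \<in> {0..w} \<longrightarrow> norm (R (w - y) * k y) \<le> norm (k y)"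
      using k_nonneg R0 R1 by (auto intro!: AE_I2 mult_left_le_one_le simp: abs_mult)
  qed (simp add: set_borel_measurable_def)
  have MS: "M w - S R w = (LBINT y:{0..w}. (1 - R (w - y)) * k y) + b * (1 - R w)" for w
  proof -
    have "(LBINT y:{0..w}. (1 - R (w - y)) * k y) = (LBINT y:{0..w}. k y) - (LBINT y:{0..w}. R (w - y) * k y)"
      by (subst set_integral_diff(2)[symmetric, OF k_integrable Rk_int]) (simp add: algebra_simps)
    then show ?thesis by (simp add: M_def S_def algebra_simps)
  qed
  have MS_nonneg: "0 \<le> M w - S R w" for w
    unfolding MS using R1 k_nonneg b_nonneg
    by (intro add_nonneg_nonneg mult_nonneg_nonneg) (auto simp: set_lebesgue_integral_def intro!: integral_nonneg_AE)
  \<comment> \<open>The size-bias identity for the indicator of \<open>(-\<infinity>,w]\<close>, with \<open>\<rho>(-\<infinity>,v] = 1 - R(v)\<close>.\<close>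
  have V: "(\<integral>\<^sup>+z. ennreal z * indicator {..w} z \<partial>\<rho>) = ennreal (t * (M w - S R w))" if w: "0 < w" for w
  proof -
    have "(\<integral>\<^sup>+z. ennreal z * indicator {..w} z \<partial>\<rho>) = (\<integral>\<^sup>+z. indicator {..w} z * ennreal z \<partial>\<rho>)"
      by (simp add: mult.commute)
    also have "\<dots> = ennreal t * (\<integral>\<^sup>+u. (\<integral>\<^sup>+y. indicator {..w} (u + y) * ennreal (k y) \<partial>lborel) + indicator {..w} u * ennreal b \<partial>\<rho>)"
      by (rule sb) measurable
    also have "(\<integral>\<^sup>+u. (\<integral>\<^sup>+y. indicator {..w} (u + y) * ennreal (k y) \<partial>lborel) + indicator {..w} u * ennreal b \<partial>\<rho>)
        = (\<integral>\<^sup>+u. \<integral>\<^sup>+y. indicator {..w} (u + y) * ennreal (k y) \<partial>lborel \<partial>\<rho>) + ennreal (1 - R w) * ennreal b"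
      by (subst nn_integral_add) (auto simp: nn_integral_multc emeasure_eq_measure compl)
    also have "(\<integral>\<^sup>+u. \<integral>\<^sup>+y. indicator {..w} (u + y) * ennreal (k y) \<partial>lborel \<partial>\<rho>)
        = (\<integral>\<^sup>+y. \<integral>\<^sup>+u. indicator {..w} (u + y) * ennreal (k y) \<partial>\<rho> \<partial>lborel)"
      by (rule P.Fubini'[symmetric]) measurable
    also have "\<dots> = (\<integral>\<^sup>+y. ennreal (indicator {0..w} y *\<^sub>R ((1 - R (w - y)) * k y)) \<partial>lborel)"
    proof (rule nn_integral_cong)
      fix y
      have "(\<integral>\<^sup>+u. indicator {..w} (u + y) * ennreal (k y) \<partial>\<rho>) = (\<integral>\<^sup>+u. indicator {..w - y} u * ennreal (k y) \<partial>\<rho>)"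
        by (intro nn_integral_cong) (auto simp: indicator_def)
      also have "\<dots> = ennreal (prob {..w - y}) * ennreal (k y)"
        by (simp add: nn_integral_multc emeasure_eq_measure)
      also have "\<dots> = ennreal (indicator {0..w} y *\<^sub>R ((1 - R (w - y)) * k y))"
        using neg[of "w - y"] R1[of "w - y"]
        by (cases "y < 0 \<or> w < y") (auto simp: indicator_def k_zero compl ennreal_mult k_nonneg)
      finally show "(\<integral>\<^sup>+u. indicator {..w} (u + y) * ennreal (k y) \<partial>\<rho>) = ennreal (indicator {0..w} y *\<^sub>R ((1 - R (w - y)) * k y))" .
    qed
    also have "\<dots> = ennreal (LBINT y:{0..w}. (1 - R (w - y)) * k y)"
      unfolding set_lebesgue_integral_def
    proof (rule nn_integral_eq_integral)
      have "set_integrable lborel {0..w} (\<lambda>y. k y - R (w - y) * k y)"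
        by (intro set_integral_diff(1) k_integrable Rk_int)
      then show "integrable lborel (\<lambda>y. indicator {0..w} y *\<^sub>R ((1 - R (w - y)) * k y))"
        by (simp add: set_integrable_def algebra_simps)
    qed (use R1 k_nonneg in auto)
    also have "ennreal (LBINT y:{0..w}. (1 - R (w - y)) * k y) + ennreal (1 - R w) * ennreal b = ennreal (M w - S R w)"
      unfolding MS using R1 k_nonneg b_nonneg
      by (subst ennreal_mult[symmetric]; simp)
         (subst ennreal_plus[symmetric]; auto simp: set_lebesgue_integral_def mult.commute intro!: integral_nonneg_AE)
    also have "ennreal t * ennreal (M w - S R w) = ennreal (t * (M w - S R w))"
      using t MS_nonneg by (simp add: ennreal_mult)
    finally show ?thesis .
  qed
  then show "\<And>w. 0 < w \<Longrightarrow> (\<integral>\<^sup>+z. ennreal z * indicator {..w} z \<partial>\<rho>) = ennreal (t * (M w - S (tail \<rho>) w))"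
    by (simp add: R_def)
  show "\<And>w. 0 < w \<Longrightarrow> S (tail \<rho>) w \<le> M w" using MS_nonneg by (simp add: R_def)
  have Vinc: "(\<integral>\<^sup>+z. ennreal z * indicator {x<..w} z \<partial>\<rho>) = ennreal (t * ((M w - S R w) - (M x - S R x)))" 
    and Vmono: "M x - S R x \<le> M w - S R w" if "0 < x" "x \<le> w" for x w
  proof -
    have "(\<integral>\<^sup>+z. ennreal z * indicator {..w} z \<partial>\<rho>) = (\<integral>\<^sup>+z. ennreal z * indicator {..x} z + ennreal z * indicator {x<..w} z \<partial>\<rho>)"
      using that by (intro nn_integral_cong) (auto simp: indicator_def)
    also have "\<dots> = (\<integral>\<^sup>+z. ennreal z * indicator {..x} z \<partial>\<rho>) + (\<integral>\<^sup>+z. ennreal z * indicator {x<..w} z \<partial>\<rho>)"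
      by (rule nn_integral_add) auto
    finally have e: "ennreal (t * (M w - S R w)) = ennreal (t * (M x - S R x)) + (\<integral>\<^sup>+z. ennreal z * indicator {x<..w} z \<partial>\<rho>)"
      using that by (simp add: V)
    then have "ennreal (t * (M x - S R x)) \<le> ennreal (t * (M w - S R w))" by simp
    then show "M x - S R x \<le> M w - S R w"
      using t MS_nonneg by (subst (asm) ennreal_le_iff) (auto simp: mult_le_cancel_left)
    have "(\<integral>\<^sup>+z. ennreal z * indicator {x<..w} z \<partial>\<rho>) = ennreal (t * (M w - S R w)) - ennreal (t * (M x - S R x))"
      unfolding e by simp
    also have "\<dots> = ennreal (t * (M w - S R w) - t * (M x - S R x))"
      using t MS_nonneg by (intro ennreal_minus) auto
    finally show "(\<integral>\<^sup>+z. ennreal z * indicator {x<..w} z \<partial>\<rho>) = ennreal (t * ((M w - S R w) - (M x - S R x)))"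
      by (simp add: algebra_simps)
  qed
  have S_meas[measurable]: "S R \<in> borel_measurable borel"
  proof -
    have "(\<lambda>x. LBINT y:{0..x}. R (x - y) * k y) = (\<lambda>x. \<integral>y. (if 0 \<le> y \<and> y \<le> x then R (x - y) * k y else 0) \<partial>lborel)"
      by (intro ext) (auto simp: set_lebesgue_integral_def indicator_def intro!: Bochner_Integration.integral_cong)
    moreover have "(\<lambda>x. \<integral>y. (if 0 \<le> y \<and> y \<le> x then R (x - y) * k y else 0) \<partial>lborel) \<in> borel_measurable borel"
      by measurable
    ultimately have [measurable]: "(\<lambda>x. LBINT y:{0..x}. R (x - y) * k y) \<in> borel_measurable borel" by simp
    show ?thesis unfolding S_def[abs_def] by measurable
  qed
  have HR: "has_bochner_integral lborel (\<lambda>w. indicator {x..} w *\<^sub>R (t * ((M w - S R w) - (M x - S R x)) / w\<^sup>2)) (R x)" if x: "0 < x" for x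
  proof -
    have "ennreal (R x) = (\<integral>\<^sup>+w. (\<integral>\<^sup>+z. ennreal z * indicator {x<..w} z \<partial>\<rho>) * (ennreal (1 / w\<^sup>2) * indicator {x..} w) \<partial>lborel)"
      by (subst tail_layer_cake[symmetric]) (auto simp: x Rp emeasure_eq_measure sigma_finite_measure_axioms)
    also have "\<dots> = (\<integral>\<^sup>+w. ennreal (indicator {x..} w *\<^sub>R (t * ((M w - S R w) - (M x - S R x)) / w\<^sup>2)) \<partial>lborel)"
    proof (rule nn_integral_cong)
      fix w
      show "(\<integral>\<^sup>+z. ennreal z * indicator {x<..w} z \<partial>\<rho>) * (ennreal (1 / w\<^sup>2) * indicator {x..} w)
          = ennreal (indicator {x..} w *\<^sub>R (t * ((M w - S R w) - (M x - S R x)) / w\<^sup>2))"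
      proof (cases "x \<le> w")
        case True
        then show ?thesis using x t Vmono[OF x True] by (simp add: Vinc[OF x True] ennreal_mult[symmetric])
      qed simp
    qed
    finally show "has_bochner_integral lborel (\<lambda>w. indicator {x..} w *\<^sub>R (t * ((M w - S R w) - (M x - S R x)) / w\<^sup>2)) (R x)"
      using R0 t Vmono[OF x] by (intro has_bochner_integral_nn_integral) (auto simp: indicator_def)
  qed
  note HG = M_layer_cake and Hc = has_bochner_integral_inverse_square
  \<comment> \<open>Solving the difference of the two layer-cake formulas for the integral of \<open>S\<close>.\<close>
  have HS: "has_bochner_integral lborel (\<lambda>w. indicator {x..} w *\<^sub>R (S R w / w\<^sup>2)) (G x + S R x / x - R x / t)" if x: "0 < x" for x
  proof -
    have "has_bochner_integral lborel (\<lambda>w. indicator {x..} w *\<^sub>R ((M w - M x) / w\<^sup>2) + indicator {x..} w *\<^sub>R (S R x / w\<^sup>2)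
       - (1 / t) * (indicator {x..} w *\<^sub>R (t * ((M w - S R w) - (M x - S R x)) / w\<^sup>2))) (G x + S R x / x - (1 / t) * R x)"
      by (intro has_bochner_integral_diff has_bochner_integral_add has_bochner_integral_mult_right HG HR Hc x)
    moreover have "indicator {x..} w *\<^sub>R ((M w - M x) / w\<^sup>2) + indicator {x..} w *\<^sub>R (S R x / w\<^sup>2)
       - (1 / t) * (indicator {x..} w *\<^sub>R (t * ((M w - S R w) - (M x - S R x)) / w\<^sup>2)) = indicator {x..} w *\<^sub>R (S R w / w\<^sup>2)" for w
      using t by (auto simp: indicator_def diff_divide_distrib add_divide_distrib right_diff_distrib)
    ultimately show ?thesis by simp
  qed
  \<comment> \<open>Test function \<open>1/z\<close> on \<open>(x,\<infinity>)\<close>; for \<open>y > x\<close> and \<open>0 \<le> u \<le> A\<close> one has \<open>1/(u + y) \<ge> (x/(x + A)) / y\<close>.\<close>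
  have low: "t * (1 - R A) * (x / (x + A)) * G x \<le> R x" if x: "0 < x" and A: "0 < A" for x A
  proof -
    define g where "g z = ennreal (1 / z) * indicator {x<..} z" for z
    have [measurable]: "g \<in> borel_measurable borel" unfolding g_def by measurable
    have "ennreal (R x) = (\<integral>\<^sup>+z. indicator {x<..} z \<partial>\<rho>)" by (simp add: Rp emeasure_eq_measure)
    also have "\<dots> = (\<integral>\<^sup>+z. g z * ennreal z \<partial>\<rho>)"
      using x by (intro nn_integral_cong) (auto simp: g_def indicator_def simp flip: ennreal_mult)
    also have "\<dots> = ennreal t * (\<integral>\<^sup>+u. (\<integral>\<^sup>+y. g (u + y) * ennreal (k y) \<partial>lborel) + g u * ennreal b \<partial>\<rho>)"
      by (rule sb) measurable
    also have "\<dots> \<ge> ennreal t * (\<integral>\<^sup>+u. (ennreal (x / (x + A)) * ennreal (G x)) * indicator {..A} u \<partial>\<rho>)"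
    proof (intro mult_left_mono nn_integral_mono_AE, use rho(2) in eventually_elim)
      case (elim u)
      show ?case
      proof (cases "u \<le> A")
        case True
        have "ennreal (x / (x + A)) * ennreal (G x) = (\<integral>\<^sup>+y. ennreal (x / (x + A)) * (ennreal (k y / y) * indicator {x<..} y) \<partial>lborel)"
          by (subst nn_integral_cmult) (auto simp: G_eq_nn[OF x])
        also have "\<dots> \<le> (\<integral>\<^sup>+y. g (u + y) * ennreal (k y) \<partial>lborel)"
        proof (intro nn_integral_mono)
          fix y
          show "ennreal (x / (x + A)) * (ennreal (k y / y) * indicator {x<..} y) \<le> g (u + y) * ennreal (k y)"
          proof (cases "x < y")
            case xy: True
            have "x / (x + A) * (1 / y) \<le> 1 / (u + y)"
            proof -
              have "x * u \<le> y * A" using xy x elim True by (intro mult_mono) auto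
              then have "x * (u + y) \<le> (x + A) * y" by (simp add: algebra_simps)
              then have "x \<le> ((x + A) * y) / (u + y)" using xy x elim by (subst pos_le_divide_eq) auto
              then have "x / ((x + A) * y) \<le> 1 / (u + y)" using xy x A by (subst pos_divide_le_eq) auto
              then show ?thesis by simp
            qed
            then have "x / (x + A) * (1 / y) * k y \<le> 1 / (u + y) * k y" using k_nonneg by (rule mult_right_mono)
            then show ?thesis using xy x A elim k_div_nonneg[of y] k_nonneg[of y]
              by (auto simp: g_def ennreal_mult[symmetric] intro!: ennreal_leI)
          qed simp
        qed
        also have "\<dots> \<le> (\<integral>\<^sup>+y. g (u + y) * ennreal (k y) \<partial>lborel) + g u * ennreal b" by simp
        finally show ?thesis using True by simp
      qed simp
    qed simp
    also have "ennreal t * (\<integral>\<^sup>+u. (ennreal (x / (x + A)) * ennreal (G x)) * indicator {..A} u \<partial>\<rho>)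
        = ennreal t * (ennreal (x / (x + A)) * ennreal (G x) * ennreal (1 - R A))"
      by (simp add: nn_integral_cmult_indicator emeasure_eq_measure compl)
    also have "\<dots> = ennreal (t * (1 - R A) * (x / (x + A)) * G x)"
    proof -
      show ?thesis using G_nonneg[of x] x A t R1[of A] by (simp add: ennreal_mult[symmetric] mult_ac)
    qed
    finally show ?thesis using R0 by (simp add: ennreal_le_iff)
  qed
  have mom: "(LBINT u:{0..x}. R u) = t * (M x - S R x) + x * R x" if x: "0 < x" for x
  proof -
    have "(\<integral>\<^sup>+u. ennreal (R u) * indicator {0..x} u \<partial>lborel) = (\<integral>\<^sup>+u. \<integral>\<^sup>+z. indicator {u<..} z * indicator {0..x} u \<partial>\<rho> \<partial>lborel)"
      by (intro nn_integral_cong) (simp add: nn_integral_multc Rp emeasure_eq_measure)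
    also have "\<dots> = (\<integral>\<^sup>+z. \<integral>\<^sup>+u. indicator {u<..} z * indicator {0..x} u \<partial>lborel \<partial>\<rho>)"
      by (rule P.Fubini') (simp add: indicator_def)
    also have "\<dots> = (\<integral>\<^sup>+z. ennreal z * indicator {..x} z + ennreal x * indicator {x<..} z \<partial>\<rho>)"
    proof (intro nn_integral_cong_AE, use rho(2) in eventually_elim)
      case (elim z)
      have "(\<integral>\<^sup>+u. indicator {u<..} z * indicator {0..x} u \<partial>lborel) = (\<integral>\<^sup>+u. indicator {0..min z x} u \<partial>lborel)"
        by (intro nn_integral_cong_AE, use AE_lborel_singleton[of z] in eventually_elim) (auto simp: indicator_def)
      also have "\<dots> = ennreal (min z x)" using elim x by simp
      finally show ?case by (auto simp: indicator_def min_def)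
    qed
    also have "\<dots> = ennreal (t * (M x - S R x)) + ennreal x * ennreal (R x)"
      by (subst nn_integral_add) (auto simp: V[OF x] nn_integral_cmult_indicator emeasure_eq_measure Rp)
    also have "\<dots> = ennreal (t * (M x - S R x) + x * R x)"
      using x t MS_nonneg[of x] R0[of x] by (simp add: ennreal_mult[symmetric] ennreal_plus[symmetric] del: ennreal_plus)
    finally have "(\<integral>\<^sup>+u. ennreal (indicator {0..x} u *\<^sub>R R u) \<partial>lborel) = ennreal (t * (M x - S R x) + x * R x)"
      by (simp add: ennreal_mult'' ennreal_indicator mult.commute R0)
    then have "has_bochner_integral lborel (\<lambda>u. indicator {0..x} u *\<^sub>R R u) (t * (M x - S R x) + x * R x)"
      using x t MS_nonneg[of x] R0 by (intro has_bochner_integral_nn_integral) auto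
    then show ?thesis by (simp add: set_lebesgue_integral_def has_bochner_integral_iff)
  qed
  show "conv_tail k b (tail \<rho>) t"
    unfolding R_def[symmetric]
  proof (intro conv_tail.intro levy_tail_axioms conv_tail_axioms.intro t R_anti R0 R1 R_lim low mom)
    fix x :: real assume x: "0 < x"
    show "set_integrable lborel {x..} (\<lambda>w. S R w / w\<^sup>2)"
      using HS[OF x] unfolding set_integrable_def by (auto simp: has_bochner_integral_iff)
    have "(LBINT w:{x..}. S R w / w\<^sup>2) = G x + S R x / x - R x / t"
      using HS[OF x] unfolding set_lebesgue_integral_def by (auto simp: has_bochner_integral_iff)
    then show "R x - t * G x = t * (S R x / x - (LBINT w:{x..}. S R w / w\<^sup>2))"
      using t by (simp only:) (simp add: right_diff_distrib distrib_left)
  qed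
qed

section \<open>Convolution powers satisfy the tail formula\<close>

lemma mean_eq_limit_truncated:
  fixes \<rho> :: "real measure"
  assumes rho: "real_distribution \<rho>" "AE x in \<rho>. 0 \<le> x"
    and V: "\<And>w. 0 < w \<Longrightarrow> (\<integral>\<^sup>+z. ennreal z * indicator {..w} z \<partial>\<rho>) = ennreal (V w)"
    and V_nonneg: "\<And>w. 0 < w \<Longrightarrow> 0 \<le> V w"
    and lim: "(V \<longlongrightarrow> m) at_top"
  shows "mean \<rho> = m"
proof -
  interpret real_distribution \<rho> by (rule rho)
  have hb: "has_bochner_integral \<rho> (\<lambda>z. z * indicator {..w} z) (V w)" if w: "0 < w" for w
  proof (rule has_bochner_integral_nn_integral)
    show "(\<integral>\<^sup>+z. ennreal (z * indicator {..w} z) \<partial>\<rho>) = ennreal (V w)"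
      unfolding V[OF w, symmetric] by (intro nn_integral_cong) (auto simp: indicator_def)
    show "AE z in \<rho>. 0 \<le> z * indicator {..w} z" using rho(2) by eventually_elim (auto simp: indicator_def)
  qed (use V_nonneg w in auto)
  have "has_bochner_integral \<rho> (\<lambda>z. z) m"
  proof (rule has_bochner_integral_monotone_convergence[where f = "\<lambda>i z. z * indicator {..real (Suc i)} z"])
    show "integrable \<rho> (\<lambda>z. z * indicator {..real (Suc i)} z)" for i
      using hb[of "real (Suc i)"] by (auto simp: has_bochner_integral_iff)
    show "AE x in \<rho>. mono (\<lambda>n. x * indicator {..real (Suc n)} x)"
      using rho(2) by eventually_elim (auto simp: mono_def indicator_def)
    show "AE x in \<rho>. (\<lambda>i. x * indicator {..real (Suc i)} x) \<longlonglongrightarrow> x"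
    proof (intro AE_I2)
      fix x
      have "\<forall>\<^sub>F i in sequentially. x * indicator {..real (Suc i)} x = x"
      proof -
        obtain N :: nat where "x \<le> real N" using real_arch_simple by blast
        then show ?thesis by (intro eventually_sequentiallyI[of N]) (auto simp: indicator_def)
      qed
      then show "(\<lambda>i. x * indicator {..real (Suc i)} x) \<longlonglongrightarrow> x" by (rule tendsto_eventually)
    qed
    have "integral\<^sup>L \<rho> (\<lambda>z. z * indicator {..real (Suc i)} z) = V (real (Suc i))" for i
      using hb[of "real (Suc i)"] by (auto simp: has_bochner_integral_iff)
    moreover have "(\<lambda>i. V (real (Suc i))) \<longlonglongrightarrow> m"
      by (rule filterlim_compose[OF lim]) (real_asymp)
    ultimately show "(\<lambda>i. integral\<^sup>L \<rho> (\<lambda>z. z * indicator {..real (Suc i)} z)) \<longlonglongrightarrow> m" by simp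
  qed auto
  then show ?thesis by (simp add: mean_def has_bochner_integral_iff)
qed

text \<open>By uniqueness of the exponent every convolution power is governed by the given \<open>\<nu>\<close>,
  with the drift \<open>b = \<gamma> - \<integral> x/(1+x\<^sup>2) \<nu>(dx)\<close>. It lives on the
  half-line because the exponential of its symbol is bounded on the half-plane.\<close>

theorem conv_powers_conv_tail:
  fixes \<mu> \<nu> :: "real measure" and k :: "real \<Rightarrow> real"
  assumes supp: "emeasure \<mu> {..<0} = 0"
    and triplet: "levy_triplet \<mu> \<gamma> a \<nu>"
    and nu: "\<nu> = density lborel (\<lambda>x. ennreal (indicator {0<..} x * (k x / x)))"
    and k_decr: "antimono_on {0<..} k"
    and k_pos: "\<And>x. 0 < x \<Longrightarrow> 0 < k x"
  obtains k0 b where "levy_tail k0 b"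
    and "\<And>x. 0 < x \<Longrightarrow> tail \<nu> x = levy_tail.G k0 x"
    and "\<And>t \<rho>. 0 < t \<Longrightarrow> is_conv_power t \<mu> \<rho> \<Longrightarrow> conv_tail k0 b (tail \<rho>) t"
    and "conv_tail k0 b (tail \<mu>) 1"
    and "\<And>m. ((\<lambda>w. levy_tail.M k0 b w - levy_tail.S k0 b (tail \<mu>) w) \<longlongrightarrow> m) at_top \<Longrightarrow> mean \<mu> = m"
proof -
  define k0 where "k0 x = indicator {0<..} x * k x" for x
  have k0_meas[measurable]: "k0 \<in> borel_measurable borel"
    unfolding k0_def[abs_def] by (rule antimono_on_borel_measurable[OF k_decr])
  have k0_nonneg: "0 \<le> k0 x" for x using k_pos[of x] by (auto simp: k0_def indicator_def)
  have k0_0: "k0 x = 0" if "x \<le> 0" for x using that by (simp add: k0_def)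
  have k0_div: "0 \<le> k0 x / x" for x using k0_nonneg[of x] k0_0[of x] by (cases "0 < x") auto
  have nu': "\<nu> = density lborel (\<lambda>x. ennreal (k0 x / x))" unfolding nu k0_def by simp
  have rd: "real_distribution \<mu>" and lm: "levy_measure \<nu>"
    using triplet by (auto simp: levy_triplet_def)
  interpret real_distribution \<mu> by (rule rd)
  have mu_pos: "AE x in \<mu>. 0 \<le> x"
    using supp by (intro AE_I[where N = "{..<0}"]) auto
  have nu_pos: "AE x in \<nu>. 0 < x"
    unfolding nu' by (subst AE_density) (measurable, auto intro!: AE_I2 simp: k0_def indicator_def split: if_splits)
  note hl = levy_triplet_half_line[OF triplet mu_pos nu_pos]
  define b where "b = \<gamma> - (LINT x|\<nu>. x / (1 + x\<^sup>2))"
  have b: "0 \<le> b" using hl(3) by (simp add: b_def)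
  have i1: "integrable lborel (\<lambda>x. k0 x / (1 + x\<^sup>2))"
  proof -
    have "integrable lborel (\<lambda>x. (k0 x / x) *\<^sub>R (x / (1 + x\<^sup>2)))"
      using hl(2) k0_div unfolding nu' by (subst (asm) integrable_density) auto
    moreover have "(k0 x / x) *\<^sub>R (x / (1 + x\<^sup>2)) = k0 x / (1 + x\<^sup>2)" for x
      using k0_0[of x] by (cases "x = 0") auto
    ultimately show ?thesis by (simp only:)
  qed
  have i2: "integrable lborel (\<lambda>x. k0 x / x * (x\<^sup>2 / (1 + x\<^sup>2)))"
    using levy_measure_integrable[OF lm] k0_div unfolding nu' by (subst (asm) integrable_density) auto
  have lt: "levy_tail k0 b"
  proof
    show "antimono_on {0<..} k0" using k_decr by (auto simp: monotone_on_def k0_def)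
    show "0 < k0 x" if "0 < x" for x using k_pos[OF that] that by (simp add: k0_def)
    show "set_integrable lborel {0..1} k0"
      unfolding set_integrable_def
    proof (rule Bochner_Integration.integrable_bound[OF integrable_mult_right[OF i1, of 2]])
      show "AE x in lborel. norm (indicator {0..1} x *\<^sub>R k0 x) \<le> norm (2 * (k0 x / (1 + x\<^sup>2)))"
      proof (rule AE_I2)
        fix x :: real
        show "norm (indicator {0..1} x *\<^sub>R k0 x) \<le> norm (2 * (k0 x / (1 + x\<^sup>2)))"
        proof (cases "x \<in> {0..1}")
          case True
          then have "x\<^sup>2 \<le> 1" by (simp add: abs_square_le_1)
          then have "k0 x * (1 + x\<^sup>2) \<le> k0 x * 2" using k0_nonneg by (intro mult_left_mono) auto
          then have "k0 x \<le> 2 * (k0 x / (1 + x\<^sup>2))"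
            by (simp add: field_simps add_pos_nonneg)
          then show ?thesis using True k0_nonneg[of x] by simp
        qed simp
      qed
    qed simp
    show "set_integrable lborel {1..} (\<lambda>y. k0 y / y)"
      unfolding set_integrable_def
    proof (rule Bochner_Integration.integrable_bound[OF integrable_mult_right[OF i2, of 2]])
      show "AE x in lborel. norm (indicator {1..} x *\<^sub>R (k0 x / x)) \<le> norm (2 * (k0 x / x * (x\<^sup>2 / (1 + x\<^sup>2))))"
      proof (rule AE_I2)
        fix x :: real
        show "norm (indicator {1..} x *\<^sub>R (k0 x / x)) \<le> norm (2 * (k0 x / x * (x\<^sup>2 / (1 + x\<^sup>2))))"
        proof (cases "x \<in> {1..}")
          case True
          then have "1 \<le> x\<^sup>2" by (simp add: one_le_power)
          then have "1 \<le> 2 * (x\<^sup>2 / (1 + x\<^sup>2))" by (simp add: field_simps)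
          then have "k0 x / x * 1 \<le> k0 x / x * (2 * (x\<^sup>2 / (1 + x\<^sup>2)))" using k0_div by (intro mult_left_mono) auto
          then have "k0 x / x \<le> 2 * (k0 x / x * (x\<^sup>2 / (1 + x\<^sup>2)))" by (simp add: mult_ac)
          then show ?thesis using True k0_div[of x] by (simp only: indicator_simps scaleR_one real_norm_def abs_of_nonneg)
        qed simp
      qed
    qed simp
  qed (use b k0_0 in auto)
  interpret lt: levy_tail k0 b by (rule lt)
  have sb: "(\<integral>\<^sup>+x. g x * ennreal x \<partial>\<rho>)
       = ennreal t * (\<integral>\<^sup>+u. (\<integral>\<^sup>+y. g (u + y) * ennreal (k0 y) \<partial>lborel) + g u * ennreal b \<partial>\<rho>)"
    if "real_distribution \<rho>" "AE x in \<rho>. 0 \<le> x" "0 < t" 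
      "\<And>z. char \<rho> z = exp (complex_of_real t * levy_exponent \<gamma> 0 \<nu> z)" "g \<in> borel_measurable borel" for \<rho> t g
    by (rule size_bias_identity[OF that(1,2) k0_meas k0_nonneg k0_0 nu' lm hl(2) b_def b less_imp_le[OF that(3)] that(4,5)])
  have ch1: "char \<mu> z = exp (complex_of_real 1 * levy_exponent \<gamma> 0 \<nu> z)" for z
    using triplet hl(1) by (simp add: levy_triplet_def)
  note sb1 = sb[OF rd mu_pos zero_less_one ch1]
  show ?thesis
  proof (rule that)
    show "levy_tail k0 b" by (rule lt)
    show "tail \<nu> x = levy_tail.G k0 x" if "0 < x" for x
    proof -
      show ?thesis using lt.G_nonneg[of x] lt.G_eq_tail[OF that] unfolding nu' tail_def measure_def by simp
    qed
    show "conv_tail k0 b (tail \<mu>) 1" by (rule lt.conv_tail_of_size_bias(1)[OF rd mu_pos zero_less_one sb1])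
    show "conv_tail k0 b (tail \<rho>) t" if t: "0 < t" and cp: "is_conv_power t \<mu> \<rho>" for t \<rho>
    proof -
      have rho: "real_distribution \<rho>" using cp by (simp add: is_conv_power_def)
      obtain \<gamma>' a' \<nu>' where trip': "levy_triplet \<mu> \<gamma>' a' \<nu>'"
        and ch': "\<And>z. char \<rho> z = exp (complex_of_real t * levy_exponent \<gamma>' a' \<nu>' z)"
        using cp by (auto simp: is_conv_power_def)
      have ch: "char \<rho> z = exp (complex_of_real t * levy_exponent \<gamma> 0 \<nu> z)" for z
        using ch' levy_exponent_unique[OF triplet trip'] hl(1) by simp
      have "AE x in \<rho>. 0 \<le> x"
      proof (rule half_line_of_bounded_half_plane_extension[OF rho])
        let ?E = "\<lambda>\<zeta>. exp (of_real t * levy_symbol \<gamma> 0 \<nu> \<zeta>)"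
        have "AE x in \<nu>. 0 \<le> Im z * x" if "0 \<le> Im z" for z
          using nu_pos by eventually_elim (use that in simp)
        then show "continuous_on {z. 0 \<le> Im z} ?E"
          by (intro continuous_intros levy_symbol_continuous[OF lm]) auto
        show "?E holomorphic_on {z. 0 < Im z}"
        proof (rule holomorphic_onI)
          fix z :: complex assume "z \<in> {z. 0 < Im z}"
          then have z: "0 < Im z" by simp
          have "(?E has_field_derivative of_real t * levy_symbol_deriv \<gamma> 0 \<nu> z * ?E z) (at z)"
            by (auto intro!: derivative_eq_intros levy_symbol_has_derivative[OF lm nu_pos z] simp: mult_ac)
          then show "?E field_differentiable at z within {z. 0 < Im z}"
            using field_differentiable_at_within field_differentiable_def by blast
        qed
        show "norm (?E z) \<le> 1" if "0 \<le> Im z" for z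
          using levy_symbol_drift_form(4)[OF lm nu_pos hl(2) that, of \<gamma>] b t
          by (simp add: b_def mult_le_0_iff)
        show "?E (of_real x) = char \<rho> x" for x by (simp add: levy_symbol_of_real ch)
      qed
      then show ?thesis
        by (intro lt.conv_tail_of_size_bias(1)[OF rho _ t] sb rho t ch)
    qed
    show "mean \<mu> = m" if lim: "((\<lambda>w. lt.M w - lt.S (tail \<mu>) w) \<longlongrightarrow> m) at_top" for m
    proof (rule mean_eq_limit_truncated[OF rd mu_pos _ _ lim])
      fix w :: real assume w: "0 < w"
      show "(\<integral>\<^sup>+z. ennreal z * indicator {..w} z \<partial>\<mu>) = ennreal (lt.M w - lt.S (tail \<mu>) w)"
        using lt.conv_tail_of_size_bias(2)[OF rd mu_pos zero_less_one sb1 w] by simp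
      show "0 \<le> lt.M w - lt.S (tail \<mu>) w"
        using lt.conv_tail_of_size_bias(3)[OF rd mu_pos zero_less_one sb1 w] by simp
    qed
  qed
qed

section \<open>Integrals over intervals\<close>

lemma set_integral_split_Icc:
  fixes f :: "real \<Rightarrow> real"
  assumes "a \<le> c" "c \<le> d" and int: "set_integrable lborel {a..d} f"
  shows "(LBINT u:{a..d}. f u) = (LBINT u:{a..c}. f u) + (LBINT u:{c..d}. f u)"
proof -
  have i1: "set_integrable lborel {a..c} f" and i2: "set_integrable lborel {c<..d} f" and i3: "set_integrable lborel {c..d} f"
    using assms by (auto intro!: set_integrable_subset[OF int])
  have "{a..d} = {a..c} \<union> {c<..d}" using assms by auto
  then have "(LBINT u:{a..d}. f u) = (LBINT u:{a..c}. f u) + (LBINT u:{c<..d}. f u)"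
    using set_integral_Un[OF ivl_disj_int_two(8) i1 i2] by simp
  also have "(LBINT u:{c<..d}. f u) = (LBINT u:{c..d}. f u)"
  proof (rule set_integral_cong_set)
    show "AE u in lborel. u \<in> {c..d} \<longleftrightarrow> u \<in> {c<..d}"
      using AE_lborel_singleton[of c] by eventually_elim auto
  qed (use i2 i3 in \<open>auto simp: set_borel_measurable_def set_integrable_def\<close>)
  finally show ?thesis .
qed

lemma set_integral_split_Ici:
  fixes f :: "real \<Rightarrow> real"
  assumes "a \<le> c" and int: "set_integrable lborel {a..} f"
  shows "(LBINT u:{a..}. f u) = (LBINT u:{a..c}. f u) + (LBINT u:{c..}. f u)"
proof -
  have i1: "set_integrable lborel {a..c} f" and i2: "set_integrable lborel {c<..} f" and i3: "set_integrable lborel {c..} f"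
    using assms by (auto intro!: set_integrable_subset[OF int])
  have "{a..} = {a..c} \<union> {c<..}" using assms by auto
  then have "(LBINT u:{a..}. f u) = (LBINT u:{a..c}. f u) + (LBINT u:{c<..}. f u)"
    using set_integral_Un[OF ivl_disj_int_one(7) i1 i2] by simp
  also have "(LBINT u:{c<..}. f u) = (LBINT u:{c..}. f u)"
  proof (rule set_integral_cong_set)
    show "AE u in lborel. u \<in> {c..} \<longleftrightarrow> u \<in> {c<..}"
      using AE_lborel_singleton[of c] by eventually_elim auto
  qed (use i2 i3 in \<open>auto simp: set_borel_measurable_def set_integrable_def\<close>)
  finally show ?thesis .
qed

lemma set_integral_const_Icc:
  fixes a b c :: real
  assumes "a \<le> b"
  shows "set_integrable lborel {a..b} (\<lambda>_. c)" "(LBINT u:{a..b}. c) = (b - a) * c"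
  using assms by (auto intro: borel_integrable_atLeastAtMost' simp: set_lebesgue_integral_def)

lemma set_integral_mono_Ioc:
  fixes f g :: "real \<Rightarrow> real"
  assumes "set_integrable lborel {a..b} f" "set_integrable lborel {a..b} g" "\<And>u. a < u \<Longrightarrow> u \<le> b \<Longrightarrow> f u \<le> g u"
  shows "(LBINT u:{a..b}. f u) \<le> (LBINT u:{a..b}. g u)"
proof (rule set_integral_mono_AE)
  show "AE u\<in>{a..b} in lborel. f u \<le> g u"
    using AE_lborel_singleton[of a] by eventually_elim (auto intro: assms(3))
qed (use assms in auto)

lemma set_integral_nonneg':
  fixes f :: "real \<Rightarrow> real"
  assumes "\<And>u. u \<in> A \<Longrightarrow> 0 \<le> f u"
  shows "0 \<le> (LBINT u:A. f u)"
  unfolding set_lebesgue_integral_def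
  by (intro integral_nonneg_AE AE_I2) (auto simp: indicator_def assms)

lemma set_integral_norm_bound':
  fixes f g :: "real \<Rightarrow> real"
  assumes "set_integrable lborel A f" "set_integrable lborel A g" "\<And>u. u \<in> A \<Longrightarrow> \<bar>f u\<bar> \<le> g u"
  shows "\<bar>LBINT u:A. f u\<bar> \<le> (LBINT u:A. g u)"
proof -
  have "\<bar>LBINT u:A. f u\<bar> \<le> (LBINT u. norm (indicator A u *\<^sub>R f u))"
    unfolding set_lebesgue_integral_def using integral_norm_bound[of lborel "\<lambda>u. indicator A u *\<^sub>R f u"] by simp
  also have "\<dots> \<le> (LBINT u:A. g u)"
    unfolding set_lebesgue_integral_def
    using assms unfolding set_integrable_def
    by (intro integral_mono integrable_norm) (auto simp: indicator_def)
  finally show ?thesis .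
qed

lemma tail_integral_pos:
  fixes g :: "real \<Rightarrow> real"
  assumes int: "set_integrable lborel {x..} g" and pos: "\<And>u. x \<le> u \<Longrightarrow> 0 < g u"
  shows "0 < (LBINT u:{x..}. g u)"
proof -
  have nn: "AE u in lborel. 0 \<le> indicator {x..} u *\<^sub>R g u"
    using pos by (intro AE_I2) (auto simp: indicator_def intro: less_imp_le)
  have "(LBINT u:{x..}. g u) \<noteq> 0"
  proof
    assume "(LBINT u:{x..}. g u) = 0"
    then have "AE u in lborel. indicator {x..} u *\<^sub>R g u = 0"
      using integral_nonneg_eq_0_iff_AE[OF int[unfolded set_integrable_def] nn]
      by (simp add: set_lebesgue_integral_def)
    then have "AE u in lborel. u \<notin> {x..x+1}"
    proof eventually_elim
      case (elim u)
      then show ?case using pos[of u] by (auto simp: indicator_def split: if_splits)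
    qed
    then have "emeasure lborel {x..x+1} = 0"
      by (subst (asm) AE_iff_measurable[where N = "{x..x+1}"]) auto
    then show False by simp
  qed
  moreover have "0 \<le> (LBINT u:{x..}. g u)"
    unfolding set_lebesgue_integral_def by (rule integral_nonneg_AE[OF nn])
  ultimately show ?thesis by linarith
qed

lemma tail_integral_scale:
  fixes f :: "real \<Rightarrow> real"
  assumes c: "0 < c"
  shows "(LBINT u:{c * x..}. f u) = c * (LBINT u:{x..}. f (c * u))"
    and "set_integrable lborel {c * x..} f \<Longrightarrow> set_integrable lborel {x..} (\<lambda>u. f (c * u))"
proof -
  have ind: "indicator {c * x..} (c * u) = (indicator {x..} u :: real)" for u using c by (simp add: indicator_def)
  show "(LBINT u:{c * x..}. f u) = c * (LBINT u:{x..}. f (c * u))"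
    unfolding set_lebesgue_integral_def
    using c lborel_integral_real_affine[of c "\<lambda>u. indicator {c * x..} u *\<^sub>R f u" 0] by (simp add: ind)
  show "set_integrable lborel {x..} (\<lambda>u. f (c * u))" if "set_integrable lborel {c * x..} f"
    using lborel_integrable_real_affine[of "\<lambda>u. indicator {c * x..} u *\<^sub>R f u" c 0] that c
    unfolding set_integrable_def by (simp add: ind)
qed

lemma cesaro_mean_tendsto_0:
  fixes f :: "real \<Rightarrow> real"
  assumes int: "\<And>x. set_integrable lborel {0..x} f" and lim: "(f \<longlongrightarrow> 0) at_top"
  shows "((\<lambda>x. (LBINT u:{0..x}. f u) / x) \<longlongrightarrow> 0) at_top"
proof (rule tendstoI)
  fix e :: real assume e: "0 < e"
  from tendstoD[OF lim, of "e / 2"] e obtain Y0 where Y0: "\<And>x. Y0 \<le> x \<Longrightarrow> \<bar>f x\<bar> < e / 2"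
    by (auto simp: eventually_at_top_linorder dist_real_def)
  define Y where "Y = max 1 Y0"
  define C where "C = \<bar>LBINT u:{0..Y}. f u\<bar>"
  show "\<forall>\<^sub>F x in at_top. dist ((LBINT u:{0..x}. f u) / x) 0 < e"
    using eventually_gt_at_top[of "max Y (2 * C / e)"]
  proof eventually_elim
    case (elim x)
    have x: "Y \<le> x" "0 < x" "2 * C / e < x" using elim by (auto simp: Y_def)
    have "set_integrable lborel {Y..x} f" using int[of x] by (rule set_integrable_subset) (auto simp: Y_def)
    then have "\<bar>LBINT u:{Y..x}. f u\<bar> \<le> (LBINT u:{Y..x}. e / 2)"
      using Y0 by (intro set_integral_norm_bound' set_integral_const_Icc(1) x) (auto simp: Y_def intro: less_imp_le)
    also have "\<dots> = (x - Y) * (e / 2)" using x by (intro set_integral_const_Icc(2))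
    also have "\<dots> \<le> x * (e / 2)" using e by (intro mult_right_mono) (auto simp: Y_def)
    finally have "\<bar>LBINT u:{0..x}. f u\<bar> \<le> C + x * (e / 2)"
      using set_integral_split_Icc[OF _ x(1) int[of x]] by (simp add: C_def Y_def)
    moreover have "C < x * (e / 2)" using x e by (simp add: field_simps)
    ultimately have "\<bar>LBINT u:{0..x}. f u\<bar> < x * e" by (simp add: field_simps)
    then show ?case using x by (simp add: dist_real_def abs_divide pos_divide_less_eq mult.commute)
  qed
qed

text \<open>Here \<open>m(w) \<integral>\<^sub>w\<^sup>\<infinity> m\<close> integrates the product
  \<open>m(w) m(u)\<close> over one of the two triangles that make up a quadrant.\<close>

lemma set_integral_triangle:
  fixes m :: "real \<Rightarrow> real"
  assumes int: "set_integrable lborel {x..} m" and nn: "\<And>w. x \<le> w \<Longrightarrow> 0 \<le> m w"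
  shows "has_bochner_integral lborel (\<lambda>w. indicator {x..} w *\<^sub>R (m w * (LBINT u:{w..}. m u))) ((LBINT u:{x..}. m u)\<^sup>2 / 2)"
proof -
  define f where "f w = indicator {x..} w * m w" for w
  have f_int: "integrable lborel f" using int by (simp add: f_def[abs_def] set_integrable_def)
  have [measurable]: "f \<in> borel_measurable borel" using f_int by auto
  have f0: "0 \<le> f w" for w using nn by (simp add: f_def indicator_def)
  define A where "A w = (LBINT u:{w..}. m u)" for w
  have nnA: "(\<integral>\<^sup>+u. ennreal (f u) * indicator {w..} u \<partial>lborel) = ennreal (A w)" and A0: "0 \<le> A w" if "x \<le> w" for w
  proof -
    have i: "set_integrable lborel {w..} m" by (rule set_integrable_subset[OF int]) (use that in auto)
    have "(\<integral>\<^sup>+u. ennreal (f u) * indicator {w..} u \<partial>lborel) = (\<integral>\<^sup>+u. ennreal (indicator {w..} u *\<^sub>R m u) \<partial>lborel)"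
      using that by (intro nn_integral_cong) (auto simp: f_def indicator_def)
    also have "\<dots> = ennreal (A w)" unfolding A_def set_lebesgue_integral_def
      using i nn that by (intro nn_integral_eq_integral) (auto simp: set_integrable_def indicator_def intro!: AE_I2)
    finally show "(\<integral>\<^sup>+u. ennreal (f u) * indicator {w..} u \<partial>lborel) = ennreal (A w)" .
    show "0 \<le> A w" unfolding A_def using nn that by (intro set_integral_nonneg') auto
  qed
  have tot: "(\<integral>\<^sup>+u. ennreal (f u) \<partial>lborel) = ennreal (A x)"
    unfolding nnA[OF order_refl, symmetric] by (intro nn_integral_cong) (auto simp: f_def indicator_def)
  define I where "I = (\<integral>\<^sup>+w. ennreal (f w) * (\<integral>\<^sup>+u. ennreal (f u) * indicator {w..} u \<partial>lborel) \<partial>lborel)"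
  have I1: "I = (\<integral>\<^sup>+w. \<integral>\<^sup>+u. ennreal (f w) * ennreal (f u) * indicator {w..} u \<partial>lborel \<partial>lborel)"
    unfolding I_def by (intro nn_integral_cong) (simp add: nn_integral_cmult[symmetric] mult.assoc)
  also have "\<dots> = (\<integral>\<^sup>+u. \<integral>\<^sup>+w. ennreal (f w) * ennreal (f u) * indicator {w..} u \<partial>lborel \<partial>lborel)"
    by (rule lborel_pair.Fubini') (simp add: indicator_def)
  finally have I2: "I = (\<integral>\<^sup>+w. \<integral>\<^sup>+u. ennreal (f w) * ennreal (f u) * indicator {u..} w \<partial>lborel \<partial>lborel)"
    by (simp add: mult.commute)
  have "I + I = (\<integral>\<^sup>+w. \<integral>\<^sup>+u. ennreal (f w) * ennreal (f u) * indicator {w..} u \<partial>lborel \<partial>lborel)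
      + (\<integral>\<^sup>+w. \<integral>\<^sup>+u. ennreal (f w) * ennreal (f u) * indicator {u..} w \<partial>lborel \<partial>lborel)"
    by (rule arg_cong2[of _ _ _ _ "(+)"], rule I1, rule I2)
  also have "\<dots> = (\<integral>\<^sup>+w. (\<integral>\<^sup>+u. ennreal (f w) * ennreal (f u) * indicator {w..} u \<partial>lborel) + (\<integral>\<^sup>+u. ennreal (f w) * ennreal (f u) * indicator {u..} w \<partial>lborel) \<partial>lborel)"
    by (subst nn_integral_add) (auto simp: indicator_def)
  also have "\<dots> = (\<integral>\<^sup>+w. ennreal (f w) * ennreal (A x) \<partial>lborel)"
  proof (rule nn_integral_cong)
    fix w :: real
    have "(\<integral>\<^sup>+u. ennreal (f w) * ennreal (f u) * indicator {w..} u \<partial>lborel) + (\<integral>\<^sup>+u. ennreal (f w) * ennreal (f u) * indicator {u..} w \<partial>lborel)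
       = (\<integral>\<^sup>+u. ennreal (f w) * ennreal (f u) * indicator {w..} u + ennreal (f w) * ennreal (f u) * indicator {u..} w \<partial>lborel)"
      by (subst nn_integral_add) (auto simp: indicator_def)
    also have "\<dots> = (\<integral>\<^sup>+u. ennreal (f w) * ennreal (f u) \<partial>lborel)"
      by (intro nn_integral_cong_AE, use AE_lborel_singleton[of w] in eventually_elim) (auto simp: indicator_def)
    also have "\<dots> = ennreal (f w) * ennreal (A x)" by (simp add: nn_integral_cmult tot)
    finally show "(\<integral>\<^sup>+u. ennreal (f w) * ennreal (f u) * indicator {w..} u \<partial>lborel) + (\<integral>\<^sup>+u. ennreal (f w) * ennreal (f u) * indicator {u..} w \<partial>lborel)
       = ennreal (f w) * ennreal (A x)" .
  qed
  also have "\<dots> = ennreal ((A x)\<^sup>2)"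
    using A0[of x] by (simp add: nn_integral_multc tot ennreal_mult power2_eq_square)
  finally have II: "I + I = ennreal ((A x)\<^sup>2)" .
  have "I = ennreal ((A x)\<^sup>2 / 2)"
  proof -
    have "I \<noteq> \<top>" using II by (intro notI) simp
    then obtain r where r: "0 \<le> r" "I = ennreal r" by (cases I) auto
    then have "ennreal (2 * r) = ennreal ((A x)\<^sup>2)" using II by (simp flip: ennreal_plus)
    then have "2 * r = (A x)\<^sup>2" using r by simp
    then show ?thesis using r by simp
  qed
  moreover have "I = (\<integral>\<^sup>+w. ennreal (indicator {x..} w *\<^sub>R (m w * A w)) \<partial>lborel)"
    unfolding I_def
  proof (rule nn_integral_cong)
    fix w
    show "ennreal (f w) * (\<integral>\<^sup>+u. ennreal (f u) * indicator {w..} u \<partial>lborel) = ennreal (indicator {x..} w *\<^sub>R (m w * A w))"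
      using nnA[of w] A0[of w] nn[of w] by (cases "x \<le> w") (auto simp: f_def ennreal_mult)
  qed
  moreover have "(\<lambda>w. indicator {x..} w *\<^sub>R (m w * A w)) \<in> borel_measurable lborel"
  proof -
    have "(\<lambda>w. indicator {x..} w *\<^sub>R (m w * A w)) = (\<lambda>w. f w * (\<integral>u. (if w \<le> u then f u else 0) \<partial>lborel))"
    proof
      fix w
      have "A w = (\<integral>u. (if w \<le> u then f u else 0) \<partial>lborel)" if "x \<le> w"
        unfolding A_def set_lebesgue_integral_def using that
        by (intro Bochner_Integration.integral_cong) (auto simp: f_def indicator_def)
      then show "indicator {x..} w *\<^sub>R (m w * A w) = f w * (\<integral>u. (if w \<le> u then f u else 0) \<partial>lborel)"
        by (cases "x \<le> w") (auto simp: f_def)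
    qed
    also have "\<dots> \<in> borel_measurable lborel" by measurable
    finally show ?thesis .
  qed
  moreover have "AE w in lborel. 0 \<le> indicator {x..} w *\<^sub>R (m w * A w)"
    using nn A0 by (intro AE_I2) (auto simp: indicator_def)
  ultimately show ?thesis
    unfolding A_def[symmetric] by (intro has_bochner_integral_nn_integral) auto
qed

section \<open>Regular variation and monotone functions\<close>

definition regvar :: "(real \<Rightarrow> real) \<Rightarrow> real \<Rightarrow> bool" where
  "regvar f a \<longleftrightarrow> (\<forall>\<^sub>F x in at_top. 0 < f x) \<and> (\<forall>c>0. ((\<lambda>x. f (c * x) / f x) \<longlongrightarrow> c powr a) at_top)"

lemma regvarD: "regvar f a \<Longrightarrow> 0 < c \<Longrightarrow> ((\<lambda>x. f (c * x) / f x) \<longlongrightarrow> c powr a) at_top"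
  and regvar_pos: "regvar f a \<Longrightarrow> \<forall>\<^sub>F x in at_top. 0 < f x"
  by (auto simp: regvar_def)

lemma eventually_at_top_times:
  fixes c :: real
  assumes "0 < c" "\<forall>\<^sub>F x in at_top. P x"
  shows "\<forall>\<^sub>F x in at_top. P (c * x)"
proof -
  have "filterlim (\<lambda>x. c * x) at_top at_top"
    using assms(1) by (rule filterlim_tendsto_pos_mult_at_top[OF tendsto_const _ filterlim_ident])
  then show ?thesis using assms(2) by (simp add: filterlim_iff)
qed

lemma tendsto_at_top_times:
  fixes c :: real
  assumes "0 < c" "(f \<longlongrightarrow> L) at_top"
  shows "((\<lambda>x. f (c * x)) \<longlongrightarrow> L) at_top"
  using assms(2) filterlim_tendsto_pos_mult_at_top[OF tendsto_const assms(1) filterlim_ident]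
  by (rule filterlim_compose)

lemma regvar_equivalent:
  assumes g: "regvar g a" and lim: "((\<lambda>x. f x / g x) \<longlongrightarrow> c) at_top" and c: "0 < c"
  shows "regvar f a"
  unfolding regvar_def
proof (intro conjI allI impI)
  have "\<forall>\<^sub>F x in at_top. 0 < f x / g x" using order_tendstoD(1)[OF lim c] .
  with regvar_pos[OF g] show fpos: "\<forall>\<^sub>F x in at_top. 0 < f x"
    by eventually_elim (simp add: zero_less_divide_iff)
  fix d :: real assume d: "0 < d"
  have "((\<lambda>x. (f (d * x) / g (d * x)) * (g (d * x) / g x) / (f x / g x)) \<longlongrightarrow> c * d powr a / c) at_top"
    using c by (intro tendsto_intros tendsto_at_top_times[OF d lim] regvarD[OF g d] lim) auto
  moreover have "\<forall>\<^sub>F x in at_top. (f (d * x) / g (d * x)) * (g (d * x) / g x) / (f x / g x) = f (d * x) / f x"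
    using regvar_pos[OF g] eventually_at_top_times[OF d regvar_pos[OF g]] fpos
    by eventually_elim auto
  ultimately have "((\<lambda>x. f (d * x) / f x) \<longlongrightarrow> c * d powr a / c) at_top"
    by (rule Lim_transform_eventually)
  then show "((\<lambda>x. f (d * x) / f x) \<longlongrightarrow> d powr a) at_top" using c by simp
qed

lemma regvar_scaled_limit:
  assumes g: "regvar g r" and lim: "((\<lambda>x. f x / g x) \<longlongrightarrow> L) at_top" and c: "0 < c"
  shows "((\<lambda>x. f (c * x) / g x) \<longlongrightarrow> L * c powr r) at_top"
proof -
  have "((\<lambda>x. f (c * x) / g (c * x) * (g (c * x) / g x)) \<longlongrightarrow> L * c powr r) at_top"
    by (intro tendsto_mult regvarD[OF g c] tendsto_at_top_times[OF c lim])
  then show ?thesis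
    by (rule Lim_transform_eventually)
       (use eventually_at_top_times[OF c regvar_pos[OF g]] in \<open>eventually_elim, simp\<close>)
qed

lemma regvar_mult:
  assumes "regvar f a" "regvar g b"
  shows "regvar (\<lambda>x. f x * g x) (a + b)"
  unfolding regvar_def
proof (intro conjI allI impI)
  show "\<forall>\<^sub>F x in at_top. 0 < f x * g x"
    using regvar_pos[OF assms(1)] regvar_pos[OF assms(2)] by eventually_elim simp
  fix c :: real assume c: "0 < c"
  have "((\<lambda>x. (f (c * x) / f x) * (g (c * x) / g x)) \<longlongrightarrow> c powr a * c powr b) at_top"
    by (intro tendsto_mult regvarD assms c)
  then show "((\<lambda>x. f (c * x) * g (c * x) / (f x * g x)) \<longlongrightarrow> c powr (a + b)) at_top"
    by (simp add: powr_add)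
qed

lemma regvar_powr: "regvar (\<lambda>x. x powr a) a"
  unfolding regvar_def
proof (intro conjI allI impI)
  show "\<forall>\<^sub>F x in at_top. 0 < (x::real) powr a" using eventually_gt_at_top[of 0] by eventually_elim simp
  fix c :: real assume c: "0 < c"
  have "\<forall>\<^sub>F x in at_top. (c * x) powr a / x powr a = c powr a"
    using eventually_gt_at_top[of 0] by eventually_elim (use c in \<open>simp add: powr_mult\<close>)
  then show "((\<lambda>x. (c * x) powr a / x powr a) \<longlongrightarrow> c powr a) at_top" by (rule tendsto_eventually)
qed

lemma regvar_0I:
  assumes pos: "\<forall>\<^sub>F x in at_top. 0 < f x"
    and lt1: "\<And>c. 0 < c \<Longrightarrow> c < 1 \<Longrightarrow> ((\<lambda>x. f (c * x) / f x) \<longlongrightarrow> 1) at_top"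
  shows "regvar f 0"
  unfolding regvar_def
proof (intro conjI allI impI pos)
  fix c :: real assume c: "0 < c"
  consider "c < 1" | "c = 1" | "1 < c" by linarith
  then show "((\<lambda>x. f (c * x) / f x) \<longlongrightarrow> c powr 0) at_top"
  proof cases
    case 1
    then show ?thesis using lt1 c by simp
  next
    case 2
    have "((\<lambda>x. f x / f x) \<longlongrightarrow> 1) at_top"
      by (rule tendsto_eventually) (use pos in \<open>eventually_elim, simp\<close>)
    then show ?thesis using 2 by simp
  next
    case 3
    have "((\<lambda>x. f ((1/c) * (c * x)) / f (c * x)) \<longlongrightarrow> 1) at_top"
      using tendsto_at_top_times[OF c lt1[of "1/c"]] 3 by simp
    then have "((\<lambda>x. inverse (f ((1/c) * (c * x)) / f (c * x))) \<longlongrightarrow> inverse 1) at_top"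
      by (rule tendsto_inverse) simp
    then show ?thesis using c by simp
  qed
qed

lemma tail_integral_ratio:
  fixes f g :: "real \<Rightarrow> real"
  assumes lim: "((\<lambda>x. f x / g x) \<longlongrightarrow> c) at_top" and gpos: "\<forall>\<^sub>F x in at_top. 0 < g x"
    and gint: "set_integrable lborel {X..} g" and fint: "set_integrable lborel {X..} f"
  shows "((\<lambda>x. (LBINT u:{x..}. f u) / (LBINT u:{x..}. g u)) \<longlongrightarrow> c) at_top"
proof (rule tendstoI)
  fix e :: real assume e: "0 < e"
  have "\<forall>\<^sub>F x in at_top. dist (f x / g x) c < e / 2" using tendstoD[OF lim, of "e / 2"] e by simp
  with gpos have "\<forall>\<^sub>F x in at_top. 0 < g x \<and> dist (f x / g x) c < e / 2" by eventually_elim simp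
  then obtain Y where Y: "\<And>x. Y \<le> x \<Longrightarrow> 0 < g x \<and> dist (f x / g x) c < e / 2"
    by (auto simp: eventually_at_top_linorder)
  show "\<forall>\<^sub>F x in at_top. dist ((LBINT u:{x..}. f u) / (LBINT u:{x..}. g u)) c < e"
    using eventually_ge_at_top[of "max X Y"]
  proof eventually_elim
    case (elim x)
    have gi: "set_integrable lborel {x..} g" and fi: "set_integrable lborel {x..} f"
      using elim by (auto intro: set_integrable_subset[OF gint] set_integrable_subset[OF fint])
    have gp: "0 < (LBINT u:{x..}. g u)" using elim Y by (intro tail_integral_pos gi) auto
    have "\<bar>LBINT u:{x..}. f u - c * g u\<bar> \<le> (LBINT u:{x..}. e / 2 * g u)"
    proof (rule set_integral_norm_bound')
      fix u assume "u \<in> {x..}"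
      then have u: "0 < g u" "\<bar>f u / g u - c\<bar> < e / 2" using Y[of u] elim by (auto simp: dist_real_def)
      have "f u - c * g u = (f u / g u - c) * g u" using u by (simp add: field_simps)
      then show "\<bar>f u - c * g u\<bar> \<le> e / 2 * g u" using u by (simp add: abs_mult)
    qed (use gi fi in auto)
    also have "(LBINT u:{x..}. f u - c * g u) = (LBINT u:{x..}. f u) - c * (LBINT u:{x..}. g u)"
      using fi gi by (subst set_integral_diff(2)) auto
    finally have "\<bar>(LBINT u:{x..}. f u) - c * (LBINT u:{x..}. g u)\<bar> \<le> e / 2 * (LBINT u:{x..}. g u)" by simp
    moreover have "(LBINT u:{x..}. f u) / (LBINT u:{x..}. g u) - c = ((LBINT u:{x..}. f u) - c * (LBINT u:{x..}. g u)) / (LBINT u:{x..}. g u)"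
      using gp by (simp add: field_simps)
    ultimately have "\<bar>(LBINT u:{x..}. f u) / (LBINT u:{x..}. g u) - c\<bar> \<le> e / 2"
      using gp by (simp add: abs_divide pos_divide_le_eq)
    then show ?case using e by (simp add: dist_real_def)
  qed
qed

lemma head_integral_ratio:
  fixes f g :: "real \<Rightarrow> real"
  assumes lim: "((\<lambda>x. f x / g x) \<longlongrightarrow> c) at_top" and gpos: "\<forall>\<^sub>F x in at_top. 0 < g x"
    and gint: "\<And>x. set_integrable lborel {1..x} g" and fint: "\<And>x. set_integrable lborel {1..x} f"
    and div: "filterlim (\<lambda>x. LBINT u:{1..x}. g u) at_top at_top"
  shows "((\<lambda>x. (LBINT u:{1..x}. f u) / (LBINT u:{1..x}. g u)) \<longlongrightarrow> c) at_top"
proof (rule tendstoI)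
  fix e :: real assume e: "0 < e"
  have "\<forall>\<^sub>F x in at_top. dist (f x / g x) c < e / 4" using tendstoD[OF lim, of "e / 4"] e by simp
  with gpos have "\<forall>\<^sub>F x in at_top. 0 < g x \<and> dist (f x / g x) c < e / 4" by eventually_elim simp
  then obtain Y0 where Y0: "\<And>x. Y0 \<le> x \<Longrightarrow> 0 < g x \<and> dist (f x / g x) c < e / 4"
    by (auto simp: eventually_at_top_linorder)
  define Y where "Y = max Y0 1"
  define D where "D = \<bar>(LBINT u:{1..Y}. f u) - c * (LBINT u:{1..Y}. g u)\<bar> + e / 4 * \<bar>LBINT u:{1..Y}. g u\<bar>"
  have "\<forall>\<^sub>F x in at_top. max 1 (4 * D / e) \<le> (LBINT u:{1..x}. g u)"
    using div unfolding filterlim_at_top by (rule spec)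
  then show "\<forall>\<^sub>F x in at_top. dist ((LBINT u:{1..x}. f u) / (LBINT u:{1..x}. g u)) c < e"
    using eventually_ge_at_top[of Y]
  proof eventually_elim
    case (elim x)
    have Yx: "1 \<le> Y" "Y \<le> x" using elim by (auto simp: Y_def)
    let ?g = "LBINT u:{1..x}. g u" and ?f = "LBINT u:{1..x}. f u"
    have g1: "1 \<le> ?g" and D: "4 * D / e \<le> ?g" using elim by auto
    have split: "(LBINT u:{1..x}. h u) = (LBINT u:{1..Y}. h u) + (LBINT u:{Y..x}. h u)"
      and hi: "set_integrable lborel {Y..x} h"
      if h: "\<And>x. set_integrable lborel {1..x} h" for h :: "real \<Rightarrow> real"
      using set_integral_split_Icc[OF Yx h] Yx by (auto intro: set_integrable_subset[OF h[of x]])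
    have "\<bar>LBINT u:{Y..x}. f u - c * g u\<bar> \<le> (LBINT u:{Y..x}. e / 4 * g u)"
    proof (rule set_integral_norm_bound')
      fix u assume "u \<in> {Y..x}"
      then have u: "0 < g u" "\<bar>f u / g u - c\<bar> < e / 4" using Y0[of u] by (auto simp: dist_real_def Y_def)
      have "f u - c * g u = (f u / g u - c) * g u" using u by (simp add: field_simps)
      then show "\<bar>f u - c * g u\<bar> \<le> e / 4 * g u" using u by (simp add: abs_mult)
    qed (use hi[OF gint] hi[OF fint] in auto)
    also have "(LBINT u:{Y..x}. f u - c * g u) = (LBINT u:{Y..x}. f u) - c * (LBINT u:{Y..x}. g u)"
      using hi[OF gint] hi[OF fint] by (subst set_integral_diff(2)) auto
    finally have "\<bar>(LBINT u:{Y..x}. f u) - c * (LBINT u:{Y..x}. g u)\<bar> \<le> e / 4 * (LBINT u:{Y..x}. g u)" by simp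
    then have "\<bar>?f - c * ?g\<bar> \<le> D + e / 4 * ?g"
      unfolding split[OF fint] split[OF gint] D_def distrib_left
      using abs_ge_minus_self[of "LBINT u:{1..Y}. g u"] e mult_left_mono[of "- (LBINT u:{1..Y}. g u)" "\<bar>LBINT u:{1..Y}. g u\<bar>" "e / 4"]
      by linarith
    moreover have "D \<le> e / 4 * ?g" using D e by (simp add: field_simps)
    ultimately have "\<bar>?f - c * ?g\<bar> \<le> e / 2 * ?g" by linarith
    moreover have "?f / ?g - c = (?f - c * ?g) / ?g" using g1 by (simp add: field_simps)
    ultimately have "\<bar>?f / ?g - c\<bar> \<le> e / 2" using g1 by (simp add: abs_divide pos_divide_le_eq)
    then show ?case using e by (simp add: dist_real_def)
  qed
qed

lemma regvar_tail_integral: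
  assumes f: "regvar f a" and int: "set_integrable lborel {X..} f"
  shows "regvar (\<lambda>x. LBINT u:{x..}. f u) (a + 1)"
  unfolding regvar_def
proof (intro conjI allI impI)
  obtain Y where Y: "\<And>x. Y \<le> x \<Longrightarrow> 0 < f x" using regvar_pos[OF f] by (auto simp: eventually_at_top_linorder)
  show "\<forall>\<^sub>F x in at_top. 0 < (LBINT u:{x..}. f u)"
    using eventually_ge_at_top[of "max X Y"]
    by eventually_elim (auto intro!: tail_integral_pos set_integrable_subset[OF int] Y)
  fix c :: real assume c: "0 < c"
  have "set_integrable lborel {X / c..} (\<lambda>u. f (c * u))"
    using c by (intro tail_integral_scale(2)) (auto intro: int)
  then have "((\<lambda>x. (LBINT u:{x..}. f (c * u)) / (LBINT u:{x..}. f u)) \<longlongrightarrow> c powr a) at_top"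
    using int by (intro tail_integral_ratio[where X = "max X (X / c)"] regvarD[OF f c] regvar_pos[OF f])
      (auto elim!: set_integrable_subset)
  then have "((\<lambda>x. c * ((LBINT u:{x..}. f (c * u)) / (LBINT u:{x..}. f u))) \<longlongrightarrow> c * c powr a) at_top"
    by (intro tendsto_intros)
  then show "((\<lambda>x. (LBINT u:{c * x..}. f u) / (LBINT u:{x..}. f u)) \<longlongrightarrow> c powr (a + 1)) at_top"
    using c by (simp add: tail_integral_scale(1)[OF c] powr_add mult.commute[of "c powr a"])
qed

text \<open>For \<open>d > 1\<close> monotonicity traps \<open>f\<close> between difference quotients:
  \<open>(d - 1) x f(d x) \<le> H(x) - H(d x) \<le> (d - 1) x f(x)\<close>. Dividing by
  \<open>H(x)\<close> and letting first \<open>x \<rightarrow> \<infinity>\<close> and then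
  \<open>d \<rightarrow> 1\<close> gives the limit.\<close>

lemma monotone_density:
  fixes f :: "real \<Rightarrow> real" and X a :: real
  assumes anti: "antimono_on {X..} f" and int: "set_integrable lborel {X..} f"
    and H: "regvar (\<lambda>x. LBINT u:{x..}. f u) (- a)"
  shows "((\<lambda>x. x * f x / (LBINT u:{x..}. f u)) \<longlongrightarrow> a) at_top"
proof -
  define H where "H = (\<lambda>x. LBINT u:{x..}. f u)"
  note H' = H[folded H_def]
  have bounds: "(d * x - x) * f (d * x) \<le> H x - H (d * x)" "H x - H (d * x) \<le> (d * x - x) * f x"
    if "max X 1 \<le> x" "1 < d" for x d
  proof -
    have xd: "x \<le> d * x" using that by simp
    have Xd: "X \<le> d * x" "X \<le> x" using that xd by linarith+
    have i0: "set_integrable lborel {x..} f" and i1: "set_integrable lborel {x..d*x} f"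
      by (rule set_integrable_subset[OF int]; use Xd in auto)+
    have e: "H x - H (d * x) = (LBINT u:{x..d*x}. f u)"
      using set_integral_split_Ici[OF xd i0] by (simp add: H_def)
    note c = set_integral_const_Icc[OF xd]
    show "(d * x - x) * f (d * x) \<le> H x - H (d * x)"
      unfolding e c(2)[symmetric] using anti that
      by (intro set_integral_mono c i1) (auto simp: monotone_on_def)
    show "H x - H (d * x) \<le> (d * x - x) * f x"
      unfolding e c(2)[symmetric] using anti that
      by (intro set_integral_mono c i1) (auto simp: monotone_on_def)
  qed
  have lim1: "((\<lambda>d. (1 - d powr (- a)) / (d - 1)) \<longlongrightarrow> a) (at_right (1::real))"
    and lim2: "((\<lambda>d. d * (d powr a - 1) / (d - 1)) \<longlongrightarrow> a) (at_right (1::real))"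
  proof -
    have D: "((\<lambda>d. (d powr s - 1) / (d - 1)) \<longlongrightarrow> s) (at_right (1::real))" for s
    proof -
      have "((\<lambda>d. d powr s) has_real_derivative s) (at 1)"
        by (auto intro!: derivative_eq_intros)
      then have "((\<lambda>d. d powr s) has_real_derivative s) (at_right 1)" by (rule has_field_derivative_at_within)
      then show ?thesis by (simp add: has_field_derivative_iff)
    qed
    have "(1 - d powr (- a)) / (d - 1) = - ((d powr (- a) - 1) / (d - 1))" for d :: real
      by (simp add: minus_divide_left)
    then show "((\<lambda>d. (1 - d powr (- a)) / (d - 1)) \<longlongrightarrow> a) (at_right (1::real))"
      using tendsto_minus[OF D[of "- a"]] by (simp only: minus_minus)
    have "((\<lambda>d. d * ((d powr a - 1) / (d - 1))) \<longlongrightarrow> 1 * a) (at_right (1::real))"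
      by (intro tendsto_mult D tendsto_ident_at)
    then show "((\<lambda>d. d * (d powr a - 1) / (d - 1)) \<longlongrightarrow> a) (at_right (1::real))" by simp
  qed
  have "((\<lambda>x. x * f x / H x) \<longlongrightarrow> a) at_top"
  proof (rule order_tendstoI)
    fix b assume "b < a"
    then have "\<forall>\<^sub>F d in at_right (1::real). b < (1 - d powr (- a)) / (d - 1)" by (rule order_tendstoD(1)[OF lim1])
    then obtain h where h: "1 < h" "\<And>d. 1 < d \<Longrightarrow> d < h \<Longrightarrow> b < (1 - d powr (- a)) / (d - 1)"
      by (auto simp: eventually_at_right_field)
    obtain d where "1 < d" "d < h" using dense[OF h(1)] by auto
    with h(2) have d: "1 < d" "b < (1 - d powr (- a)) / (d - 1)" by auto
    have "((\<lambda>x. (1 - H (d * x) / H x) / (d - 1)) \<longlongrightarrow> (1 - d powr (- a)) / (d - 1)) at_top"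
      using d by (intro tendsto_intros regvarD[OF H']) auto
    then have "\<forall>\<^sub>F x in at_top. b < (1 - H (d * x) / H x) / (d - 1)" using d(2) by (rule order_tendstoD(1))
    then show "\<forall>\<^sub>F x in at_top. b < x * f x / H x"
      using regvar_pos[OF H'] eventually_ge_at_top[of "max X 1"]
    proof eventually_elim
      case (elim x)
      have "(H x - H (d * x)) / H x / (d - 1) \<le> (d * x - x) * f x / H x / (d - 1)"
        using bounds(2)[of x d] elim d by (intro divide_right_mono) auto
      also have "(d * x - x) * f x / H x / (d - 1) = x * f x / H x"
      proof -
        have "d * x - x = (d - 1) * x" by (simp add: algebra_simps)
        then show ?thesis using d by simp
      qed
      also have "(H x - H (d * x)) / H x / (d - 1) = (1 - H (d * x) / H x) / (d - 1)"
        using elim by (simp add: diff_divide_distrib)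
      finally show ?case using elim by linarith
    qed
  next
    fix b assume "a < b"
    then have "\<forall>\<^sub>F d in at_right (1::real). d * (d powr a - 1) / (d - 1) < b" by (rule order_tendstoD(2)[OF lim2])
    then obtain h where h: "1 < h" "\<And>d. 1 < d \<Longrightarrow> d < h \<Longrightarrow> d * (d powr a - 1) / (d - 1) < b"
      by (auto simp: eventually_at_right_field)
    obtain d where "1 < d" "d < h" using dense[OF h(1)] by auto
    with h(2) have d: "1 < d" "d * (d powr a - 1) / (d - 1) < b" by auto
    have "((\<lambda>x. d * (H ((1/d) * x) / H x - 1) / (d - 1)) \<longlongrightarrow> d * ((1/d) powr (- a) - 1) / (d - 1)) at_top"
      using d by (intro tendsto_intros regvarD[OF H']) auto
    moreover have "(1/d) powr (- a) = d powr a" using d by (simp add: powr_divide powr_minus)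
    ultimately have "((\<lambda>x. d * (H ((1/d) * x) / H x - 1) / (d - 1)) \<longlongrightarrow> d * (d powr a - 1) / (d - 1)) at_top" by simp
    then have "\<forall>\<^sub>F x in at_top. d * (H ((1/d) * x) / H x - 1) / (d - 1) < b" using d(2) by (rule order_tendstoD(2))
    then show "\<forall>\<^sub>F x in at_top. x * f x / H x < b"
      using regvar_pos[OF H'] eventually_ge_at_top[of "d * max X 1"]
    proof eventually_elim
      case (elim x)
      define y where "y = (1/d) * x"
      have "max X 1 * d \<le> x" using elim by (simp only: mult.commute)
      then have "max X 1 \<le> x / d" using d by (subst pos_le_divide_eq) auto
      then have y: "d * y = x" "max X 1 \<le> y" using d by (auto simp: y_def)
      have "(d * y - y) * f x \<le> H y - H x" using bounds(1)[of y d] y d by simp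
      then have "(d - 1) * (x * f x) \<le> d * (H y - H x)"
        using d mult_left_mono[of "(d * y - y) * f x" "H y - H x" d] by (simp add: y(1)[symmetric] algebra_simps)
      then have "x * f x \<le> d * (H y - H x) / (d - 1)" using d by (simp add: field_simps)
      then have "x * f x / H x \<le> d * (H y - H x) / (d - 1) / H x" using elim by (intro divide_right_mono) auto
      also have "\<dots> = d * (H y / H x - 1) / (d - 1)" using elim by (simp add: field_simps)
      finally show ?case using elim by (simp add: y_def)
    qed
  qed
  then show ?thesis by (simp add: H_def)
qed

text \<open>Far out, \<open>G(x) \<le> 2\<^sup>\<beta> G(2x)\<close>. Iterating this along
  \<open>u, 2u, 4u, \<dots>\<close> until \<open>x\<close> is passed gives the bound; monotonicity covers
  the last step.\<close>

lemma potter_bound: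
  fixes G :: "real \<Rightarrow> real"
  assumes G: "regvar G (- a)" and anti: "antimono_on {X0..} G" and ab: "a < \<beta>" "0 \<le> \<beta>"
  obtains X where "0 < X" "X0 \<le> X" "\<And>u x. X \<le> u \<Longrightarrow> u \<le> x \<Longrightarrow> 0 < G x \<and> G u \<le> 2 powr \<beta> * (x / u) powr \<beta> * G x"
proof -
  have "2 powr (- \<beta>) < (2::real) powr (- a)" using ab by simp
  from order_tendstoD(1)[OF regvarD[OF G, of 2] this]
  have "\<forall>\<^sub>F x in at_top. 2 powr (- \<beta>) < G (2 * x) / G x" by simp
  with regvar_pos[OF G] have "\<forall>\<^sub>F x in at_top. 0 < G x \<and> 2 powr (- \<beta>) < G (2 * x) / G x" by eventually_elim simp
  then obtain Y where Y: "\<And>x. Y \<le> x \<Longrightarrow> 0 < G x \<and> 2 powr (- \<beta>) < G (2 * x) / G x"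
    by (auto simp: eventually_at_top_linorder)
  define X where "X = max 1 (max X0 Y)"
  have dbl: "G x \<le> 2 powr \<beta> * G (2 * x)" and pos: "0 < G x" if "X \<le> x" for x
  proof -
    show p: "0 < G x" using Y[of x] that by (simp add: X_def)
    have "2 powr (- \<beta>) * G x \<le> G (2 * x)" using Y[of x] that p by (simp add: X_def field_simps)
    then have "2 powr \<beta> * (2 powr (- \<beta>) * G x) \<le> 2 powr \<beta> * G (2 * x)" by (intro mult_left_mono) auto
    then show "G x \<le> 2 powr \<beta> * G (2 * x)" by (simp add: powr_minus field_simps)
  qed
  have it: "G u \<le> (2 ^ n) powr \<beta> * G (2 ^ n * u)" if "X \<le> u" for u n
  proof (induction n)
    case (Suc n)
    have "u \<le> 2 ^ n * u" using that by (auto simp: X_def)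
    then have "X \<le> 2 ^ n * u" using that by linarith
    from dbl[OF this] have "(2 ^ n) powr \<beta> * G (2 ^ n * u) \<le> (2 ^ n) powr \<beta> * (2 powr \<beta> * G (2 * (2 ^ n * u)))"
      by (intro mult_left_mono) auto
    also have "\<dots> = (2 ^ Suc n) powr \<beta> * G (2 ^ Suc n * u)" by (simp add: powr_mult mult_ac)
    finally show ?case using Suc by linarith
  qed simp
  show ?thesis
  proof (rule that)
    show "0 < X" "X0 \<le> X" by (auto simp: X_def)
    fix u x assume ux: "X \<le> u" "u \<le> x"
    have u0: "0 < u" using ux by (auto simp: X_def)
    have "\<exists>n::nat. x \<le> 2 ^ n * u"
    proof -
      obtain n :: nat where "x / u < 2 ^ n" using real_arch_pow[of 2 "x / u"] by auto
      then show ?thesis using u0 by (intro exI[of _ n]) (simp add: field_simps)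
    qed
    \<comment> \<open>The number of doublings that just carries \<open>u\<close> up to \<open>x\<close> or beyond, so that \<open>2\<^sup>n \<le> 2x/u\<close>.\<close>
  define n where "n = (LEAST n::nat. x \<le> 2 ^ n * u)"
    have n: "x \<le> 2 ^ n * u" unfolding n_def by (rule LeastI_ex) fact
    have n2: "2 ^ n \<le> 2 * (x / u)"
    proof (cases n)
      case 0 then show ?thesis using ux u0 by (simp add: field_simps)
    next
      case (Suc m)
      then have "\<not> x \<le> 2 ^ m * u" using not_less_Least[of m "\<lambda>n. x \<le> 2 ^ n * u"] by (simp add: n_def)
      then show ?thesis using u0 Suc by (simp add: field_simps)
    qed
    have "G u \<le> (2 ^ n) powr \<beta> * G (2 ^ n * u)" by (rule it) fact
    also have "\<dots> \<le> (2 ^ n) powr \<beta> * G x"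
      using anti n ux by (intro mult_left_mono) (auto simp: monotone_on_def X_def)
    also have "\<dots> \<le> (2 * (x / u)) powr \<beta> * G x"
      using n2 ab pos[of x] ux by (intro mult_right_mono powr_mono2) auto
    also have "(2 * (x / u)) powr \<beta> = 2 powr \<beta> * (x / u) powr \<beta>" by (rule powr_mult)
    finally show "0 < G x \<and> G u \<le> 2 powr \<beta> * (x / u) powr \<beta> * G x" using pos[of x] ux by simp
  qed
qed

section \<open>Limits of convolutions and the Beta integral\<close>

text \<open>Slow variation of the integral of \<open>h\<close> means that its mass on \<open>[0,x]\<close> sits, to
  leading order, in \<open>[0,ex]\<close> for every fixed \<open>e > 0\<close>. There
  \<open>f(x - u)\<close> is close to \<open>f(x)\<close>.\<close>

lemma convolution_half_limit:
  fixes f h :: "real \<Rightarrow> real"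
  assumes f_anti: "\<And>x y. 0 < x \<Longrightarrow> x \<le> y \<Longrightarrow> f y \<le> f x" and f_rv: "regvar f r" and f_nonneg: "\<And>x. 0 \<le> f x"
    and h_nonneg: "\<And>x. 0 \<le> h x" and h_int: "\<And>x. set_integrable lborel {0..x} h"
    and h_rv: "regvar (\<lambda>x. LBINT u:{0..x}. h u) 0"
    and int: "\<And>x. 0 < x \<Longrightarrow> set_integrable lborel {0..x/2} (\<lambda>u. f (x - u) * h u)"
  shows "((\<lambda>x. (LBINT u:{0..x/2}. f (x - u) * h u) / (f x * (LBINT u:{0..x}. h u))) \<longlongrightarrow> 1) at_top"
proof -
  define K where "K x = (LBINT u:{0..x}. h u)" for x
  define I where "I x = (LBINT u:{0..x/2}. f (x - u) * h u)" for x
  have K_rv: "regvar K 0" using h_rv by (simp add: K_def[abs_def])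
  have K0: "0 \<le> K x" for x unfolding K_def using h_nonneg by (intro set_integral_nonneg')
  have K_le: "K x \<le> K y" if "0 \<le> x" "x \<le> y" for x y
  proof -
    have "set_integrable lborel {x..y} h" by (rule set_integrable_subset[OF h_int[of y]]) (use that in auto)
    then have "0 \<le> (LBINT u:{x..y}. h u)" using h_nonneg by (intro set_integral_nonneg')
    then show ?thesis using set_integral_split_Icc[OF that h_int[of y]] by (simp add: K_def)
  qed
  have low: "f x * K (x/2) \<le> I x" if x: "0 < x" for x
  proof -
    have "f x * K (x/2) = (LBINT u:{0..x/2}. f x * h u)" by (simp add: K_def)
    also have "\<dots> \<le> I x"
      unfolding I_def using x f_anti h_nonneg
      by (intro set_integral_mono set_integrable_mult_right h_int int mult_right_mono) auto
    finally show ?thesis .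
  qed
  have up: "I x \<le> f ((1 - e) * x) * K x + f ((1/2) * x) * (K x - K (e * x))" if x: "0 < x" and e: "0 < e" "e < 1/2" for x e
  proof -
    have ex: "0 \<le> e * x" "e * x \<le> x / 2" using x e by (auto simp: field_simps)
    have i1: "set_integrable lborel {0..e*x} (\<lambda>u. f (x - u) * h u)" and i2: "set_integrable lborel {e*x..x/2} (\<lambda>u. f (x - u) * h u)"
      by (rule set_integrable_subset[OF int[OF x]]; use ex in auto)+
    have i3: "set_integrable lborel {e*x..x/2} h" by (rule set_integrable_subset[OF h_int[of "x/2"]]) (use ex in auto)
    have "(LBINT u:{0..e*x}. f (x - u) * h u) \<le> (LBINT u:{0..e*x}. f ((1 - e) * x) * h u)"
      using x e h_nonneg ex
      by (intro set_integral_mono i1 set_integrable_mult_right h_int mult_right_mono f_anti) (auto simp: algebra_simps)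
    also have "\<dots> = f ((1 - e) * x) * K (e * x)" by (simp add: K_def)
    also have "\<dots> \<le> f ((1 - e) * x) * K x" using ex x e f_nonneg by (intro mult_left_mono K_le) auto
    finally have 1: "(LBINT u:{0..e*x}. f (x - u) * h u) \<le> f ((1 - e) * x) * K x" .
    have "(LBINT u:{e*x..x/2}. f (x - u) * h u) \<le> (LBINT u:{e*x..x/2}. f ((1/2) * x) * h u)"
      using x e h_nonneg ex
      by (intro set_integral_mono i2 set_integrable_mult_right i3 mult_right_mono f_anti) auto
    also have "\<dots> = f ((1/2) * x) * (K (x/2) - K (e * x))"
      using set_integral_split_Icc[OF ex h_int[of "x/2"]] by (simp add: K_def)
    also have "\<dots> \<le> f ((1/2) * x) * (K x - K (e * x))" using x f_nonneg by (intro mult_left_mono diff_right_mono K_le) auto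
    finally have 2: "(LBINT u:{e*x..x/2}. f (x - u) * h u) \<le> f ((1/2) * x) * (K x - K (e * x))" .
    show ?thesis unfolding I_def set_integral_split_Icc[OF ex int[OF x]] using 1 2 by linarith
  qed
  have "((\<lambda>x. I x / (f x * K x)) \<longlongrightarrow> 1) at_top"
  proof (rule order_tendstoI)
    fix a :: real assume "a < 1"
    have "((\<lambda>x. K ((1/2) * x) / K x) \<longlongrightarrow> 1) at_top" using regvarD[OF K_rv, of "1/2"] by simp
    from order_tendstoD(1)[OF this \<open>a < 1\<close>]
    show "\<forall>\<^sub>F x in at_top. a < I x / (f x * K x)"
      using regvar_pos[OF K_rv] regvar_pos[OF f_rv] eventually_gt_at_top[of 0]
    proof eventually_elim
      case (elim x)
      have "K (x/2) / K x = f x * K (x/2) / (f x * K x)" using elim by simp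
      also have "\<dots> \<le> I x / (f x * K x)" using low[of x] elim by (intro divide_right_mono) auto
      finally show ?case using elim by simp
    qed
  next
    fix a :: real assume a: "1 < a"
    have "((\<lambda>e. (1 - e) powr r) \<longlongrightarrow> (1 - 0) powr r) (at_right 0)"
      by (intro tendsto_intros) auto
    from order_tendstoD(2)[OF this, of a] a
    have "\<forall>\<^sub>F e in at_right 0. (1 - e) powr r < a" by simp
    then obtain e0 where e0: "0 < e0" "\<And>e. 0 < e \<Longrightarrow> e < e0 \<Longrightarrow> (1 - e) powr r < a"
      by (auto simp: eventually_at_right_field)
    define e where "e = min e0 (1/2) / 2"
    have e: "0 < e" "e < 1/2" "(1 - e) powr r < a" using e0 by (auto simp: e_def)
    have "((\<lambda>x. f ((1 - e) * x) / f x + f ((1/2) * x) / f x * (1 - K (e * x) / K x)) \<longlongrightarrow> (1 - e) powr r + (1/2) powr r * (1 - e powr 0)) at_top"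
      using e by (intro tendsto_intros regvarD[OF f_rv] regvarD[OF K_rv]) auto
    then have "((\<lambda>x. f ((1 - e) * x) / f x + f ((1/2) * x) / f x * (1 - K (e * x) / K x)) \<longlongrightarrow> (1 - e) powr r) at_top"
      using e by simp
    from order_tendstoD(2)[OF this e(3)]
    show "\<forall>\<^sub>F x in at_top. I x / (f x * K x) < a"
      using regvar_pos[OF K_rv] regvar_pos[OF f_rv] eventually_gt_at_top[of 0]
    proof eventually_elim
      case (elim x)
      have "I x / (f x * K x) \<le> (f ((1 - e) * x) * K x + f ((1/2) * x) * (K x - K (e * x))) / (f x * K x)"
        using up[of x e] elim e by (intro divide_right_mono) auto
      also have "\<dots> = f ((1 - e) * x) / f x + f ((1/2) * x) / f x * (1 - K (e * x) / K x)"
        using elim by (simp add: field_simps)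
      finally show ?case using elim by linarith
    qed
  qed
  then show ?thesis by (simp add: I_def K_def)
qed

lemma has_bochner_integral_Beta:
  fixes c :: real
  assumes "c < 1"
  shows "has_bochner_integral lborel (\<lambda>v. indicator {0<..<1} v * (v powr (- c) * (1 - v) powr (- c))) (Beta (1 - c) (1 - c))"
proof -
  have "((\<lambda>t. t powr (- c) * (1 - t) powr (- c)) has_integral Beta (1 - c) (1 - c)) {0<..<1}"
    using has_integral_Beta_real[of "1 - c" "1 - c"] assms by (simp add: has_integral_Icc_iff_Ioo)
  then have "((\<lambda>v. if v \<in> {0<..<1} then v powr (- c) * (1 - v) powr (- c) else 0) has_integral Beta (1 - c) (1 - c)) UNIV"
    by (rule has_integral_restrict_UNIV[THEN iffD2])
  moreover have "(\<lambda>v. if v \<in> {0<..<1} then v powr (- c) * (1 - v) powr (- c) else 0) = (\<lambda>v. indicator {0<..<1} v * (v powr (- c) * (1 - v) powr (- c)))"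
    by (auto simp: indicator_def)
  ultimately have h: "((\<lambda>v. indicator {0<..<1} v * (v powr (- c) * (1 - v) powr (- c))) has_integral Beta (1 - c) (1 - c)) UNIV" by simp
  have B: "0 \<le> Beta (1 - c) (1 - c)" using assms by (simp add: Beta_def)
  show ?thesis
    by (intro has_bochner_integral_nn_integral nn_integral_has_integral_lborel[OF _ _ h])
       (use B in \<open>auto simp: indicator_def\<close>)
qed

section \<open>First-order equivalence of the tails\<close>

context levy_tail
begin

lemma G_pos: "0 < x \<Longrightarrow> 0 < G x"
  unfolding G_def using k_pos by (intro tail_integral_pos k_div_integrable) auto

lemma G_antimono: "0 < x \<Longrightarrow> x \<le> y \<Longrightarrow> G y \<le> G x"
  unfolding G_def using k_div_integrable[of x] k_div_integrable[of y] k_div_nonneg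
  unfolding set_lebesgue_integral_def set_integrable_def
  by (intro integral_mono) (auto simp: indicator_def)

lemma G_measurable [measurable]: "G \<in> borel_measurable borel"
proof -
  have "G = (\<lambda>x. \<integral>y. (if x \<le> y then k y / y else 0) \<partial>lborel)"
    by (auto simp: G_def set_lebesgue_integral_def indicator_def fun_eq_iff intro!: Bochner_Integration.integral_cong)
  also have "\<dots> \<in> borel_measurable borel" by measurable
  finally show ?thesis .
qed

lemma k_le_G: "0 < x \<Longrightarrow> k x \<le> 2 * G (x / 2)"
proof -
  assume x: "0 < x"
  have i: "set_integrable lborel {x/2..} (\<lambda>y. k y / y)" using x by (intro k_div_integrable) auto
  have i': "set_integrable lborel {x/2..x} (\<lambda>y. k y / y)" by (rule set_integrable_subset[OF i]) auto
  have "(x - x / 2) * (k x / x) = (LBINT u:{x/2..x}. k x / x)" using x by (subst set_integral_const_Icc) auto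
  also have "\<dots> \<le> (LBINT u:{x/2..x}. k u / u)"
    using x k_nonneg k_mono by (intro set_integral_mono_Ioc i' set_integral_const_Icc) (auto intro!: frac_le)
  also have "\<dots> \<le> G (x / 2)"
    using set_integral_split_Ici[OF _ i, of x] x G_nonneg[of x] by (simp add: G_def)
  finally show ?thesis using x by simp
qed

lemma xk_le_M: "0 < x \<Longrightarrow> x * k x \<le> M x"
proof -
  assume x: "0 < x"
  have "x * k x = (LBINT u:{0..x}. k x)" using x by (subst set_integral_const_Icc) auto
  also have "\<dots> \<le> (LBINT u:{0..x}. k u)"
    using x k_mono by (intro set_integral_mono_Ioc k_integrable set_integral_const_Icc) auto
  finally show ?thesis using b_nonneg by (simp add: M_def)
qed

lemma M_increment: "0 < x \<Longrightarrow> x \<le> y \<Longrightarrow> M y = M x + (LBINT u:{x..y}. k u)"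
  using set_integral_split_Icc[of 0 x y k] k_integrable by (simp add: M_def)

lemma M_increment_le: "0 < x \<Longrightarrow> x \<le> y \<Longrightarrow> M y - M x \<le> (y - x) * k x"
proof -
  assume x: "0 < x" "x \<le> y"
  have "set_integrable lborel {x..y} k" by (rule set_integrable_subset[OF k_integrable[of y]]) (use x in auto)
  then have "(LBINT u:{x..y}. k u) \<le> (LBINT u:{x..y}. k x)"
    using x k_mono by (intro set_integral_mono_Ioc set_integral_const_Icc) auto
  also have "\<dots> = (y - x) * k x" using x by (intro set_integral_const_Icc)
  finally show ?thesis using M_increment[OF x] by simp
qed

lemma M_increment_ge: "0 < x \<Longrightarrow> x \<le> y \<Longrightarrow> (y - x) * k y \<le> M y - M x"
proof -
  assume x: "0 < x" "x \<le> y"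
  have "set_integrable lborel {x..y} k" by (rule set_integrable_subset[OF k_integrable[of y]]) (use x in auto)
  then have "(LBINT u:{x..y}. k y) \<le> (LBINT u:{x..y}. k u)"
    using x k_mono by (intro set_integral_mono_Ioc set_integral_const_Icc) auto
  also have "(LBINT u:{x..y}. k y) = (y - x) * k y" using x by (intro set_integral_const_Icc)
  finally show ?thesis using M_increment[OF x] by simp
qed

lemma k_div_antimono: "antimono_on {0<..} (\<lambda>y. k y / y)"
  using k_mono k_nonneg by (auto simp: monotone_on_def intro!: frac_le)

end

context conv_tail
begin

abbreviation "SR \<equiv> S R"

definition H :: "real \<Rightarrow> real" where "H x = (LBINT u:{0..x}. R u)"

lemma R_anti: "x \<le> y \<Longrightarrow> R y \<le> R x"
  using R_antimono by (simp add: antimono_def)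

lemma R_measurable [measurable]: "R \<in> borel_measurable borel"
proof -
  have "mono (\<lambda>x. - R x)" using R_anti by (auto simp: mono_def)
  then have "(\<lambda>x. - (- R x)) \<in> borel_measurable borel"
    by (intro borel_measurable_uminus borel_measurable_mono)
  then show ?thesis by simp
qed

lemma R_integrable: "set_integrable lborel {a..c} R"
proof (cases "a \<le> c")
  case True
  show ?thesis
    by (rule set_integrable_bound[OF set_integral_const_Icc(1)[OF True, of 1]])
       (auto simp: set_borel_measurable_def R_nonneg R_le_1)
qed (simp add: set_integrable_def)

lemma Rk_integrable: "set_integrable lborel {0..w} (\<lambda>y. R (x - y) * k y)"
proof (rule set_integrable_bound[OF k_integrable[of w]])
  show "AE y in lborel. y \<in> {0..w} \<longrightarrow> norm (R (x - y) * k y) \<le> norm (k y)"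
    using k_nonneg R_nonneg R_le_1 by (auto intro!: AE_I2 mult_left_le_one_le simp: abs_mult)
qed (simp add: set_borel_measurable_def)

lemma H_nonneg: "0 \<le> H x"
  unfolding H_def using R_nonneg by (intro set_integral_nonneg')

lemma S_nonneg: "0 \<le> SR x"
  unfolding S_def using R_nonneg k_nonneg b_nonneg
  by (intro add_nonneg_nonneg mult_nonneg_nonneg set_integral_nonneg') auto

lemma S_ge: "R x * M x \<le> SR x"
proof -
  have "R x * (LBINT y:{0..x}. k y) = (LBINT y:{0..x}. R x * k y)" by simp
  also have "\<dots> \<le> (LBINT y:{0..x}. R (x - y) * k y)"
    using k_nonneg R_anti by (intro set_integral_mono set_integrable_mult_right k_integrable Rk_integrable mult_right_mono) auto
  finally show ?thesis by (simp add: S_def M_def algebra_simps)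
qed

lemma conv_reflect:
  "(LBINT y:{x-e..x}. R (x - y) * k y) = (LBINT u:{0..e}. R u * k (x - u))"
proof -
  have "indicator {x-e..x} (x - u) = (indicator {0..e} u :: real)" for u by (auto simp: indicator_def)
  then show ?thesis
    unfolding set_lebesgue_integral_def
    using lborel_integral_real_affine[of "-1" "\<lambda>y. indicator {x-e..x} y *\<^sub>R (R (x - y) * k y)" x]
    by simp
qed

lemma S_split:
  assumes "0 < e" "e < x"
  shows "SR x = (LBINT y:{0..x-e}. R (x - y) * k y) + (LBINT u:{0..e}. R u * k (x - u)) + b * R x"
  using set_integral_split_Icc[OF _ _ Rk_integrable[of x x], of "x-e"] assms
  by (simp add: S_def conv_reflect)

lemma kR_integrable:
  assumes "0 < e" "e < x"
  shows "set_integrable lborel {0..e} (\<lambda>u. R u * k (x - u))"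
proof (rule set_integrable_bound[OF set_integral_const_Icc(1)[of 0 e "k (x-e)"]])
  show "AE u in lborel. u \<in> {0..e} \<longrightarrow> norm (R u * k (x - u)) \<le> norm (k (x-e))"
  proof (intro AE_I2 impI)
    fix u assume u: "u \<in> {0..e}"
    have "k (x - u) \<le> k (x-e)" using u assms by (intro k_mono) auto
    then have "R u * k (x - u) \<le> 1 * k (x-e)"
      using R_le_1[of u] R_nonneg[of u] k_nonneg[of "x - u"] by (intro mult_mono) auto
    then show "norm (R u * k (x - u)) \<le> norm (k (x-e))"
      using R_nonneg[of u] k_nonneg[of "x - u"] k_nonneg[of "x-e"] by (simp add: abs_mult)
  qed
qed (use assms in \<open>auto simp: set_borel_measurable_def\<close>)

lemma S_le_split:
  assumes e: "0 < e" "e < x"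
  shows "SR x \<le> R e * M x + k (x - e) * H e"
proof -
  have "(LBINT y:{0..x-e}. R (x - y) * k y) \<le> (LBINT y:{0..x-e}. R e * k y)"
    using k_nonneg R_anti e by (intro set_integral_mono set_integrable_mult_right k_integrable Rk_integrable mult_right_mono) auto
  also have "\<dots> = R e * (M (x - e) - b)" by (simp add: M_def)
  also have "\<dots> \<le> R e * (M x - b)" using R_nonneg e by (intro mult_left_mono diff_right_mono monoD[OF M_mono]) auto
  finally have 1: "(LBINT y:{0..x-e}. R (x - y) * k y) \<le> R e * (M x - b)" .
  have "(LBINT u:{0..e}. R u * k (x - u)) \<le> (LBINT u:{0..e}. R u * k (x - e))"
    using k_mono e R_nonneg by (intro set_integral_mono kR_integrable set_integrable_mult_left R_integrable mult_left_mono) auto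
  also have "\<dots> = k (x - e) * H e" by (simp add: H_def mult.commute)
  finally have 2: "(LBINT u:{0..e}. R u * k (x - u)) \<le> k (x - e) * H e" .
  have 3: "b * R x \<le> R e * b" using R_anti[of e x] e b_nonneg by (simp add: mult.commute mult_left_mono)
  show ?thesis unfolding S_split[OF e] using 1 2 3 by (simp add: right_diff_distrib)
qed

lemma S_le: "0 < x \<Longrightarrow> SR x \<le> R (x/2) * M x + k (x/2) * H (x/2)"
  using S_le_split[of "x/2" x] by simp

lemma G_lim: "(G \<longlongrightarrow> 0) at_top"
proof -
  have "\<forall>\<^sub>F x in at_top. R x < 1/2" using order_tendstoD(2)[OF R_lim, of "1/2"] by simp
  then obtain A0 where A0: "\<And>x. A0 \<le> x \<Longrightarrow> R x < 1/2" by (auto simp: eventually_at_top_linorder)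
  define A where "A = max A0 1"
  have A: "0 < A" "R A < 1/2" unfolding A_def using A0[of "max A0 1"] by auto
  show ?thesis
  proof (rule tendsto_sandwich[of "\<lambda>_. 0" _ _ "\<lambda>x. 4 / t * R x"])
    show "\<forall>\<^sub>F x in at_top. G x \<le> 4 / t * R x"
      using eventually_ge_at_top[of A]
    proof eventually_elim
      case (elim x)
      then have x: "0 < x" using A by linarith
      have "1/2 * (1/2) \<le> (1 - R A) * (x / (x + A))"
        using A x elim by (intro mult_mono) (auto simp: field_simps)
      then have "t * (1/2 * (1/2)) * G x \<le> t * ((1 - R A) * (x / (x + A))) * G x"
        using t_pos G_nonneg by (intro mult_right_mono mult_left_mono) auto
      also have "\<dots> \<le> R x" using tail_lower[OF x A(1)] by (simp add: mult.assoc)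
      finally show ?case using t_pos by (simp add: field_simps)
    qed
    show "((\<lambda>x. 4 / t * R x) \<longlongrightarrow> 0) at_top" by (rule tendsto_mult_right_zero[OF R_lim])
  qed (auto simp: G_nonneg)
qed

lemma k_lim: "(k \<longlongrightarrow> 0) at_top"
proof (rule tendsto_sandwich[of "\<lambda>_. 0" _ _ "\<lambda>x. 2 * G ((1/2) * x)"])
  show "\<forall>\<^sub>F x in at_top. k x \<le> 2 * G ((1/2) * x)"
    using eventually_gt_at_top[of 0] by eventually_elim (use k_le_G in auto)
  show "((\<lambda>x. 2 * G ((1/2) * x)) \<longlongrightarrow> 0) at_top"
    by (intro tendsto_mult_right_zero tendsto_at_top_times G_lim) auto
qed (auto simp: k_nonneg)

lemma M_div_lim: "((\<lambda>x. M x / x) \<longlongrightarrow> 0) at_top"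
proof -
  have "((\<lambda>x. b / x + (LBINT u:{0..x}. k u) / x) \<longlongrightarrow> 0 + 0) at_top"
    by (intro tendsto_add cesaro_mean_tendsto_0 k_integrable k_lim) real_asymp
  then show ?thesis by (simp add: M_def add_divide_distrib)
qed

lemma H_div_lim: "((\<lambda>x. H x / x) \<longlongrightarrow> 0) at_top"
  unfolding H_def by (intro cesaro_mean_tendsto_0 R_integrable R_lim)

lemma S_div_M_lim: "((\<lambda>x. SR x / M x) \<longlongrightarrow> 0) at_top"
proof (rule tendsto_sandwich[of "\<lambda>_. 0" _ _ "\<lambda>x. R ((1/2) * x) + H ((1/2) * x) / ((1/2) * x)"])
  show "\<forall>\<^sub>F x in at_top. 0 \<le> SR x / M x"
    using eventually_gt_at_top[of 0] by eventually_elim (use M_pos S_nonneg in \<open>auto intro!: divide_nonneg_pos\<close>)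
  show "\<forall>\<^sub>F x in at_top. SR x / M x \<le> R ((1/2) * x) + H ((1/2) * x) / ((1/2) * x)"
    using eventually_gt_at_top[of 0]
  proof eventually_elim
    case (elim x)
    have "x / 2 * k (x / 2) \<le> M (x / 2)" using elim by (intro xk_le_M) auto
    also have "\<dots> \<le> M x" using elim by (intro monoD[OF M_mono]) auto
    finally have "k (x/2) \<le> M x / (x/2)" using elim by (simp add: field_simps)
    then have "k (x/2) * H (x/2) \<le> M x / (x/2) * H (x/2)" using H_nonneg by (intro mult_right_mono)
    with S_le[OF elim] have "SR x \<le> M x * (R (x/2) + H (x/2) / (x/2))" by (simp add: algebra_simps)
    then show ?case using M_pos[OF elim] by (simp add: field_simps)
  qed
  have "((\<lambda>x. R ((1/2) * x) + H ((1/2) * x) / ((1/2) * x)) \<longlongrightarrow> 0 + 0) at_top"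
    by (intro tendsto_add tendsto_at_top_times R_lim tendsto_at_top_times[OF _ H_div_lim]) auto
  then show "((\<lambda>x. R ((1/2) * x) + H ((1/2) * x) / ((1/2) * x)) \<longlongrightarrow> 0) at_top" by simp
qed simp

text \<open>The rate at which \<open>S(x)/x\<close> is negligible against the tails.\<close>

definition small :: "real \<Rightarrow> real" where
  "small x = M x / x + H ((1/2) * x) / ((1/2) * x)"

lemma small_lim: "(small \<longlongrightarrow> 0) at_top"
proof -
  have "((\<lambda>x. M x / x + H ((1/2) * x) / ((1/2) * x)) \<longlongrightarrow> 0 + 0) at_top"
    by (intro tendsto_add M_div_lim tendsto_at_top_times[OF _ H_div_lim]) auto
  then show ?thesis unfolding small_def[abs_def] by simp
qed

lemma small_nonneg: "0 < x \<Longrightarrow> 0 \<le> small x"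
  unfolding small_def using M_pos[of x] H_nonneg[of "(1/2) * x"] by (intro add_nonneg_nonneg divide_nonneg_pos) auto

lemma S_div_le:
  assumes x: "0 < x"
  shows "SR x / x \<le> small x * (R ((1/2) * x) + G ((1/4) * x))"
proof -
  have "k (x/2) \<le> 2 * G ((1/4) * x)" using k_le_G[of "x/2"] x by simp
  then have "k (x/2) * H (x/2) \<le> 2 * G ((1/4) * x) * H (x/2)" using H_nonneg by (intro mult_right_mono)
  with S_le[OF x] have "SR x \<le> R (x/2) * M x + 2 * G ((1/4) * x) * H (x/2)" by linarith
  then have "SR x / x \<le> (R (x/2) * M x + 2 * G ((1/4) * x) * H (x/2)) / x" using x by (intro divide_right_mono) auto
  also have "\<dots> = R (x/2) * (M x / x) + G ((1/4) * x) * (H (x/2) / (x/2))" by (simp add: add_divide_distrib)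
  also have "\<dots> \<le> R (x/2) * small x + G ((1/4) * x) * small x"
    using x M_pos[OF x] H_nonneg[of "x/2"] R_nonneg G_nonneg
    by (intro add_mono mult_left_mono) (auto simp: small_def)
  finally show ?thesis by (simp add: algebra_simps)
qed

lemma R_le: "0 < x \<Longrightarrow> R x \<le> t * G x + t * small x * (R ((1/2) * x) + G ((1/4) * x))"
proof -
  assume x: "0 < x"
  have "0 \<le> (LBINT w:{x..}. SR w / w\<^sup>2)"
    using S_nonneg by (intro set_integral_nonneg') auto
  then have "t * (SR x / x - (LBINT w:{x..}. SR w / w\<^sup>2)) \<le> t * (small x * (R ((1/2) * x) + G ((1/4) * x)))"
    using S_div_le[OF x] t_pos by (intro mult_left_mono) auto
  then show ?thesis using tail_diff[OF x] by (simp add: mult.assoc)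
qed

text \<open>The bound \<open>tail_lower\<close> with \<open>A = \<surd>x\<close>, which grows but is of smaller
  order than \<open>x\<close>, so that the factor tends to \<open>1\<close>.\<close>

definition theta :: "real \<Rightarrow> real" where "theta x = (1 - R (sqrt x)) * (x / (x + sqrt x))"

lemma theta_lim: "(theta \<longlongrightarrow> 1) at_top"
proof -
  have "((\<lambda>x. (1 - R (sqrt x)) * (x / (x + sqrt x))) \<longlongrightarrow> (1 - 0) * 1) at_top"
    by (intro tendsto_intros filterlim_compose[OF R_lim sqrt_at_top]) real_asymp
  then show ?thesis by (simp add: theta_def[abs_def])
qed

lemma R_ge: "0 < x \<Longrightarrow> t * theta x * G x \<le> R x"
  using tail_lower[of x "sqrt x"] by (simp add: theta_def mult.assoc)

text \<open>From below \<open>R\<close> is at least \<open>t \<theta> G\<close>. From above \<open>R - t G\<close>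
  is a small multiple of \<open>R(x/2) + G(x/4)\<close>; the lower bound turns \<open>G(x/4)\<close> into
  a multiple of \<open>R(x/4)\<close>, and regular variation compares both with \<open>R(x)\<close>.\<close>

lemma levy_tail_equivalent_of_regvar:
  assumes RV: "regvar R (- a)"
  shows "((\<lambda>x. t * G x / R x) \<longlongrightarrow> 1) at_top"
proof -
  let ?l = "\<lambda>x. 1 - small x * (t * (R ((1/2) * x) / R x) + 1 / theta ((1/4) * x) * (R ((1/4) * x) / R x))"
  have up: "\<forall>\<^sub>F x in at_top. t * G x / R x \<le> 1 / theta x"
    using regvar_pos[OF RV] order_tendstoD(1)[OF theta_lim, of 0, simplified] eventually_gt_at_top[of 0]
  proof eventually_elim
    case (elim x)
    have "theta x * (t * G x) \<le> R x" using R_ge[of x] elim by (simp add: mult_ac)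
    then show ?case using elim by (simp add: field_simps)
  qed
  have ul: "((\<lambda>x. 1 / theta x) \<longlongrightarrow> 1) at_top"
    using tendsto_divide[OF tendsto_const theta_lim, of 1] by simp
  have p4: "\<forall>\<^sub>F x in at_top. 0 < R ((1/4) * x)"
    by (rule eventually_at_top_times[OF _ regvar_pos[OF RV]]) simp
  have u4: "\<forall>\<^sub>F x in at_top. t * G ((1/4) * x) / R ((1/4) * x) \<le> 1 / theta ((1/4) * x)"
    by (rule eventually_at_top_times[OF _ up]) simp
  have lo: "\<forall>\<^sub>F x in at_top. ?l x \<le> t * G x / R x"
    using regvar_pos[OF RV] p4 u4 eventually_gt_at_top[of 0]
  proof eventually_elim
    case (elim x)
    have p: "0 < R x" "0 < R ((1/4) * x)" using elim by auto
    have "t * G ((1/4) * x) / R x = t * G ((1/4) * x) / R ((1/4) * x) * (R ((1/4) * x) / R x)" using p by simp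
    also have "\<dots> \<le> 1 / theta ((1/4) * x) * (R ((1/4) * x) / R x)"
      using elim p by (intro mult_right_mono) auto
    finally have q: "t * G ((1/4) * x) / R x \<le> 1 / theta ((1/4) * x) * (R ((1/4) * x) / R x)" .
    have "R x / R x \<le> (t * G x + t * small x * (R ((1/2) * x) + G ((1/4) * x))) / R x"
      using R_le[of x] elim p by (intro divide_right_mono) auto
    then have "1 \<le> t * G x / R x + small x * (t * (R ((1/2) * x) / R x) + t * G ((1/4) * x) / R x)"
      using p by (simp add: add_divide_distrib algebra_simps)
    moreover have "small x * (t * (R ((1/2) * x) / R x) + t * G ((1/4) * x) / R x)
       \<le> small x * (t * (R ((1/2) * x) / R x) + 1 / theta ((1/4) * x) * (R ((1/4) * x) / R x))"
      using q small_nonneg[of x] elim by (intro mult_left_mono add_left_mono) auto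
    ultimately show ?case by linarith
  qed
  have "(?l \<longlongrightarrow> 1 - 0 * (t * (1/2) powr (- a) + 1 / 1 * (1/4) powr (- a))) at_top"
    by (intro tendsto_intros small_lim tendsto_at_top_times[OF _ theta_lim] regvarD[OF RV]) auto
  then have "(?l \<longlongrightarrow> 1) at_top" by simp
  then show ?thesis by (rule tendsto_sandwich[OF lo up _ ul])
qed

text \<open>Now regular variation is known for \<open>G\<close> instead of \<open>R\<close>, and the upper bound
  still contains \<open>R(x/2)\<close>. The quotient \<open>f = R/G\<close> satisfies
  \<open>f(x) \<le> d(x) + c(x) f(x/2)\<close> with \<open>c \<rightarrow> 0\<close> and
  \<open>d \<rightarrow> t\<close>. This makes \<open>f\<close> bounded, and then the same inequality
  gives the limit.\<close>

lemma tail_equivalent_of_regvar_levy: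
  assumes GV: "regvar G (- a)"
  shows "((\<lambda>x. R x / G x) \<longlongrightarrow> t) at_top"
proof -
  define c where "c x = small x * t * (G ((1/2) * x) / G x)" for x
  define d where "d x = t + small x * t * (G ((1/4) * x) / G x)" for x
  have c_lim: "(c \<longlongrightarrow> 0) at_top"
  proof -
    have "((\<lambda>x. small x * t * (G ((1/2) * x) / G x)) \<longlongrightarrow> 0 * t * (1/2) powr (- a)) at_top"
      by (intro tendsto_intros small_lim regvarD[OF GV]) auto
    then show ?thesis by (simp add: c_def[abs_def])
  qed
  have d_lim: "(d \<longlongrightarrow> t) at_top"
  proof -
    have "((\<lambda>x. t + small x * t * (G ((1/4) * x) / G x)) \<longlongrightarrow> t + 0 * t * (1/4) powr (- a)) at_top"
      by (intro tendsto_intros small_lim regvarD[OF GV]) auto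
    then show ?thesis by (simp add: d_def[abs_def])
  qed
  define f where "f x = R x / G x" for x
  have rec: "f x \<le> d x + c x * f ((1/2) * x)" if x: "0 < x" for x
  proof -
    have g: "0 < G x" "0 < G ((1/2) * x)" using x by (auto intro!: G_pos)
    have "R x / G x \<le> (t * G x + t * small x * (R ((1/2) * x) + G ((1/4) * x))) / G x"
      using R_le[OF x] g by (intro divide_right_mono) auto
    also have "\<dots> = d x + c x * f ((1/2) * x)"
      using g by (simp add: d_def c_def f_def add_divide_distrib algebra_simps)
    finally show ?thesis by (simp add: f_def)
  qed
  have f0: "0 \<le> f x" for x using R_nonneg G_nonneg by (simp add: f_def)
  have "\<forall>\<^sub>F x in at_top. c x \<le> 1/2 \<and> d x \<le> t + 1"
    using order_tendstoD(2)[OF c_lim, of "1/2"] order_tendstoD(2)[OF d_lim, of "t + 1"]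
    by simp (auto elim: eventually_elim2)
  then obtain X0 where X0: "\<And>x. X0 \<le> x \<Longrightarrow> c x \<le> 1/2 \<and> d x \<le> t + 1"
    by (auto simp: eventually_at_top_linorder)
  define X where "X = max X0 1"
  have X: "1 \<le> X" "\<And>x. X \<le> x \<Longrightarrow> c x \<le> 1/2 \<and> d x \<le> t + 1"
    by (simp add: X_def, rule X0, simp add: X_def)
  define B where "B = max (2 * (t + 1)) (1 / G X)"
  \<comment> \<open>Beyond \<open>X\<close> one has \<open>f(x) \<le> t + 1 + f(x/2)/2\<close>, so \<open>B \<ge> 2 (t + 1)\<close> is preserved from one dyadic scale to the next.\<close>
  have bound: "X / 2 \<le> x \<Longrightarrow> x \<le> 2 ^ n * X \<Longrightarrow> f x \<le> B" for n :: nat and x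
  proof (induction n arbitrary: x)
    case 0
    then have "0 < x" "x \<le> X" using X by auto
    then have "R x / G x \<le> 1 / G X" using R_le_1 R_nonneg G_antimono[of x X] G_pos[of X] X by (intro frac_le) auto
    then show ?case by (simp add: f_def B_def)
  next
    case (Suc n)
    show ?case
    proof (cases "x \<le> X")
      case True
      then have "0 < x" using Suc.prems X by auto
      then have "R x / G x \<le> 1 / G X" using True R_le_1 R_nonneg G_antimono[of x X] G_pos[of X] X by (intro frac_le) auto
      then show ?thesis by (simp add: f_def B_def)
    next
      case False
      have fx: "f ((1/2) * x) \<le> B" using Suc.IH[of "(1/2) * x"] Suc.prems False by auto
      have "f x \<le> d x + c x * f ((1/2) * x)" using False X by (intro rec) auto
      also have "\<dots> \<le> (t + 1) + 1/2 * B"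
      proof (intro add_mono)
        show "d x \<le> t + 1" using X(2)[of x] False by simp
        have "c x * f ((1/2) * x) \<le> 1/2 * f ((1/2) * x)" using X(2)[of x] False f0 by (intro mult_right_mono) auto
        also have "\<dots> \<le> 1/2 * B" using fx by simp
        finally show "c x * f ((1/2) * x) \<le> 1/2 * B" .
      qed
      also have "\<dots> \<le> B" by (auto simp: B_def max_def)
      finally show ?thesis .
    qed
  qed
  have fB: "f x \<le> B" if "X / 2 \<le> x" for x
  proof -
    obtain n :: nat where "x / X < 2 ^ n" using real_arch_pow[of 2 "x / X"] by auto
    then have "x \<le> 2 ^ n * X" using X by (simp add: field_simps)
    with that show ?thesis by (rule bound)
  qed
  have "(f \<longlongrightarrow> t) at_top"
  proof (rule tendsto_sandwich)
    show "\<forall>\<^sub>F x in at_top. t * theta x \<le> f x"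
      using eventually_gt_at_top[of 0]
    proof eventually_elim
      case (elim x)
      then show ?case using R_ge[of x] G_pos[of x] by (simp add: f_def field_simps)
    qed
    show "\<forall>\<^sub>F x in at_top. f x \<le> d x + \<bar>c x\<bar> * B"
      using eventually_ge_at_top[of X]
    proof eventually_elim
      case (elim x)
      have "c x * f ((1/2) * x) \<le> \<bar>c x\<bar> * B" using fB[of "(1/2) * x"] f0 elim by (intro mult_mono) auto
      then show ?case using rec[of x] elim X by auto
    qed
    have "((\<lambda>x. t * theta x) \<longlongrightarrow> t * 1) at_top" by (intro tendsto_intros theta_lim)
    then show "((\<lambda>x. t * theta x) \<longlongrightarrow> t) at_top" by simp
    have "((\<lambda>x. d x + \<bar>c x\<bar> * B) \<longlongrightarrow> t + \<bar>0\<bar> * B) at_top" by (intro tendsto_intros c_lim d_lim)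
    then show "((\<lambda>x. d x + \<bar>c x\<bar> * B) \<longlongrightarrow> t) at_top" by simp
  qed
  then show ?thesis by (simp add: f_def[abs_def])
qed

end

section \<open>Index below one\<close>

context levy_tail
begin

lemma k_div_G_lim:
  assumes "regvar G (- a)"
  shows "((\<lambda>x. k x / G x) \<longlongrightarrow> a) at_top"
proof -
  have "((\<lambda>x. x * (k x / x) / (LBINT u:{x..}. k u / u)) \<longlongrightarrow> a) at_top"
  proof (rule monotone_density[OF _ k_int1])
    show "antimono_on {1..} (\<lambda>y. k y / y)" using k_div_antimono by (auto simp: monotone_on_def)
    show "regvar (\<lambda>x. LBINT u:{x..}. k u / u) (- a)" using assms by (simp add: G_def[abs_def])
  qed
  then show ?thesis
    by (rule Lim_transform_eventually)
       (use eventually_gt_at_top[of 0] in \<open>eventually_elim, simp add: G_def\<close>)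
qed

text \<open>\<open>M\<close> is concave and nonnegative.\<close>

lemma M_div_antimono: "0 < x \<Longrightarrow> x \<le> y \<Longrightarrow> M y / y \<le> M x / x"
proof -
  assume x: "0 < x" "x \<le> y"
  have "(y - x) * (x * k x) \<le> (y - x) * M x" using xk_le_M[OF x(1)] x by (intro mult_left_mono) auto
  moreover have "x * (M y - M x) \<le> x * ((y - x) * k x)" using M_increment_le[OF x] x by (intro mult_left_mono) auto
  ultimately have "M y * x \<le> M x * y" by (simp add: algebra_simps)
  then show ?thesis using x by (simp add: field_simps)
qed

end

context conv_tail
begin

lemma tail_diff_limit:
  assumes S: "((\<lambda>x. SR x / x / E x) \<longlongrightarrow> s) at_top"
    and I: "((\<lambda>x. (LBINT w:{x..}. SR w / w\<^sup>2) / E x) \<longlongrightarrow> i) at_top"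
  shows "((\<lambda>x. (R x - t * G x) / E x) \<longlongrightarrow> t * (s - i)) at_top"
proof -
  have "((\<lambda>x. t * (SR x / x / E x - (LBINT w:{x..}. SR w / w\<^sup>2) / E x)) \<longlongrightarrow> t * (s - i)) at_top"
    by (intro tendsto_intros S I)
  then show ?thesis
    by (rule Lim_transform_eventually)
       (use eventually_gt_at_top[of 0] in \<open>eventually_elim, simp add: tail_diff diff_divide_distrib right_diff_distrib\<close>)
qed

lemma xG_at_top:
  assumes GV: "regvar G (- a)" and a: "0 \<le> a" "a < 1"
  shows "filterlim (\<lambda>x. x * G x) at_top at_top"
proof -
  define \<beta> where "\<beta> = (a + 1) / 2"
  have b: "a < \<beta>" "0 \<le> \<beta>" "\<beta> < 1" using a by (auto simp: \<beta>_def)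
  have an: "antimono_on {1..} G" using G_antimono by (auto simp: monotone_on_def)
  obtain X where X: "0 < X" "1 \<le> X" "\<And>u x. X \<le> u \<Longrightarrow> u \<le> x \<Longrightarrow> 0 < G x \<and> G u \<le> 2 powr \<beta> * (x / u) powr \<beta> * G x"
    using potter_bound[OF GV an b(1,2)] by blast
  define c where "c = G X * X powr \<beta> / 2 powr \<beta>"
  have c: "0 < c" using G_pos[of X] X by (simp add: c_def)
  have "filterlim (\<lambda>x. c * x powr (1 - \<beta>)) at_top at_top"
    using c b by real_asymp
  then show ?thesis
  proof (rule filterlim_at_top_mono)
    show "\<forall>\<^sub>F x in at_top. c * x powr (1 - \<beta>) \<le> x * G x"
      using eventually_ge_at_top[of X]
    proof eventually_elim
      case (elim x)
      have "x powr (1 - \<beta>) * G X \<le> x powr (1 - \<beta>) * (2 powr \<beta> * (x / X) powr \<beta> * G x)"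
        using X(3)[of X x] elim by (intro mult_left_mono) auto
      also have "\<dots> = (x powr (1 - \<beta>) * x powr \<beta>) * (2 powr \<beta> / X powr \<beta> * G x)"
        using X elim by (simp add: powr_divide)
      also have "x powr (1 - \<beta>) * x powr \<beta> = x" using X elim by (simp flip: powr_add)
      finally show ?case using X elim by (simp add: c_def field_simps)
    qed
  qed
qed

text \<open>For \<open>R\<close> the bound extends down to all \<open>u > 0\<close>, since \<open>R \<le> 1\<close>
  and \<open>x\<^sup>\<beta> G(x)\<close> is bounded below.\<close>

lemma R_potter:
  assumes GV: "regvar G (- a)" and a: "0 \<le> a" "a < \<beta>"
  obtains X C where "1 \<le> X" "0 < C" 
    "\<And>u x. 0 < u \<Longrightarrow> u \<le> x \<Longrightarrow> X \<le> x \<Longrightarrow> R u \<le> C * (x / u) powr \<beta> * G x"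
    "\<And>u x. X \<le> u \<Longrightarrow> u \<le> x \<Longrightarrow> k u \<le> C * (x / u) powr \<beta> * G x"
proof -
  have an: "antimono_on {1..} G" using G_antimono by (auto simp: monotone_on_def)
  obtain X0 where X0: "0 < X0" "1 \<le> X0" "\<And>u x. X0 \<le> u \<Longrightarrow> u \<le> x \<Longrightarrow> 0 < G x \<and> G u \<le> 2 powr \<beta> * (x / u) powr \<beta> * G x"
    using potter_bound[OF GV an a(2) order_trans[OF a(1) less_imp_le[OF a(2)]]] by blast
  have "\<forall>\<^sub>F x in at_top. R x / G x < t + 1" by (rule order_tendstoD(2)[OF tail_equivalent_of_regvar_levy[OF GV]]) simp
  moreover have "\<forall>\<^sub>F x in at_top. k x / G x < a + 1" by (rule order_tendstoD(2)[OF k_div_G_lim[OF GV]]) simp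
  ultimately have "\<forall>\<^sub>F x in at_top. R x / G x < t + 1 \<and> k x / G x < a + 1" by eventually_elim simp
  then obtain X1 where X1: "\<And>x. X1 \<le> x \<Longrightarrow> R x / G x < t + 1 \<and> k x / G x < a + 1" by (auto simp: eventually_at_top_linorder)
  define X where "X = max X0 X1"
  have X: "1 \<le> X" "X0 \<le> X" using X0 by (auto simp: X_def)
  have RG: "R x \<le> (t + 1) * G x" and kG: "k x \<le> (a + 1) * G x" if "X \<le> x" for x
  proof -
    have "R x / G x < t + 1 \<and> k x / G x < a + 1" using that by (intro X1) (auto simp: X_def)
    moreover have "0 < G x" using that X by (intro G_pos) auto
    ultimately show "R x \<le> (t + 1) * G x" "k x \<le> (a + 1) * G x" by (auto simp: pos_divide_less_eq intro: less_imp_le)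
  qed
  have GX: "0 < G X" using X by (intro G_pos) auto
  define C where "C = max ((t + 1) * 2 powr \<beta>) (max ((a + 1) * 2 powr \<beta>) (2 powr \<beta> / G X))"
  have C: "(t + 1) * 2 powr \<beta> \<le> C" "(a + 1) * 2 powr \<beta> \<le> C" "2 powr \<beta> / G X \<le> C"
    by (simp_all only: C_def le_max_iff_disj order_refl simp_thms)
  have "0 < 2 powr \<beta> / G X" using GX by simp
  then have C0: "0 < C" using C(3) by linarith
  have G0: "0 \<le> (x / u) powr \<beta> * G x" for x u using G_nonneg by simp
  show ?thesis
  proof (rule that[OF X(1) C0])
    fix u x :: real assume u: "X \<le> u" "u \<le> x"
    have g: "G u \<le> 2 powr \<beta> * (x / u) powr \<beta> * G x" using X0(3)[of u x] u X by auto
    have "k u \<le> (a + 1) * G u" by (rule kG[OF u(1)])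
    also have "\<dots> \<le> (a + 1) * (2 powr \<beta> * (x / u) powr \<beta> * G x)" using g a by (intro mult_left_mono) auto
    also have "\<dots> = ((a + 1) * 2 powr \<beta>) * ((x / u) powr \<beta> * G x)" by simp
    also have "\<dots> \<le> C * ((x / u) powr \<beta> * G x)" by (intro mult_right_mono C G0)
    finally show "k u \<le> C * (x / u) powr \<beta> * G x" by (simp add: mult.assoc)
  next
    fix u x :: real assume u: "0 < u" "u \<le> x" "X \<le> x"
    show "R u \<le> C * (x / u) powr \<beta> * G x"
    proof (cases "X \<le> u")
      case True
      have g: "G u \<le> 2 powr \<beta> * (x / u) powr \<beta> * G x" using X0(3)[of u x] u True X by auto
      have "R u \<le> (t + 1) * G u" by (rule RG[OF True])
      also have "\<dots> \<le> (t + 1) * (2 powr \<beta> * (x / u) powr \<beta> * G x)" using g t_pos by (intro mult_left_mono) auto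
      also have "\<dots> = ((t + 1) * 2 powr \<beta>) * ((x / u) powr \<beta> * G x)" by simp
      also have "\<dots> \<le> C * ((x / u) powr \<beta> * G x)" by (intro mult_right_mono C G0)
      finally show ?thesis by (simp add: mult.assoc)
    next
      case False
      have "G X \<le> 2 powr \<beta> * (x / X) powr \<beta> * G x" using X0(3)[of X x] u X by auto
      also have "\<dots> \<le> 2 powr \<beta> * (x / u) powr \<beta> * G x"
        using False u X a G_nonneg by (intro mult_right_mono mult_left_mono powr_mono2 divide_left_mono) auto
      finally have "1 \<le> 2 powr \<beta> / G X * ((x / u) powr \<beta> * G x)" using GX by (simp add: field_simps)
      also have "\<dots> \<le> C * ((x / u) powr \<beta> * G x)" by (intro mult_right_mono C G0)
      finally show ?thesis using R_le_1[of u] by (simp add: mult.assoc)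
    qed
  qed
qed

lemma R_scaled_lim:
  assumes "regvar G (- a)" and "0 < c"
  shows "((\<lambda>x. R (c * x) / G x) \<longlongrightarrow> t * c powr (- a)) at_top"
  by (rule regvar_scaled_limit[OF assms(1) tail_equivalent_of_regvar_levy[OF assms(1)] assms(2)])

lemma k_scaled_lim:
  assumes "regvar G (- a)" and "0 < c"
  shows "((\<lambda>x. k (c * x) / G x) \<longlongrightarrow> a * c powr (- a)) at_top"
  by (rule regvar_scaled_limit[OF assms(1) k_div_G_lim[OF assms(1)] assms(2)])

text \<open>Substituting \<open>y = x v\<close> turns \<open>S(x)/(x G(x)\<^sup>2)\<close> into
  \<open>\<integral> (R(x(1-v))/G(x)) (k(xv)/G(x)) dv\<close> over \<open>(0,1)\<close>, whose integrand
  tends to \<open>t (1-v)\<^sup>-\<^sup>a a v\<^sup>-\<^sup>a\<close>. Potter bounds with an exponent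
  \<open>\<beta> < 1\<close> dominate it where \<open>xv\<close> exceeds a constant. The rest, including
  the atom of \<open>\<kappa>\<close>, contributes \<open>O(G(x))\<close>, and
  \<open>x G(x) \<rightarrow> \<infinity>\<close>.\<close>

lemma S_limit_below_1:
  assumes GV: "regvar G (- a)" and a: "0 \<le> a" "a < 1"
  shows "((\<lambda>x. SR x / (x * (G x)\<^sup>2)) \<longlongrightarrow> t * a * Beta (1 - a) (1 - a)) at_top"
proof -
  define \<beta> where "\<beta> = (a + 1) / 2"
  have b: "a < \<beta>" "0 \<le> \<beta>" "\<beta> < 1" using a by (auto simp: \<beta>_def)
  obtain X C where X: "1 \<le> X" and C: "0 < C" 
    and Rp: "\<And>u x. 0 < u \<Longrightarrow> u \<le> x \<Longrightarrow> X \<le> x \<Longrightarrow> R u \<le> C * (x / u) powr \<beta> * G x"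
    and kp: "\<And>u x. X \<le> u \<Longrightarrow> u \<le> x \<Longrightarrow> k u \<le> C * (x / u) powr \<beta> * G x"
    using R_potter[OF GV a(1) b(1)] by blast
  define F where "F x v = indicator {0<..<1} v * (R (x * (1 - v)) / G x * (indicator {X..} (x * v) * k (x * v) / G x))" for x v :: real
  have main: "((\<lambda>x. \<integral>v. F x v \<partial>lborel) \<longlongrightarrow> (\<integral>v. t * a * (indicator {0<..<1} v * (v powr (- a) * (1 - v) powr (- a))) \<partial>lborel)) at_top"
  proof (rule integral_dominated_convergence_at_top[where w = "\<lambda>v. C\<^sup>2 * (indicator {0<..<1} v * (v powr (- \<beta>) * (1 - v) powr (- \<beta>)))"])
    show "integrable lborel (\<lambda>v. C\<^sup>2 * (indicator {0<..<1} v * (v powr (- \<beta>) * (1 - v) powr (- \<beta>))))"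
      using has_bochner_integral_Beta[OF b(3)] by (intro integrable_mult_right) (simp add: has_bochner_integral_iff)
    show "\<forall>\<^sub>F x in at_top. AE v in lborel. norm (F x v) \<le> C\<^sup>2 * (indicator {0<..<1} v * (v powr (- \<beta>) * (1 - v) powr (- \<beta>)))"
      using eventually_ge_at_top[of X]
    proof eventually_elim
      case (elim x)
      have x: "0 < x" using elim X by auto
      have g: "0 < G x" using x by (rule G_pos)
      show ?case
      proof (rule AE_I2)
        fix v :: real
        show "norm (F x v) \<le> C\<^sup>2 * (indicator {0<..<1} v * (v powr (- \<beta>) * (1 - v) powr (- \<beta>)))"
        proof (cases "v \<in> {0<..<1}")
          case True
          have "x * (1 - v) \<le> x * 1" using True x by (intro mult_left_mono) auto
          then have "R (x * (1 - v)) \<le> C * (x / (x * (1 - v))) powr \<beta> * G x" using True x elim by (intro Rp) auto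
          also have "x / (x * (1 - v)) = 1 / (1 - v)" using x by simp
          finally have 1: "R (x * (1 - v)) / G x \<le> C * (1 - v) powr (- \<beta>)"
            using g True by (simp add: powr_divide powr_minus field_simps)
          have 2: "indicator {X..} (x * v) * k (x * v) / G x \<le> C * v powr (- \<beta>)"
          proof (cases "X \<le> x * v")
            case Xv: True
            have "x * v \<le> x * 1" using True x by (intro mult_left_mono) auto
            then have "k (x * v) \<le> C * (x / (x * v)) powr \<beta> * G x" using Xv by (intro kp) auto
            also have "x / (x * v) = 1 / v" using x by simp
            finally show ?thesis using g True Xv by (simp add: powr_divide powr_minus field_simps)
          qed (use C in auto)
          have "R (x * (1 - v)) / G x * (indicator {X..} (x * v) * k (x * v) / G x) \<le> (C * (1 - v) powr (- \<beta>)) * (C * v powr (- \<beta>))"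
            using 1 2 R_nonneg k_nonneg g C by (intro mult_mono) auto
          moreover have "0 \<le> R (x * (1 - v)) / G x * (indicator {X..} (x * v) * k (x * v) / G x)"
            using R_nonneg k_nonneg g by simp
          ultimately show ?thesis using True by (simp add: F_def power2_eq_square mult_ac)
        qed (simp add: F_def)
      qed
    qed
    show "AE v in lborel. ((\<lambda>x. F x v) \<longlongrightarrow> t * a * (indicator {0<..<1} v * (v powr (- a) * (1 - v) powr (- a)))) at_top"
    proof (rule AE_I2)
      fix v :: real
      show "((\<lambda>x. F x v) \<longlongrightarrow> t * a * (indicator {0<..<1} v * (v powr (- a) * (1 - v) powr (- a)))) at_top"
      proof (cases "v \<in> {0<..<1}")
        case True
        have "((\<lambda>x. R ((1 - v) * x) / G x * (k (v * x) / G x)) \<longlongrightarrow> (t * (1 - v) powr (- a)) * (a * v powr (- a))) at_top"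
          using True by (intro tendsto_mult R_scaled_lim[OF GV] k_scaled_lim[OF GV]) auto
        then have "((\<lambda>x. F x v) \<longlongrightarrow> (t * (1 - v) powr (- a)) * (a * v powr (- a))) at_top"
        proof (rule Lim_transform_eventually)
          show "\<forall>\<^sub>F x in at_top. R ((1 - v) * x) / G x * (k (v * x) / G x) = F x v"
            using eventually_ge_at_top[of "X / v"]
          proof eventually_elim
            case (elim x)
            then have "X \<le> x * v" using True by (simp add: field_simps)
            then show ?case using True by (simp add: F_def mult.commute)
          qed
        qed
        then show ?thesis using True by (simp add: mult_ac)
      qed (simp add: F_def)
    qed
    show "F x \<in> borel_measurable lborel" for x unfolding F_def[abs_def] by measurable
  qed measurable
  have val: "(\<integral>v. t * a * (indicator {0<..<1} v * (v powr (- a) * (1 - v) powr (- a))) \<partial>lborel) = t * a * Beta (1 - a) (1 - a)"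
    using has_bochner_integral_Beta[OF a(2)] by (simp add: has_bochner_integral_iff)
  have Fint: "(\<integral>v. F x v \<partial>lborel) = (LBINT y:{X..x}. R (x - y) * k y) / (x * (G x)\<^sup>2)" if x: "X < x" for x
  proof -
    have x0: "0 < x" using x X by simp
    have "(LBINT y:{X..x}. R (x - y) * k y) = x * (\<integral>v. indicator {X..x} (x * v) *\<^sub>R (R (x - x * v) * k (x * v)) \<partial>lborel)"
      unfolding set_lebesgue_integral_def
      using lborel_integral_real_affine[of x "\<lambda>y. indicator {X..x} y *\<^sub>R (R (x - y) * k y)" 0] x0 by simp
    also have "(\<integral>v. indicator {X..x} (x * v) *\<^sub>R (R (x - x * v) * k (x * v)) \<partial>lborel) = (\<integral>v. (G x)\<^sup>2 * F x v \<partial>lborel)"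
    proof (rule integral_cong_AE)
      show "AE v in lborel. indicator {X..x} (x * v) *\<^sub>R (R (x - x * v) * k (x * v)) = (G x)\<^sup>2 * F x v"
        using AE_lborel_singleton[of 1]
      proof eventually_elim
        case (elim v)
        have g: "G x \<noteq> 0" using G_pos[OF x0] by simp
        show ?case
        proof (cases "X \<le> x * v \<and> v \<le> 1")
          case True
          then have "0 < x * v" using X by linarith
          then have "v \<in> {0<..<1}" using True elim x0 by (auto simp: zero_less_mult_iff)
          then show ?thesis using True g x0 by (simp add: F_def power2_eq_square algebra_simps)
        next
          case False
          then show ?thesis using x0 by (auto simp: F_def indicator_def)
        qed
      qed
    qed (auto simp: F_def[abs_def])
    finally have "(LBINT y:{X..x}. R (x - y) * k y) = x * (G x)\<^sup>2 * (\<integral>v. F x v \<partial>lborel)" by simp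
    then show ?thesis using x0 G_pos[OF x0] by simp
  qed
  \<comment> \<open>The part near \<open>0\<close>, where \<open>k\<close> may be unbounded, together with the atom.\<close>
  have rest: "((\<lambda>x. ((LBINT y:{0..X}. R (x - y) * k y) + b * R x) / (x * (G x)\<^sup>2)) \<longlongrightarrow> 0) at_top"
  proof (rule tendsto_sandwich[of "\<lambda>_. 0" _ _ "\<lambda>x. M X * (R ((1/2) * x) / G x) * (1 / (x * G x))"])
    show "\<forall>\<^sub>F x in at_top. 0 \<le> ((LBINT y:{0..X}. R (x - y) * k y) + b * R x) / (x * (G x)\<^sup>2)"
      using eventually_gt_at_top[of 0]
    proof eventually_elim
      case (elim x)
      have "0 \<le> (LBINT y:{0..X}. R (x - y) * k y)" using R_nonneg k_nonneg by (intro set_integral_nonneg') auto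
      then show ?case using elim R_nonneg[of x] b_nonneg by (intro divide_nonneg_nonneg add_nonneg_nonneg mult_nonneg_nonneg) auto
    qed
    show "\<forall>\<^sub>F x in at_top. ((LBINT y:{0..X}. R (x - y) * k y) + b * R x) / (x * (G x)\<^sup>2) \<le> M X * (R ((1/2) * x) / G x) * (1 / (x * G x))"
      using eventually_ge_at_top[of "2 * X"]
    proof eventually_elim
      case (elim x)
      have x: "0 < x" using elim X by simp
      have "(LBINT y:{0..X}. R (x - y) * k y) \<le> (LBINT y:{0..X}. R ((1/2) * x) * k y)"
        using R_anti k_nonneg elim by (intro set_integral_mono set_integrable_mult_right k_integrable Rk_integrable mult_right_mono) auto
      also have "\<dots> = R ((1/2) * x) * (M X - b)" by (simp add: M_def)
      finally have "(LBINT y:{0..X}. R (x - y) * k y) + b * R x \<le> R ((1/2) * x) * (M X - b) + b * R ((1/2) * x)"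
        using R_anti[of "(1/2) * x" x] x b_nonneg by (intro add_mono mult_left_mono) auto
      also have "\<dots> = M X * R ((1/2) * x)" by (simp add: algebra_simps)
      finally have "((LBINT y:{0..X}. R (x - y) * k y) + b * R x) / (x * (G x)\<^sup>2) \<le> M X * R ((1/2) * x) / (x * (G x)\<^sup>2)"
        using x by (intro divide_right_mono) auto
      then show ?case by (simp add: power2_eq_square mult_ac)
    qed
    have "((\<lambda>x. M X * (R ((1/2) * x) / G x) * (1 / (x * G x))) \<longlongrightarrow> M X * (t * (1/2) powr (- a)) * 0) at_top"
      by (intro tendsto_intros R_scaled_lim[OF GV] tendsto_divide_0[OF tendsto_const] filterlim_at_top_imp_at_infinity xG_at_top[OF GV a]) simp
    then show "((\<lambda>x. M X * (R ((1/2) * x) / G x) * (1 / (x * G x))) \<longlongrightarrow> 0) at_top" by simp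
  qed simp
  have "((\<lambda>x. ((LBINT y:{0..X}. R (x - y) * k y) + b * R x) / (x * (G x)\<^sup>2) + (\<integral>v. F x v \<partial>lborel)) \<longlongrightarrow> 0 + t * a * Beta (1 - a) (1 - a)) at_top"
    using main unfolding val by (intro tendsto_add rest)
  then have "((\<lambda>x. SR x / (x * (G x)\<^sup>2)) \<longlongrightarrow> 0 + t * a * Beta (1 - a) (1 - a)) at_top"
  proof (rule Lim_transform_eventually)
    show "\<forall>\<^sub>F x in at_top. ((LBINT y:{0..X}. R (x - y) * k y) + b * R x) / (x * (G x)\<^sup>2) + (\<integral>v. F x v \<partial>lborel) = SR x / (x * (G x)\<^sup>2)"
      using eventually_gt_at_top[of X]
    proof eventually_elim
      case (elim x)
      then show ?case
        using set_integral_split_Icc[OF _ _ Rk_integrable[of x x], of X] X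
        by (simp add: Fint S_def add_divide_distrib)
    qed
  qed
  then show ?thesis by simp
qed

lemma S_tail_integral_asymptotics:
  assumes f_meas: "\<And>x. set_borel_measurable lborel {x..} f" and f_pos: "\<forall>\<^sub>F x in at_top. 0 < f x"
    and lim: "((\<lambda>x. SR x / x\<^sup>2 / f x) \<longlongrightarrow> c) at_top" and c: "0 < c"
  obtains X where "1 \<le> X" "set_integrable lborel {X..} f"
    "((\<lambda>x. (LBINT w:{x..}. SR w / w\<^sup>2) / (LBINT w:{x..}. f w)) \<longlongrightarrow> c) at_top"
proof -
  have "\<forall>\<^sub>F x in at_top. c / 2 < SR x / x\<^sup>2 / f x" using order_tendstoD(1)[OF lim, of "c / 2"] c by simp
  with f_pos have "\<forall>\<^sub>F x in at_top. 0 < f x \<and> f x \<le> 2 / c * (SR x / x\<^sup>2)"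
  proof eventually_elim
    case (elim x)
    have l: "c / 2 * f x < SR x / x\<^sup>2" using elim by (simp only: pos_less_divide_eq)
    have "f x = 2 / c * (c / 2 * f x)" using c by simp
    also have "\<dots> \<le> 2 / c * (SR x / x\<^sup>2)" using l c by (intro mult_left_mono) auto
    finally show ?case using elim by simp
  qed
  then obtain X0 where X0: "\<And>x. X0 \<le> x \<Longrightarrow> 0 < f x \<and> f x \<le> 2 / c * (SR x / x\<^sup>2)" by (auto simp: eventually_at_top_linorder)
  define X where "X = max 1 X0"
  have Si: "set_integrable lborel {X..} (\<lambda>w. SR w / w\<^sup>2)" by (rule S_integrable) (simp add: X_def)
  have fi: "set_integrable lborel {X..} f"
  proof (rule set_integrable_bound[OF set_integrable_mult_right[of "2 / c", OF Si]])
    show "AE x in lborel. x \<in> {X..} \<longrightarrow> norm (f x) \<le> norm (2 / c * (SR x / x\<^sup>2))"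
    proof (intro AE_I2 impI)
      fix x assume "x \<in> {X..}"
      then have "0 < f x \<and> f x \<le> 2 / c * (SR x / x\<^sup>2)" by (intro X0) (auto simp: X_def)
      then show "norm (f x) \<le> norm (2 / c * (SR x / x\<^sup>2))" by (simp only: real_norm_def) linarith
    qed
  qed (use f_meas in auto)
  show ?thesis
    by (rule that[of X]) (use fi in \<open>auto simp: X_def intro!: tail_integral_ratio[OF lim f_pos fi] Si\<close>)
qed

text \<open>Karamata's theorem for a monotone function \<open>f\<close> that is proportional to
  \<open>S(w)/w\<^sup>2\<close> in the limit.\<close>

lemma S_tail_integral_regvar:
  assumes f_meas: "\<And>x. set_borel_measurable lborel {x..} f" and f_anti: "antimono_on {1..} f"
    and f_rv: "regvar f (- r - 1)" and r: "0 < r"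
    and lim: "((\<lambda>x. SR x / x\<^sup>2 / f x) \<longlongrightarrow> c) at_top" and c: "0 < c"
  shows "((\<lambda>x. (LBINT w:{x..}. SR w / w\<^sup>2) / (x * f x)) \<longlongrightarrow> c / r) at_top"
proof -
  obtain X where X: "1 \<le> X" "set_integrable lborel {X..} f"
    and L: "((\<lambda>x. (LBINT w:{x..}. SR w / w\<^sup>2) / (LBINT w:{x..}. f w)) \<longlongrightarrow> c) at_top"
    using S_tail_integral_asymptotics[OF f_meas regvar_pos[OF f_rv] lim c] by blast
  have Frv: "regvar (\<lambda>x. LBINT u:{x..}. f u) (- r)"
    using regvar_tail_integral[OF f_rv X(2)] by simp
  have "((\<lambda>x. x * f x / (LBINT u:{x..}. f u)) \<longlongrightarrow> r) at_top"
    by (rule monotone_density[OF _ X(2) Frv]) (use f_anti X in \<open>auto simp: monotone_on_def\<close>)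
  from tendsto_divide[OF L this] r
  have "((\<lambda>x. (LBINT w:{x..}. SR w / w\<^sup>2) / (LBINT w:{x..}. f w) / (x * f x / (LBINT u:{x..}. f u))) \<longlongrightarrow> c / r) at_top" by simp
  then show ?thesis
    by (rule Lim_transform_eventually) (use regvar_pos[OF Frv] in \<open>eventually_elim, simp\<close>)
qed

lemma regvar_G_squared:
  assumes "regvar G (- a)"
  shows "regvar (\<lambda>x. (G x)\<^sup>2 / x) (- (2 * a) - 1)"
proof -
  have "regvar (\<lambda>x. G x * G x * x powr (- 1)) (- a + - a + - 1)"
    by (intro regvar_mult regvar_powr assms)
  moreover have "((\<lambda>x. ((G x)\<^sup>2 / x) / (G x * G x * x powr (- 1))) \<longlongrightarrow> 1) at_top"
    by (rule tendsto_eventually)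
       (use eventually_gt_at_top[of 0] in \<open>eventually_elim, use G_pos in \<open>force simp: powr_minus power2_eq_square field_simps\<close>\<close>)
  ultimately have "regvar (\<lambda>x. (G x)\<^sup>2 / x) (- a + - a + - 1)" by (rule regvar_equivalent) simp
  then show ?thesis by simp
qed

text \<open>With \<open>c = t a B(1-a,1-a)\<close> the two terms of the tail formula are asymptotic to
  \<open>c G\<^sup>2\<close> and \<open>c G\<^sup>2/(2a)\<close>.\<close>

theorem second_order_between_0_1:
  assumes GV: "regvar G (- a)" and a: "0 < a" "a < 1"
  shows "((\<lambda>x. (R x - t * G x) / (G x)\<^sup>2) \<longlongrightarrow> t\<^sup>2 * ((2 * a - 1) * Beta (1 - a) (1 - a) / 2)) at_top"
proof -
  define c where "c = t * a * Beta (1 - a) (1 - a)"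
  have c: "0 < c" using a t_pos by (simp add: c_def Beta_def Gamma_real_pos)
  have S: "((\<lambda>x. SR x / (x * (G x)\<^sup>2)) \<longlongrightarrow> c) at_top" unfolding c_def using S_limit_below_1[OF GV] a by simp
  define f where "f x = (G x)\<^sup>2 / x" for x
  have lim: "((\<lambda>x. SR x / x\<^sup>2 / f x) \<longlongrightarrow> c) at_top"
    using S by (rule Lim_transform_eventually)
      (use eventually_gt_at_top[of 0] in \<open>eventually_elim, simp add: f_def power2_eq_square field_simps\<close>)
  have "((\<lambda>x. (LBINT w:{x..}. SR w / w\<^sup>2) / (x * f x)) \<longlongrightarrow> c / (2 * a)) at_top"
  proof (rule S_tail_integral_regvar[OF _ _ _ _ lim c])
    show "set_borel_measurable lborel {x..} f" for x
      unfolding set_borel_measurable_def f_def by measurable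
    show "antimono_on {1..} f"
      unfolding f_def monotone_on_def using G_antimono G_nonneg by (auto intro!: frac_le power_mono)
    show "regvar f (- (2 * a) - 1)" unfolding f_def by (rule regvar_G_squared[OF GV])
  qed (use a in simp)
  then have I: "((\<lambda>x. (LBINT w:{x..}. SR w / w\<^sup>2) / (G x)\<^sup>2) \<longlongrightarrow> c / (2 * a)) at_top"
    by (rule Lim_transform_eventually)
       (use eventually_gt_at_top[of 0] in \<open>eventually_elim, simp add: f_def\<close>)
  have "((\<lambda>x. (R x - t * G x) / (G x)\<^sup>2) \<longlongrightarrow> t * (c - c / (2 * a))) at_top"
    by (rule tail_diff_limit[OF _ I]) (use S in simp)
  moreover have "t * (c - c / (2 * a)) = t\<^sup>2 * ((2 * a - 1) * Beta (1 - a) (1 - a) / 2)"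
    using a by (simp add: c_def power2_eq_square field_simps)
  ultimately show ?thesis by simp
qed

end

section \<open>Index one\<close>

context levy_tail
begin

text \<open>Each of the dyadic blocks \<open>(x/2\<^sup>j\<^sup>+\<^sup>1, x/2\<^sup>j]\<close> contributes about
  \<open>x k(x)/2\<close> or more to the integral of \<open>k\<close>, so enough of them together exceed
  any given multiple of \<open>x k(x)\<close>.\<close>

lemma xk_div_lim:
  assumes k_rv: "regvar k (- 1)"
  shows "((\<lambda>x. x * k x / (M x - b)) \<longlongrightarrow> 0) at_top"
proof -
  define K where "K x = M x - b" for x
  have K0: "0 \<le> K x" for x using M_ge_b[of x] by (simp add: K_def)
  have sum: "(\<Sum>j<n. (x / 2 ^ Suc j) * k (x / 2 ^ j)) + K (x / 2 ^ n) \<le> K x" if x: "0 < x" for x n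
  proof (induction n)
    case (Suc n)
    have "(x / 2 ^ n - x / 2 ^ Suc n) * k (x / 2 ^ n) \<le> M (x / 2 ^ n) - M (x / 2 ^ Suc n)"
      using x by (intro M_increment_ge) (auto simp: field_simps)
    moreover have "x / 2 ^ n - x / 2 ^ Suc n = x / 2 ^ Suc n" by (simp add: field_simps)
    ultimately have "(x / 2 ^ Suc n) * k (x / 2 ^ n) + K (x / 2 ^ Suc n) \<le> K (x / 2 ^ n)" by (simp add: K_def)
    then show ?case using Suc by simp
  qed simp
  have "((\<lambda>x. x * k x / K x) \<longlongrightarrow> 0) at_top"
  proof (rule order_tendstoI)
    fix a :: real assume a: "a < 0"
    show "\<forall>\<^sub>F x in at_top. a < x * k x / K x"
      using eventually_gt_at_top[of 0]
    proof eventually_elim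
      case (elim x)
      have "0 \<le> x * k x / K x" using elim k_nonneg K0 by simp
      then show ?case using a by linarith
    qed
  next
    fix a :: real assume a: "0 < a"
    obtain n :: nat where n: "2 / a + 1 < real n" using reals_Archimedean2 by blast
    have "((\<lambda>x. \<Sum>j<n. (1 / 2 ^ Suc j) * (k ((1 / 2 ^ j) * x) / k x)) \<longlongrightarrow> (\<Sum>j<n. (1 / 2 ^ Suc j) * (1 / 2 ^ j) powr (- 1))) at_top"
      by (intro tendsto_intros regvarD[OF k_rv]) auto
    moreover have "(\<Sum>j<n. (1 / 2 ^ Suc j) * (1 / 2 ^ j) powr (- 1 :: real)) = real n / 2"
      by (simp add: powr_minus)
    ultimately have "((\<lambda>x. \<Sum>j<n. (1 / 2 ^ Suc j) * (k ((1 / 2 ^ j) * x) / k x)) \<longlongrightarrow> real n / 2) at_top" by simp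
    from order_tendstoD(1)[OF this, of "(real n - 1) / 2"]
    have "\<forall>\<^sub>F x in at_top. (real n - 1) / 2 < (\<Sum>j<n. (1 / 2 ^ Suc j) * (k ((1 / 2 ^ j) * x) / k x))" by simp
    then show "\<forall>\<^sub>F x in at_top. x * k x / K x < a"
      using eventually_gt_at_top[of 0]
    proof eventually_elim
      case (elim x)
      have kx: "0 < k x" using elim by (intro k_pos) auto
      have "1 / a < (real n - 1) / 2" using n a by (simp add: field_simps)
      then have "1 / a * (x * k x) < (\<Sum>j<n. (1 / 2 ^ Suc j) * (k ((1 / 2 ^ j) * x) / k x)) * (x * k x)"
        using elim kx by (intro mult_strict_right_mono) auto
      also have "\<dots> = (\<Sum>j<n. (x / 2 ^ Suc j) * k (x / 2 ^ j))"
        unfolding sum_distrib_right using kx by (intro sum.cong) (auto simp: mult.commute)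
      also have "\<dots> \<le> K x" using sum[of x n] elim K0[of "x / 2 ^ n"] by linarith
      finally have l: "1 / a * (x * k x) < K x" .
      moreover have "0 < 1 / a * (x * k x)" using a elim kx by simp
      ultimately have "0 < K x" by linarith
      then show ?case using l a by (simp add: field_simps)
    qed
  qed
  then show ?thesis by (simp add: K_def)
qed

lemma truncated_moment_slowly_varying:
  assumes k_rv: "regvar k (- 1)"
  shows "regvar (\<lambda>x. M x - b) 0" and "regvar M 0" and "((\<lambda>x. x * k x / M x) \<longlongrightarrow> 0) at_top"
proof -
  define K where "K x = M x - b" for x
  have Kpos: "0 < K x" if "0 < x" for x
  proof -
    have "0 < x / 2 * k x" using that k_pos by simp
    also have "\<dots> \<le> M x - M (x / 2)" using M_increment_ge[of "x/2" x] that by simp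
    also have "\<dots> \<le> K x" using M_ge_b[of "x/2"] by (simp add: K_def)
    finally show ?thesis .
  qed
  have q: "((\<lambda>x. x * k x / K x) \<longlongrightarrow> 0) at_top" using xk_div_lim[OF k_rv] by (simp add: K_def)
  have diff: "((\<lambda>x. (K x - K (c * x)) / K x) \<longlongrightarrow> 0) at_top" if c: "0 < c" "c < 1" for c
  proof (rule tendsto_sandwich[of "\<lambda>_. 0" _ _ "\<lambda>x. (1 - c) / c * ((c * x) * k (c * x) / K (c * x))"])
    show "\<forall>\<^sub>F x in at_top. 0 \<le> (K x - K (c * x)) / K x"
      using eventually_gt_at_top[of 0]
    proof eventually_elim
      case (elim x)
      then have "c * x \<le> x" using c by simp
      then show ?case using monoD[OF M_mono, of "c * x" x] Kpos[of x] elim by (simp add: K_def)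
    qed
    show "\<forall>\<^sub>F x in at_top. (K x - K (c * x)) / K x \<le> (1 - c) / c * ((c * x) * k (c * x) / K (c * x))"
      using eventually_gt_at_top[of 0]
    proof eventually_elim
      case (elim x)
      have cx: "0 < c * x" "c * x \<le> x" using elim c by auto
      have "K x - K (c * x) \<le> (x - c * x) * k (c * x)" using M_increment_le[OF cx] by (simp add: K_def)
      also have "\<dots> = (1 - c) / c * ((c * x) * k (c * x))" using c by (simp add: field_simps)
      finally have "(K x - K (c * x)) / K x \<le> (1 - c) / c * ((c * x) * k (c * x)) / K x"
        using Kpos[OF elim] by (intro divide_right_mono) auto
      also have "\<dots> \<le> (1 - c) / c * ((c * x) * k (c * x)) / K (c * x)"
        using c cx k_nonneg Kpos[OF cx(1)] monoD[OF M_mono cx(2)] by (intro divide_left_mono mult_nonneg_nonneg mult_pos_pos) (auto simp: K_def)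
      finally show ?case by simp
    qed
    have "((\<lambda>x. (1 - c) / c * ((c * x) * k (c * x) / K (c * x))) \<longlongrightarrow> (1 - c) / c * 0) at_top"
      by (intro tendsto_intros tendsto_at_top_times[OF c(1) q])
    then show "((\<lambda>x. (1 - c) / c * ((c * x) * k (c * x) / K (c * x))) \<longlongrightarrow> 0) at_top" by simp
  qed simp
  show "regvar (\<lambda>x. M x - b) 0"
    unfolding K_def[symmetric]
  proof (rule regvar_0I)
    show "\<forall>\<^sub>F x in at_top. 0 < K x" using eventually_gt_at_top[of 0] by eventually_elim (rule Kpos)
    fix c :: real assume c: "0 < c" "c < 1"
    have "((\<lambda>x. 1 - (K x - K (c * x)) / K x) \<longlongrightarrow> 1 - 0) at_top" by (intro tendsto_intros diff c)
    then have "((\<lambda>x. K (c * x) / K x) \<longlongrightarrow> 1 - 0) at_top"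
      by (rule Lim_transform_eventually)
         (use eventually_gt_at_top[of 0] in \<open>eventually_elim, use Kpos in \<open>force simp: diff_divide_distrib\<close>\<close>)
    then show "((\<lambda>x. K (c * x) / K x) \<longlongrightarrow> 1) at_top" by simp
  qed
  have KM: "K x \<le> M x" for x using b_nonneg by (simp add: K_def)
  show "regvar M 0"
  proof (rule regvar_0I)
    show "\<forall>\<^sub>F x in at_top. 0 < M x" using eventually_gt_at_top[of 0] by eventually_elim (rule M_pos)
    fix c :: real assume c: "0 < c" "c < 1"
    have "((\<lambda>x. (M x - M (c * x)) / M x) \<longlongrightarrow> 0) at_top"
    proof (rule tendsto_sandwich[OF _ _ tendsto_const diff[OF c]])
      show "\<forall>\<^sub>F x in at_top. 0 \<le> (M x - M (c * x)) / M x"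
        using eventually_gt_at_top[of 0]
      proof eventually_elim
        case (elim x)
        then have "c * x \<le> x" using c by simp
        then show ?case using monoD[OF M_mono, of "c * x" x] M_pos[of x] elim by simp
      qed
      show "\<forall>\<^sub>F x in at_top. (M x - M (c * x)) / M x \<le> (K x - K (c * x)) / K x"
        using eventually_gt_at_top[of 0]
      proof eventually_elim
        case (elim x)
        then have "c * x \<le> x" using c by simp
        then have "M (c * x) \<le> M x" by (rule monoD[OF M_mono])
        then have "(M x - M (c * x)) / M x \<le> (M x - M (c * x)) / K x"
          using Kpos[OF elim] M_pos[OF elim] KM by (intro divide_left_mono) auto
        then show ?case by (simp add: K_def)
      qed
    qed
    then have "((\<lambda>x. 1 - (M x - M (c * x)) / M x) \<longlongrightarrow> 1 - 0) at_top" by (intro tendsto_intros)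
    then have "((\<lambda>x. M (c * x) / M x) \<longlongrightarrow> 1 - 0) at_top"
      by (rule Lim_transform_eventually)
         (use eventually_gt_at_top[of 0] in \<open>eventually_elim, use M_pos in \<open>force simp: diff_divide_distrib\<close>\<close>)
    then show "((\<lambda>x. M (c * x) / M x) \<longlongrightarrow> 1) at_top" by simp
  qed
  show "((\<lambda>x. x * k x / M x) \<longlongrightarrow> 0) at_top"
  proof (rule tendsto_sandwich[OF _ _ tendsto_const q])
    show "\<forall>\<^sub>F x in at_top. 0 \<le> x * k x / M x"
      using eventually_gt_at_top[of 0] by eventually_elim (use M_pos k_nonneg in \<open>auto intro!: divide_nonneg_pos mult_nonneg_nonneg\<close>)
    show "\<forall>\<^sub>F x in at_top. x * k x / M x \<le> x * k x / K x"
      using eventually_gt_at_top[of 0] by eventually_elim (use M_pos k_nonneg Kpos KM in \<open>auto intro!: divide_left_mono mult_nonneg_nonneg mult_pos_pos\<close>)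
  qed
qed

end

context conv_tail
begin

text \<open>By \<open>tail_moment\<close>, \<open>H = t (M - S) + x R\<close>; here \<open>S = o(M)\<close>, and
  \<open>x R \<sim> t x k = o(M)\<close>. This treats finite and infinite means alike.\<close>

lemma H_div_M_lim:
  assumes GV: "regvar G (- 1)"
  shows "((\<lambda>x. H x / M x) \<longlongrightarrow> t) at_top"
proof -
  have kG: "((\<lambda>x. k x / G x) \<longlongrightarrow> 1) at_top" by (rule k_div_G_lim[OF GV])
  have k_rv: "regvar k (- 1)" by (rule regvar_equivalent[OF GV kG]) simp
  have "((\<lambda>x. t * (1 - SR x / M x) + (R x / G x) / (k x / G x) * (x * k x / M x)) \<longlongrightarrow> t * (1 - 0) + t / 1 * 0) at_top"
    by (intro tendsto_intros S_div_M_lim tail_equivalent_of_regvar_levy[OF GV] kG truncated_moment_slowly_varying(3)[OF k_rv]) simp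
  then have "((\<lambda>x. H x / M x) \<longlongrightarrow> t * (1 - 0) + t / 1 * 0) at_top"
  proof (rule Lim_transform_eventually)
    show "\<forall>\<^sub>F x in at_top. t * (1 - SR x / M x) + (R x / G x) / (k x / G x) * (x * k x / M x) = H x / M x"
      using eventually_gt_at_top[of 0]
    proof eventually_elim
      case (elim x)
      have "0 < G x" "0 < k x" "0 < M x" using elim by (auto intro: G_pos k_pos M_pos)
      then show ?case using tail_moment[OF elim] by (simp add: H_def field_simps)
    qed
  qed
  then show ?thesis by simp
qed

text \<open>The convolution is cut at \<open>x/2\<close>. The part of \<open>\<kappa>\<close> on
  \<open>[0,x/2]\<close> meets \<open>R(x) \<sim> t G(x)\<close> and has mass asymptotic to
  \<open>M\<close>; on the other half, \<open>R\<close> on \<open>[0,x/2]\<close> meets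
  \<open>k(x) \<sim> G(x)\<close> and integrates to about \<open>H \<sim> t M\<close>.\<close>

lemma S_limit_1:
  assumes GV: "regvar G (- 1)"
  shows "((\<lambda>x. SR x / (G x * M x)) \<longlongrightarrow> 2 * t) at_top"
proof -
  have RG: "((\<lambda>x. R x / G x) \<longlongrightarrow> t) at_top" by (rule tail_equivalent_of_regvar_levy[OF GV])
  have kG: "((\<lambda>x. k x / G x) \<longlongrightarrow> 1) at_top" by (rule k_div_G_lim[OF GV])
  have k_rv: "regvar k (- 1)" by (rule regvar_equivalent[OF GV kG]) simp
  have R_rv: "regvar R (- 1)" by (rule regvar_equivalent[OF GV RG t_pos])
  have H_rv: "regvar H 0" by (rule regvar_equivalent[OF truncated_moment_slowly_varying(2)[OF k_rv] H_div_M_lim[OF GV] t_pos])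
  have 1: "((\<lambda>x. (LBINT u:{0..x/2}. R (x - u) * k u) / (R x * (LBINT u:{0..x}. k u))) \<longlongrightarrow> 1) at_top"
    by (rule convolution_half_limit[OF R_anti R_rv R_nonneg k_nonneg k_integrable _ Rk_integrable])
       (use truncated_moment_slowly_varying(1)[OF k_rv] in \<open>simp_all add: M_def\<close>)
  have 2: "((\<lambda>x. (LBINT u:{0..x/2}. k (x - u) * R u) / (k x * (LBINT u:{0..x}. R u))) \<longlongrightarrow> 1) at_top"
  proof (rule convolution_half_limit[OF k_mono k_rv k_nonneg R_nonneg R_integrable])
    show "regvar (\<lambda>x. LBINT u:{0..x}. R u) 0" using H_rv by (simp add: H_def[abs_def])
    show "set_integrable lborel {0..x/2} (\<lambda>u. k (x - u) * R u)" if "0 < x" for x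
      using kR_integrable[of "x/2" x] that by (simp add: mult.commute)
  qed
  define r where "r x = (LBINT u:{0..x/2}. R (x - u) * k u) / (R x * (M x - b))" for x
  have r: "(r \<longlongrightarrow> 1) at_top" using 1 by (simp add: r_def[abs_def] M_def)
  have A: "((\<lambda>x. 1 + (r x - 1) * ((M x - b) / M x)) \<longlongrightarrow> 1) at_top"
  proof -
    have "((\<lambda>x. (r x - 1) * ((M x - b) / M x)) \<longlongrightarrow> 0) at_top"
    proof (rule Lim_null_comparison)
      show "\<forall>\<^sub>F x in at_top. norm ((r x - 1) * ((M x - b) / M x)) \<le> \<bar>r x - 1\<bar>"
        using eventually_gt_at_top[of 0]
      proof eventually_elim
        case (elim x)
        have "0 \<le> (M x - b) / M x" "(M x - b) / M x \<le> 1" using M_ge_b[of x] M_pos[OF elim] b_nonneg by auto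
        then have "\<bar>r x - 1\<bar> * \<bar>(M x - b) / M x\<bar> \<le> \<bar>r x - 1\<bar> * 1" by (intro mult_left_mono) auto
        then show ?case by (simp add: abs_mult)
      qed
      have "((\<lambda>x. \<bar>r x - 1\<bar>) \<longlongrightarrow> \<bar>1 - 1\<bar>) at_top" by (intro tendsto_intros r)
      then show "((\<lambda>x. \<bar>r x - 1\<bar>) \<longlongrightarrow> 0) at_top" by simp
    qed
    from tendsto_add[OF tendsto_const[of 1] this] show ?thesis by simp
  qed
  have "((\<lambda>x. (1 + (r x - 1) * ((M x - b) / M x)) * (R x / G x)
      + (LBINT u:{0..x/2}. k (x - u) * R u) / (k x * H x) * (k x / G x) * (H x / M x)) \<longlongrightarrow> 1 * t + 1 * 1 * t) at_top"
    by (intro tendsto_intros A RG kG H_div_M_lim[OF GV]) (use 2 in \<open>simp add: H_def\<close>)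
  then have "((\<lambda>x. SR x / (G x * M x)) \<longlongrightarrow> 1 * t + 1 * 1 * t) at_top"
  proof (rule Lim_transform_eventually)
    show "\<forall>\<^sub>F x in at_top. (1 + (r x - 1) * ((M x - b) / M x)) * (R x / G x)
      + (LBINT u:{0..x/2}. k (x - u) * R u) / (k x * H x) * (k x / G x) * (H x / M x) = SR x / (G x * M x)"
      using eventually_gt_at_top[of 0] regvar_pos[OF R_rv] regvar_pos[OF H_rv] regvar_pos[OF truncated_moment_slowly_varying(1)[OF k_rv]]
    proof eventually_elim
      case (elim x)
      have p: "0 < G x" "0 < k x" "0 < M x" using elim by (auto intro: G_pos k_pos M_pos)
      let ?I = "LBINT u:{0..x/2}. R (x - u) * k u" and ?J = "LBINT u:{0..x/2}. k (x - u) * R u"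
      have "1 + (r x - 1) * ((M x - b) / M x) = (r x * (M x - b) + b) / M x" using p by (simp add: field_simps)
      also have "r x * (M x - b) = ?I / R x" using elim by (simp add: r_def)
      finally have e: "1 + (r x - 1) * ((M x - b) / M x) = (?I / R x + b) / M x" .
      have "(1 + (r x - 1) * ((M x - b) / M x)) * (R x / G x) = (?I + b * R x) / (G x * M x)"
        unfolding e using elim p by (simp add: field_simps)
      moreover have "?J / (k x * H x) * (k x / G x) * (H x / M x) = ?J / (G x * M x)"
        using elim p by simp
      moreover have "SR x = ?I + ?J + b * R x" using S_split[of "x/2" x] elim by (simp add: mult.commute)
      ultimately show ?case by (simp add: add_divide_distrib)
    qed
  qed
  then show ?thesis by simp
qed

lemma GM_measurable: "set_borel_measurable lborel {x..} (\<lambda>x. G x * M x / x\<^sup>2)"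
  unfolding set_borel_measurable_def by measurable

text \<open>As \<open>S(w)/w\<^sup>2 \<sim> 2 t G(w) M(w)/w\<^sup>2\<close> has index \<open>-3\<close>, its
  integral is asymptotic to half of \<open>S(x)/x\<close>. The comparison function decreases because
  \<open>M(w)/w\<close> does.\<close>

theorem second_order_1:
  assumes GV: "regvar G (- 1)"
  shows "((\<lambda>x. (R x - t * G x) / (G x * M x / x)) \<longlongrightarrow> t\<^sup>2) at_top"
proof -
  have k_rv: "regvar k (- 1)" by (rule regvar_equivalent[OF GV k_div_G_lim[OF GV]]) simp
  define f where "f x = G x * M x / x\<^sup>2" for x
  have S: "((\<lambda>x. SR x / (G x * M x)) \<longlongrightarrow> 2 * t) at_top" by (rule S_limit_1[OF GV])
  have lim: "((\<lambda>x. SR x / x\<^sup>2 / f x) \<longlongrightarrow> 2 * t) at_top"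
    using S by (rule Lim_transform_eventually)
      (use eventually_gt_at_top[of 0] in \<open>eventually_elim, simp add: f_def\<close>)
  have f_rv: "regvar f (- 2 - 1)"
  proof -
    have "regvar (\<lambda>x. G x * M x * x powr (- 2)) (- 1 + 0 + - 2)"
      by (intro regvar_mult regvar_powr GV truncated_moment_slowly_varying(2)[OF k_rv])
    moreover have "((\<lambda>x. f x / (G x * M x * x powr (- 2))) \<longlongrightarrow> 1) at_top"
    proof (rule tendsto_eventually)
      show "\<forall>\<^sub>F x in at_top. f x / (G x * M x * x powr (- 2)) = 1"
        using eventually_gt_at_top[of 0]
      proof eventually_elim
        case (elim x)
        have "0 < G x" "0 < M x" using elim G_pos M_pos by simp_all
        then show ?case using elim by (simp add: f_def powr_minus power2_eq_square powr_numeral field_simps)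
      qed
    qed
    ultimately have "regvar f (- 1 + 0 + - 2)" by (rule regvar_equivalent) simp
    then show ?thesis by simp
  qed
  have "((\<lambda>x. (LBINT w:{x..}. SR w / w\<^sup>2) / (x * f x)) \<longlongrightarrow> 2 * t / 2) at_top"
  proof (rule S_tail_integral_regvar[OF _ _ f_rv _ lim])
    show "set_borel_measurable lborel {x..} f" for x unfolding f_def by (rule GM_measurable)
    have "f y \<le> f x" if "1 \<le> x" "x \<le> y" for x y
    proof -
      have "G y * (M y / y) \<le> G x * (M x / x)"
        using that G_antimono[of x y] M_div_antimono[of x y] G_nonneg M_pos[of y]
        by (intro mult_mono) auto
      then have "G y * (M y / y) * (1 / y) \<le> G x * (M x / x) * (1 / x)"
        using that G_nonneg M_pos[of x]
        by (intro mult_mono[of "G y * (M y / y)"]) (auto intro!: frac_le)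
      then show ?thesis by (simp add: f_def power2_eq_square)
    qed
    then show "antimono_on {1..} f" by (auto simp: monotone_on_def)
  qed (use t_pos in auto)
  then have I: "((\<lambda>x. (LBINT w:{x..}. SR w / w\<^sup>2) / (G x * M x / x)) \<longlongrightarrow> 2 * t / 2) at_top"
    by (rule Lim_transform_eventually)
       (use eventually_gt_at_top[of 0] in \<open>eventually_elim, simp add: f_def power2_eq_square\<close>)
  have "((\<lambda>x. (R x - t * G x) / (G x * M x / x)) \<longlongrightarrow> t * (2 * t - 2 * t / 2)) at_top"
  proof (rule tail_diff_limit[OF _ I])
    show "((\<lambda>x. SR x / x / (G x * M x / x)) \<longlongrightarrow> 2 * t) at_top"
      using S by (rule Lim_transform_eventually)
        (use eventually_gt_at_top[of 0] in \<open>eventually_elim, simp\<close>)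
  qed
  then show ?thesis by (simp add: power2_eq_square)
qed

section \<open>Index zero\<close>

text \<open>The substitution \<open>u = x v\<close> and Potter bounds with exponent \<open>1/2\<close>; the Beta
  density only serves as an integrable majorant.\<close>

lemma H_limit_0:
  assumes GV: "regvar G 0"
  shows "((\<lambda>x. H x / (x * G x)) \<longlongrightarrow> t) at_top"
proof -
  have GV': "regvar G (- 0)" using GV by simp
  obtain X C where X: "1 \<le> X" and C: "0 < C" 
    and Rp: "\<And>u x. 0 < u \<Longrightarrow> u \<le> x \<Longrightarrow> X \<le> x \<Longrightarrow> R u \<le> C * (x / u) powr (1/2) * G x"
    and "\<And>u x. X \<le> u \<Longrightarrow> u \<le> x \<Longrightarrow> k u \<le> C * (x / u) powr (1/2) * G x"
    using R_potter[OF GV' order_refl half_gt_zero[OF zero_less_one]] by blast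
  define F where "F x v = indicator {0<..<1} v * (R (v * x) / G x)" for x v :: real
  have "((\<lambda>x. \<integral>v. F x v \<partial>lborel) \<longlongrightarrow> (\<integral>v. t * indicator {0<..<1::real} v \<partial>lborel)) at_top"
  proof (rule integral_dominated_convergence_at_top[where w = "\<lambda>v. C * (indicator {0<..<1} v * (v powr (- (1/2)) * (1 - v) powr (- (1/2))))"])
    show "integrable lborel (\<lambda>v. C * (indicator {0<..<1} v * (v powr (- (1/2)) * (1 - v) powr (- (1/2)))))"
      using has_bochner_integral_Beta[of "1/2"] by (intro integrable_mult_right) (simp add: has_bochner_integral_iff)
    show "\<forall>\<^sub>F x in at_top. AE v in lborel. norm (F x v) \<le> C * (indicator {0<..<1} v * (v powr (- (1/2)) * (1 - v) powr (- (1/2))))"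
      using eventually_ge_at_top[of X]
    proof eventually_elim
      case (elim x)
      have x: "0 < x" using elim X by auto
      have g: "0 < G x" using x by (rule G_pos)
      show ?case
      proof (rule AE_I2)
        fix v :: real
        show "norm (F x v) \<le> C * (indicator {0<..<1} v * (v powr (- (1/2)) * (1 - v) powr (- (1/2))))"
        proof (cases "v \<in> {0<..<1}")
          case True
          have "R (v * x) \<le> C * (x / (v * x)) powr (1/2) * G x" using True x elim by (intro Rp) auto
          also have "x / (v * x) = 1 / v" using x by simp
          finally have "R (v * x) / G x \<le> C * v powr (- (1/2)) * 1"
            using g True by (simp add: powr_divide powr_minus field_simps)
          also have "\<dots> \<le> C * v powr (- (1/2)) * (1 - v) powr (- (1/2))"
          proof (intro mult_left_mono)
            have "(1 - v) powr (1/2) \<le> 1 powr (1/2)" using True by (intro powr_mono2) auto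
            then show "1 \<le> (1 - v) powr (- (1/2))" using True by (simp add: powr_minus field_simps)
          qed (use C in auto)
          finally show ?thesis using True g R_nonneg[of "v * x"] by (simp add: F_def mult_ac)
        qed (simp add: F_def)
      qed
    qed
    show "AE v in lborel. ((\<lambda>x. F x v) \<longlongrightarrow> t * indicator {0<..<1} v) at_top"
    proof (rule AE_I2)
      fix v :: real
      show "((\<lambda>x. F x v) \<longlongrightarrow> t * indicator {0<..<1} v) at_top"
      proof (cases "v \<in> {0<..<1}")
        case True
        then show ?thesis using R_scaled_lim[OF GV', of v] by (simp add: F_def)
      qed (simp add: F_def)
    qed
    show "F x \<in> borel_measurable lborel" for x unfolding F_def[abs_def] by measurable
  qed measurable
  then have "((\<lambda>x. \<integral>v. F x v \<partial>lborel) \<longlongrightarrow> t) at_top" by simp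
  then show ?thesis
  proof (rule Lim_transform_eventually)
    show "\<forall>\<^sub>F x in at_top. (\<integral>v. F x v \<partial>lborel) = H x / (x * G x)"
      using eventually_gt_at_top[of 0]
    proof eventually_elim
      case (elim x)
      have "H x = x * (\<integral>v. indicator {0..x} (x * v) *\<^sub>R R (x * v) \<partial>lborel)"
        unfolding H_def set_lebesgue_integral_def
        using lborel_integral_real_affine[of x "\<lambda>y. indicator {0..x} y *\<^sub>R R y" 0] elim by simp
      also have "(\<integral>v. indicator {0..x} (x * v) *\<^sub>R R (x * v) \<partial>lborel) = (\<integral>v. G x * F x v \<partial>lborel)"
      proof (rule integral_cong_AE)
        show "AE v in lborel. indicator {0..x} (x * v) *\<^sub>R R (x * v) = G x * F x v"
          using AE_lborel_singleton[of 1] AE_lborel_singleton[of 0]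
        proof eventually_elim
          case (elim v)
          then show ?case using \<open>0 < x\<close> G_pos[OF \<open>0 < x\<close>]
            by (auto simp: F_def indicator_def zero_le_mult_iff mult.commute)
        qed
      qed (auto simp: F_def[abs_def])
      finally show ?case using elim G_pos[OF elim] by simp
    qed
  qed
qed

text \<open>The bound \<open>R M \<le> S\<close> transfers the estimate \<open>S = o(x G\<^sup>2)\<close> to
  \<open>M\<close>.\<close>

lemma M_limit_0:
  assumes GV: "regvar G 0"
  shows "((\<lambda>x. M x / (x * G x)) \<longlongrightarrow> 0) at_top"
proof -
  have GV': "regvar G (- 0)" using GV by simp
  have RG: "((\<lambda>x. R x / G x) \<longlongrightarrow> t) at_top" by (rule tail_equivalent_of_regvar_levy[OF GV'])
  have S: "((\<lambda>x. SR x / (x * (G x)\<^sup>2)) \<longlongrightarrow> 0) at_top" using S_limit_below_1[OF GV'] by simp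
  have Rpos: "\<forall>\<^sub>F x in at_top. 0 < R x / G x" by (rule order_tendstoD(1)[OF RG t_pos])
  show ?thesis
  proof (rule tendsto_sandwich[of "\<lambda>_. 0" _ _ "\<lambda>x. SR x / (x * (G x)\<^sup>2) / (R x / G x)"])
    show "\<forall>\<^sub>F x in at_top. 0 \<le> M x / (x * G x)"
      using eventually_gt_at_top[of 0] by eventually_elim (use M_pos G_pos in \<open>auto intro!: divide_nonneg_pos less_imp_le\<close>)
    show "\<forall>\<^sub>F x in at_top. M x / (x * G x) \<le> SR x / (x * (G x)\<^sup>2) / (R x / G x)"
      using eventually_gt_at_top[of 0] Rpos
    proof eventually_elim
      case (elim x)
      have g: "0 < G x" using elim by (intro G_pos)
      then have r: "0 < R x" using elim by (simp add: zero_less_divide_iff)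
      have "M x / (x * G x) = R x * M x / (x * G x * R x)" using r by simp
      also have "\<dots> \<le> SR x / (x * G x * R x)" using S_ge[of x] elim g r by (intro divide_right_mono) auto
      also have "\<dots> = SR x / (x * (G x)\<^sup>2) / (R x / G x)" using g by (simp add: power2_eq_square)
      finally show ?case .
    qed
    have "((\<lambda>x. SR x / (x * (G x)\<^sup>2) / (R x / G x)) \<longlongrightarrow> 0 / t) at_top"
      using t_pos by (intro tendsto_divide S RG) simp
    then show "((\<lambda>x. SR x / (x * (G x)\<^sup>2) / (R x / G x)) \<longlongrightarrow> 0) at_top" by simp
  qed simp
qed

text \<open>A slowly varying \<open>R\<close> is nearly constant on \<open>[ex, x]\<close>. Splitting the
  convolution at \<open>x - ex\<close> costs at most \<open>2 e t\<close> in the upper bound, and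
  \<open>S \<ge> R M\<close> is the lower bound.\<close>

lemma S_limit_0:
  assumes GV: "regvar G 0"
  shows "((\<lambda>x. SR x / (G x * M x)) \<longlongrightarrow> t) at_top"
proof -
  have GV': "regvar G (- 0)" using GV by simp
  have RG: "((\<lambda>x. R x / G x) \<longlongrightarrow> t) at_top" by (rule tail_equivalent_of_regvar_levy[OF GV'])
  show ?thesis
  proof (rule order_tendstoI)
    fix s assume "s < t"
    from order_tendstoD(1)[OF RG this]
    show "\<forall>\<^sub>F x in at_top. s < SR x / (G x * M x)"
      using eventually_gt_at_top[of 0]
    proof eventually_elim
      case (elim x)
      have g: "0 < G x" "0 < M x" using elim by (auto intro: G_pos M_pos)
      have "R x / G x = R x * M x / (G x * M x)" using g by simp
      also have "\<dots> \<le> SR x / (G x * M x)" using S_ge[of x] g by (intro divide_right_mono) auto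
      finally show ?case using elim by linarith
    qed
  next
    fix s assume s: "t < s"
    \<comment> \<open>Chosen so that the limit \<open>t + 2 e t\<close> of the upper bound stays below \<open>s\<close>.\<close>
    define e where "e = min (1/2) ((s - t) / (4 * t))"
    have e: "0 < e" "e \<le> 1/2" "e \<le> (s - t) / (4 * t)" using s t_pos by (auto simp: e_def)
    have "2 * t * e \<le> (s - t) / 2" using mult_left_mono[OF e(3), of "2 * t"] t_pos by simp
    then have lt: "t + 2 * e * t < s" using s by (simp add: mult_ac)
    have "((\<lambda>x. R (e * x) / G x + 2 * e * (H (e * x) / ((e * x) * G (e * x))) * (G (e * x) / G x)) \<longlongrightarrow> t * e powr (- 0) + 2 * e * t * e powr 0) at_top"
      using e by (intro tendsto_intros R_scaled_lim[OF GV'] regvarD[OF GV] tendsto_at_top_times[OF _ H_limit_0[OF GV]]) auto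
    then have "((\<lambda>x. R (e * x) / G x + 2 * e * (H (e * x) / ((e * x) * G (e * x))) * (G (e * x) / G x)) \<longlongrightarrow> t + 2 * e * t) at_top"
      using e by simp
    from order_tendstoD(2)[OF this lt]
    show "\<forall>\<^sub>F x in at_top. SR x / (G x * M x) < s"
      using eventually_gt_at_top[of 0]
    proof eventually_elim
      case (elim x)
      have ex: "0 < e * x" "e * x \<le> x / 2" using elim e by auto
      have exx: "e * x < x" using ex elim by linarith
      have g: "0 < G x" "0 < M x" "0 < G (e * x)" using elim ex by (auto intro: G_pos M_pos)
      have "(x - e * x) * k (x - e * x) \<le> M (x - e * x)" using exx by (intro xk_le_M) auto
      also have "\<dots> \<le> M x" using ex by (intro monoD[OF M_mono]) auto
      finally have m: "(x - e * x) * k (x - e * x) \<le> M x" .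
      have "x / 2 * k (x - e * x) \<le> (x - e * x) * k (x - e * x)" using ex k_nonneg by (intro mult_right_mono) auto
      with m have "x / 2 * k (x - e * x) \<le> M x" by linarith
      then have "k (x - e * x) \<le> 2 * M x / x" using \<open>0 < x\<close> by (simp add: field_simps)
      then have "k (x - e * x) * H (e * x) \<le> 2 * M x / x * H (e * x)" using H_nonneg by (intro mult_right_mono)
      with S_le_split[OF ex(1) exx] have "SR x \<le> R (e * x) * M x + 2 * M x / x * H (e * x)" by linarith
      then have "SR x / (G x * M x) \<le> (R (e * x) * M x + 2 * M x / x * H (e * x)) / (G x * M x)"
        using g by (intro divide_right_mono) auto
      also have "\<dots> = R (e * x) / G x + 2 * e * (H (e * x) / ((e * x) * G (e * x))) * (G (e * x) / G x)"
        using g e elim by (simp add: field_simps)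
      finally show ?case using elim by linarith
    qed
  qed
qed

text \<open>The integral of \<open>S(w)/w\<^sup>2 \<sim> t G(w) M(w)/w\<^sup>2\<close> is found by comparison with
  \<open>A(x) = \<integral>\<^sub>x\<^sup>\<infinity> M(w)/w\<^sup>2 dw = G(x) + M(x)/x \<sim> G(x)\<close>:
  the integral of \<open>A(w) M(w)/w\<^sup>2\<close> is exactly \<open>A(x)\<^sup>2/2\<close>.\<close>

theorem second_order_0:
  assumes GV: "regvar G 0"
  shows "((\<lambda>x. (R x - t * G x) / (G x)\<^sup>2) \<longlongrightarrow> - (t\<^sup>2 / 2)) at_top"
proof -
  have GV': "regvar G (- 0)" using GV by simp
  have S: "((\<lambda>x. SR x / (x * (G x)\<^sup>2)) \<longlongrightarrow> 0) at_top" using S_limit_below_1[OF GV'] by simp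
  define f where "f x = G x * M x / x\<^sup>2" for x
  have fpos: "\<forall>\<^sub>F x in at_top. 0 < f x"
    using eventually_gt_at_top[of 0] by eventually_elim (use G_pos M_pos in \<open>auto simp: f_def\<close>)
  have lim: "((\<lambda>x. SR x / x\<^sup>2 / f x) \<longlongrightarrow> t) at_top"
    using S_limit_0[OF GV] by (rule Lim_transform_eventually)
      (use eventually_gt_at_top[of 0] in \<open>eventually_elim, simp add: f_def\<close>)
  have f_meas: "set_borel_measurable lborel {x..} f" for x unfolding f_def by (rule GM_measurable)
  obtain X where X: "1 \<le> X" and f_int: "set_integrable lborel {X..} f"
    and L: "((\<lambda>x. (LBINT w:{x..}. SR w / w\<^sup>2) / (LBINT w:{x..}. f w)) \<longlongrightarrow> t) at_top"
    using S_tail_integral_asymptotics[OF f_meas fpos lim t_pos] by blast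
  define A where "A x = (LBINT w:{x..}. M w / w\<^sup>2)" for x
  have A: "A x = G x + M x / x" if "0 < x" for x unfolding A_def by (rule M_div_square_integral(2)[OF that])
  have AG: "((\<lambda>x. A x / G x) \<longlongrightarrow> 1) at_top"
  proof -
    have "((\<lambda>x. 1 + M x / (x * G x)) \<longlongrightarrow> 1 + 0) at_top" by (intro tendsto_intros M_limit_0[OF GV])
    then have "((\<lambda>x. A x / G x) \<longlongrightarrow> 1 + 0) at_top"
    proof (rule Lim_transform_eventually)
      show "\<forall>\<^sub>F x in at_top. 1 + M x / (x * G x) = A x / G x"
        using eventually_gt_at_top[of 0] by eventually_elim (use G_pos in \<open>force simp: A add_divide_distrib\<close>)
    qed
    then show ?thesis by simp
  qed
  have nn: "0 \<le> M w / w\<^sup>2" if "x \<le> w" "0 < x" for x w using M_pos[of w] that by simp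
  have tri: "has_bochner_integral lborel (\<lambda>w. indicator {x..} w *\<^sub>R (M w / w\<^sup>2 * A w)) ((A x)\<^sup>2 / 2)" if "0 < x" for x
    unfolding A_def using that by (intro set_integral_triangle M_div_square_integral(1)) (auto intro: nn)
  \<comment> \<open>\<open>G\<close> may be replaced by the exact primitive \<open>A\<close>.\<close>
  have fa: "((\<lambda>x. f x / (M x / x\<^sup>2 * A x)) \<longlongrightarrow> 1) at_top"
  proof -
    have "((\<lambda>x. 1 / (A x / G x)) \<longlongrightarrow> 1 / 1) at_top" by (intro tendsto_intros AG) simp
    then have "((\<lambda>x. f x / (M x / x\<^sup>2 * A x)) \<longlongrightarrow> 1 / 1) at_top"
    proof (rule Lim_transform_eventually)
      show "\<forall>\<^sub>F x in at_top. 1 / (A x / G x) = f x / (M x / x\<^sup>2 * A x)"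
        using eventually_gt_at_top[of 0] by eventually_elim (use M_pos in \<open>force simp: f_def field_simps\<close>)
    qed
    then show ?thesis by simp
  qed
  have "((\<lambda>x. (LBINT w:{x..}. f w) / (LBINT w:{x..}. M w / w\<^sup>2 * A w)) \<longlongrightarrow> 1) at_top"
  proof (rule tail_integral_ratio[OF fa _ _ f_int])
    show "\<forall>\<^sub>F x in at_top. 0 < M x / x\<^sup>2 * A x"
      using eventually_gt_at_top[of 0]
    proof eventually_elim
      case (elim x)
      then show ?case using M_pos[of x] G_pos[of x] by (simp add: A add_pos_pos)
    qed
    show "set_integrable lborel {X..} (\<lambda>w. M w / w\<^sup>2 * A w)"
      using tri[of X] X by (simp add: set_integrable_def has_bochner_integral_iff)
  qed
  then have "((\<lambda>x. (LBINT w:{x..}. SR w / w\<^sup>2) / (LBINT w:{x..}. f w) * ((LBINT w:{x..}. f w) / (LBINT w:{x..}. M w / w\<^sup>2 * A w)) * ((A x / G x)\<^sup>2 / 2)) \<longlongrightarrow> t * 1 * (1\<^sup>2 / 2)) at_top"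
    by (intro tendsto_mult L tendsto_divide tendsto_power AG tendsto_const) auto
  then have I: "((\<lambda>x. (LBINT w:{x..}. SR w / w\<^sup>2) / (G x)\<^sup>2) \<longlongrightarrow> t * 1 * (1\<^sup>2 / 2)) at_top"
  proof (rule Lim_transform_eventually)
    obtain Y where Y: "\<And>x. Y \<le> x \<Longrightarrow> 0 < f x" using fpos by (auto simp: eventually_at_top_linorder)
    show "\<forall>\<^sub>F x in at_top. (LBINT w:{x..}. SR w / w\<^sup>2) / (LBINT w:{x..}. f w) * ((LBINT w:{x..}. f w) / (LBINT w:{x..}. M w / w\<^sup>2 * A w)) * ((A x / G x)\<^sup>2 / 2)
        = (LBINT w:{x..}. SR w / w\<^sup>2) / (G x)\<^sup>2"
      using eventually_ge_at_top[of "max X Y"]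
    proof eventually_elim
      case (elim x)
      have x: "0 < x" using elim X by auto
      have 1: "0 < (LBINT w:{x..}. f w)" using elim Y by (intro tail_integral_pos set_integrable_subset[OF f_int]) auto
      have 2: "(LBINT w:{x..}. M w / w\<^sup>2 * A w) = (A x)\<^sup>2 / 2"
        using tri[OF x] by (simp add: set_lebesgue_integral_def has_bochner_integral_iff)
      have 3: "0 < A x" using x M_pos[of x] G_pos[of x] by (simp add: A add_pos_pos)
      show ?case unfolding 2 using 1 3 by (simp add: power_divide)
    qed
  qed
  have "((\<lambda>x. (R x - t * G x) / (G x)\<^sup>2) \<longlongrightarrow> t * (0 - t * 1 * (1\<^sup>2 / 2))) at_top"
    by (rule tail_diff_limit[OF _ I]) (use S in simp)
  then show ?thesis by (simp add: power2_eq_square)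
qed

lemma S_lim_of_M_bounded:
  assumes "(M \<longlongrightarrow> m) at_top"
  shows "((\<lambda>x. M x - SR x) \<longlongrightarrow> m) at_top"
proof -
  have "((\<lambda>x. M x * (1 - SR x / M x)) \<longlongrightarrow> m * (1 - 0)) at_top"
    by (intro tendsto_intros assms S_div_M_lim)
  then have "((\<lambda>x. M x - SR x) \<longlongrightarrow> m * (1 - 0)) at_top"
    by (rule Lim_transform_eventually)
       (use eventually_gt_at_top[of 0] in \<open>eventually_elim, use M_pos in \<open>force simp: field_simps\<close>\<close>)
  then show ?thesis by simp
qed

end

section \<open>From the tail formula to expansions\<close>

lemma remainder_form:
  fixes A m \<delta> :: "real \<Rightarrow> real"
  assumes m: "\<forall>\<^sub>F x in at_top. 0 < m x" and \<delta>: "\<forall>\<^sub>F x in at_top. 0 < \<delta> x" and s: "0 < s"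
    and lim: "((\<lambda>x. (A x - s * m x) / (m x * \<delta> x)) \<longlongrightarrow> s * e) at_top"
  shows "\<exists>r \<in> o[at_top](\<delta>). \<forall>\<^sub>F x in at_top. A x = s * m x * (1 + e * \<delta> x + r x)"
proof (rule bexI)
  define r where "r x = A x / (s * m x) - 1 - e * \<delta> x" for x
  show "\<forall>\<^sub>F x in at_top. A x = s * m x * (1 + e * \<delta> x + r x)"
    using m by eventually_elim (use s in \<open>simp add: r_def\<close>)
  have "((\<lambda>x. (A x - s * m x) / (m x * \<delta> x) / s - e) \<longlongrightarrow> s * e / s - e) at_top"
    using s by (intro tendsto_intros lim) auto
  then have "((\<lambda>x. r x / \<delta> x) \<longlongrightarrow> s * e / s - e) at_top"
  proof (rule Lim_transform_eventually)
    show "\<forall>\<^sub>F x in at_top. (A x - s * m x) / (m x * \<delta> x) / s - e = r x / \<delta> x"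
      using m \<delta> by eventually_elim (use s in \<open>simp add: r_def field_simps\<close>)
  qed
  then show "r \<in> o[at_top](\<delta>)"
    using s \<delta> by (intro smalloI_tendsto) (auto elim: eventually_mono)
qed

text \<open>The expansions of \<open>m\<close> and of \<open>R\<close> around \<open>G\<close> and
  \<open>t G\<close> have error terms proportional to \<open>\<kappa>\<close> and
  \<open>t\<^sup>2 \<kappa>\<close>. Eliminating \<open>G\<close> leaves \<open>t\<^sup>2 - t\<close>.\<close>

lemma second_order_transfer:
  fixes G m D \<delta> :: "real \<Rightarrow> real"
  assumes Gm: "((\<lambda>x. G x / m x) \<longlongrightarrow> 1) at_top" and m: "\<forall>\<^sub>F x in at_top. 0 < m x" and G: "\<forall>\<^sub>F x in at_top. 0 < G x"
    and D: "\<forall>\<^sub>F x in at_top. 0 < D x" and \<delta>: "\<forall>\<^sub>F x in at_top. 0 < \<delta> x"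
    and D\<delta>: "((\<lambda>x. D x / \<delta> x) \<longlongrightarrow> d) at_top"
    and base: "((\<lambda>x. (m x - 1 * G x) / (G x * D x)) \<longlongrightarrow> 1\<^sup>2 * \<kappa>) at_top"
  shows "\<exists>r \<in> o[at_top](\<delta>). \<forall>\<^sub>F x in at_top. G x = m x * (1 - \<kappa> * d * \<delta> x + r x)"
    and "\<And>t R. 0 < t \<Longrightarrow> ((\<lambda>x. (R x - t * G x) / (G x * D x)) \<longlongrightarrow> t\<^sup>2 * \<kappa>) at_top \<Longrightarrow>
      \<exists>r \<in> o[at_top](\<delta>). \<forall>\<^sub>F x in at_top. R x = t * m x * (1 + (t - 1) * (\<kappa> * d) * \<delta> x + r x)"
proof -
  have scale: "((\<lambda>x. (R x - t * G x) / (m x * \<delta> x)) \<longlongrightarrow> c * d) at_top"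
    if "((\<lambda>x. (R x - t * G x) / (G x * D x)) \<longlongrightarrow> c) at_top" for R :: "real \<Rightarrow> real" and t c
  proof -
    have "((\<lambda>x. (R x - t * G x) / (G x * D x) * (G x / m x) * (D x / \<delta> x)) \<longlongrightarrow> c * 1 * d) at_top"
      by (intro tendsto_mult that Gm D\<delta>)
    then have "((\<lambda>x. (R x - t * G x) / (m x * \<delta> x)) \<longlongrightarrow> c * 1 * d) at_top"
      by (rule Lim_transform_eventually) (use G D in \<open>eventually_elim, simp\<close>)
    then show ?thesis by simp
  qed
  have b: "((\<lambda>x. (m x - 1 * G x) / (m x * \<delta> x)) \<longlongrightarrow> 1\<^sup>2 * \<kappa> * d) at_top" by (rule scale[OF base])
  have "((\<lambda>x. - ((m x - 1 * G x) / (m x * \<delta> x))) \<longlongrightarrow> - (1\<^sup>2 * \<kappa> * d)) at_top"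
    by (intro tendsto_intros b)
  moreover have "- ((m x - 1 * G x) / (m x * \<delta> x)) = (G x - 1 * m x) / (m x * \<delta> x)" for x
    by (simp add: minus_divide_left)
  ultimately have "((\<lambda>x. (G x - 1 * m x) / (m x * \<delta> x)) \<longlongrightarrow> 1 * (- (\<kappa> * d))) at_top" by simp
  from remainder_form[OF m \<delta> zero_less_one this]
  show "\<exists>r \<in> o[at_top](\<delta>). \<forall>\<^sub>F x in at_top. G x = m x * (1 - \<kappa> * d * \<delta> x + r x)" by simp
  fix t :: real and R assume t: "0 < t" and lim: "((\<lambda>x. (R x - t * G x) / (G x * D x)) \<longlongrightarrow> t\<^sup>2 * \<kappa>) at_top"
  have "((\<lambda>x. (R x - t * G x) / (m x * \<delta> x) - t * ((m x - 1 * G x) / (m x * \<delta> x))) \<longlongrightarrow> t\<^sup>2 * \<kappa> * d - t * (1\<^sup>2 * \<kappa> * d)) at_top"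
    by (intro tendsto_intros scale[OF lim] b)
  moreover have "(R x - t * G x) / (m x * \<delta> x) - t * ((m x - 1 * G x) / (m x * \<delta> x)) = (R x - t * m x) / (m x * \<delta> x)" for x
    by (simp add: diff_divide_distrib right_diff_distrib)
  moreover have "t\<^sup>2 * \<kappa> * d - t * (1\<^sup>2 * \<kappa> * d) = t * ((t - 1) * (\<kappa> * d))"
    by (simp add: power2_eq_square algebra_simps)
  ultimately have "((\<lambda>x. (R x - t * m x) / (m x * \<delta> x)) \<longlongrightarrow> t * ((t - 1) * (\<kappa> * d))) at_top" by simp
  from remainder_form[OF m \<delta> t this]
  show "\<exists>r \<in> o[at_top](\<delta>). \<forall>\<^sub>F x in at_top. R x = t * m x * (1 + (t - 1) * (\<kappa> * d) * \<delta> x + r x)" .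
qed

lemma mono_at_top_cases:
  fixes F :: "real \<Rightarrow> real"
  assumes "mono F"
  obtains "filterlim F at_top at_top" | s where "(F \<longlongrightarrow> s) at_top"
proof (cases "bdd_above (range F)")
  case True
  have "(F \<longlongrightarrow> (SUP x. F x)) at_top"
  proof (rule increasing_tendsto)
    show "\<forall>\<^sub>F x in at_top. F x \<le> (SUP x. F x)" using True by (intro always_eventually allI cSUP_upper) auto
    fix y assume "y < (SUP x. F x)"
    then obtain x0 where "y < F x0" using less_cSUP_iff[OF _ True] by auto
    then have "\<And>x. x0 \<le> x \<Longrightarrow> y < F x" using monoD[OF assms] by (meson less_le_trans)
    then show "\<forall>\<^sub>F x in at_top. y < F x" by (auto simp: eventually_at_top_linorder)
  qed
  then show ?thesis by (rule that(2))
next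
  case False
  have "filterlim F at_top at_top"
    unfolding filterlim_at_top
  proof
    fix Z
    obtain x0 where "Z < F x0" using False by (auto simp: bdd_above_def not_le)
    then have "\<And>x. x0 \<le> x \<Longrightarrow> Z \<le> F x" using monoD[OF assms] by (meson less_imp_le order_trans)
    then show "\<forall>\<^sub>F x in at_top. Z \<le> F x" by (auto simp: eventually_at_top_linorder)
  qed
  then show ?thesis by (rule that(1))
qed

theorem proposition6p1:
  fixes \<mu> \<nu> :: "real measure" and p k l :: "real \<Rightarrow> real" and \<gamma> a \<alpha> :: real
  assumes sd: "self_decomposable \<mu>"
    and nondeg: "\<not> degenerate \<mu>"
    and supp: "emeasure \<mu> {..<0} = 0"
    and triplet: "levy_triplet \<mu> \<gamma> a \<nu>"
    and nu: "\<nu> = density lborel (\<lambda>x. ennreal (indicator {0<..} x * (k x / x)))"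
    and k_decr: "antimono_on {0<..} k"
    and k_pos: "\<And>x. 0 < x \<Longrightarrow> 0 < k x"
    and dens: "unimodal_density \<mu> p"
    and alpha: "0 \<le> \<alpha>" "\<alpha> \<le> 1"
    and l_sv: "slowly_varying l"
    and l_int: "\<And>x. 1 \<le> x \<Longrightarrow> set_integrable lborel {1..x} l"
    and p_asymp: "p \<sim>[at_top] (\<lambda>x. x powr (- \<alpha> - 1) * l x)"
  shows
    "(0 < \<alpha> \<and> \<alpha> < 1 \<longrightarrow>
        (\<exists>r \<in> o[at_top](\<lambda>x. x powr (- \<alpha>) * l x). \<forall>\<^sub>F x in at_top.
           tail \<nu> x = tail \<mu> x * (1 - K_const \<alpha> * x powr (- \<alpha>) * l x + r x)) \<and>
        (\<forall>t>0. \<forall>\<mu>t. is_conv_power t \<mu> \<mu>t \<longrightarrow>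
           (\<exists>r \<in> o[at_top](\<lambda>x. x powr (- \<alpha>) * l x). \<forall>\<^sub>F x in at_top.
              tail \<mu>t x = t * tail \<mu> x * (1 + (t - 1) * K_const \<alpha> * x powr (- \<alpha>) * l x + r x)))) \<and>
     (\<alpha> = 1 \<and> l_upper_infinity l = \<infinity> \<longrightarrow>
        (\<exists>r \<in> o[at_top](\<lambda>x. l_upper l x / x). \<forall>\<^sub>F x in at_top.
           tail \<nu> x = tail \<mu> x * (1 - l_upper l x / x + r x)) \<and>
        (\<forall>t>0. \<forall>\<mu>t. is_conv_power t \<mu> \<mu>t \<longrightarrow>
           (\<exists>r \<in> o[at_top](\<lambda>x. l_upper l x / x). \<forall>\<^sub>F x in at_top.
              tail \<mu>t x = t * tail \<mu> x * (1 + (t - 1) * (l_upper l x / x) + r x)))) \<and>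
     (\<alpha> = 1 \<and> l_upper_infinity l < \<infinity> \<longrightarrow>
        (\<exists>r \<in> o[at_top](\<lambda>x. 1 / x). \<forall>\<^sub>F x in at_top.
           tail \<nu> x = tail \<mu> x * (1 - mean \<mu> / x + r x)) \<and>
        (\<forall>t>0. \<forall>\<mu>t. is_conv_power t \<mu> \<mu>t \<longrightarrow>
           (\<exists>r \<in> o[at_top](\<lambda>x. 1 / x). \<forall>\<^sub>F x in at_top.
              tail \<mu>t x = t * tail \<mu> x * (1 + (t - 1) * (mean \<mu> / x) + r x)))) \<and>
     (\<alpha> = 0 \<longrightarrow>
        (\<exists>r \<in> o[at_top](l_lower l). \<forall>\<^sub>F x in at_top.
           tail \<nu> x = tail \<mu> x * (1 + l_lower l x / 2 + r x)) \<and>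
        (\<forall>t>0. \<forall>\<mu>t. is_conv_power t \<mu> \<mu>t \<longrightarrow>
           (\<exists>r \<in> o[at_top](l_lower l). \<forall>\<^sub>F x in at_top.
              tail \<mu>t x = t * tail \<mu> x * (1 - (t - 1) * (l_lower l x / 2) + r x))))"
  (is "(_ \<longrightarrow> ?P1) \<and> (_ \<longrightarrow> ?P2) \<and> (_ \<longrightarrow> ?P3) \<and> (_ \<longrightarrow> ?P4)")
proof -
  obtain k0 b where lt: "levy_tail k0 b"
    and tail_nu: "\<And>x. 0 < x \<Longrightarrow> tail \<nu> x = levy_tail.G k0 x"
    and ct: "\<And>t \<rho>. 0 < t \<Longrightarrow> is_conv_power t \<mu> \<rho> \<Longrightarrow> conv_tail k0 b (tail \<rho>) t"
    and ct1: "conv_tail k0 b (tail \<mu>) 1"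
    and mean_lim: "\<And>m. ((\<lambda>w. levy_tail.M k0 b w - levy_tail.S k0 b (tail \<mu>) w) \<longlongrightarrow> m) at_top \<Longrightarrow> mean \<mu> = m"
    using conv_powers_conv_tail[OF supp triplet nu k_decr k_pos] by blast
  interpret lt: levy_tail k0 b by (rule lt)
  interpret c1: conv_tail k0 b "tail \<mu>" 1 by (rule ct1)
  define m where "m = tail \<mu>"
  have rd: "real_distribution \<mu>" using triplet by (simp add: levy_triplet_def)
  interpret mu: real_distribution \<mu> by (rule rd)
  have p_meas[measurable]: "p \<in> borel_measurable borel" and p0: "\<And>x. 0 \<le> p x" and mu_p: "\<mu> = density lborel (\<lambda>x. ennreal (p x))"
    using dens by (auto simp: unimodal_density_def)
  obtain c where p_anti: "antimono_on {c<..} p" using dens by (auto simp: unimodal_density_def)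
  have p_int: "integrable lborel p"
  proof (rule integrableI_nonneg)
    have "(\<integral>\<^sup>+x. ennreal (p x) \<partial>lborel) = emeasure \<mu> (space \<mu>)" unfolding mu_p by (simp add: emeasure_density)
    also have "\<dots> < \<infinity>" using mu.emeasure_space_1 by simp
    finally show "(\<integral>\<^sup>+x. ennreal (p x) \<partial>lborel) < \<infinity>" .
  qed (use p0 in auto)
  have p_sint: "set_integrable lborel A p" if "A \<in> sets borel" for A
    unfolding set_integrable_def using integrable_mult_indicator[OF _ p_int, of A] that by simp
  have m_eq: "m x = (LBINT u:{x..}. p u)" for x
  proof -
    have "emeasure \<mu> {x<..} = (\<integral>\<^sup>+u. ennreal (p u) * indicator {x<..} u \<partial>lborel)"
      by (subst mu_p) (simp add: emeasure_density)
    also have "\<dots> = (\<integral>\<^sup>+u. ennreal (indicator {x..} u *\<^sub>R p u) \<partial>lborel)"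
      by (intro nn_integral_cong_AE, use AE_lborel_singleton[of x] in eventually_elim) (auto simp: indicator_def)
    also have "\<dots> = ennreal (LBINT u:{x..}. p u)"
      unfolding set_lebesgue_integral_def
      using p_sint[of "{x..}"] p0 by (intro nn_integral_eq_integral) (auto simp: set_integrable_def indicator_def intro!: AE_I2)
    finally have "emeasure \<mu> {x<..} = ennreal (LBINT u:{x..}. p u)" .
    moreover have "0 \<le> (LBINT u:{x..}. p u)" using p0 by (intro set_integral_nonneg')
    ultimately show ?thesis by (simp add: m_def tail_def measure_def)
  qed
  have l_pos: "0 < l x" if "0 < x" for x using l_sv that by (auto simp: slowly_varying_def)
  have l_rv: "regvar l 0"
    unfolding regvar_def
  proof (intro conjI allI impI)
    show "\<forall>\<^sub>F x in at_top. 0 < l x" using eventually_gt_at_top[of 0] by eventually_elim (rule l_pos)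
    fix c :: real assume "0 < c"
    then show "((\<lambda>x. l (c * x) / l x) \<longlongrightarrow> c powr 0) at_top" using l_sv by (simp add: slowly_varying_def)
  qed
  define g where "g x = x powr (- \<alpha> - 1) * l x" for x
  have g_rv: "regvar g (- \<alpha> - 1)" using regvar_mult[OF regvar_powr l_rv, of "- \<alpha> - 1"] by (simp add: g_def[abs_def])
  have g_pos: "0 < g x" if "0 < x" for x using that l_pos by (simp add: g_def)
  have pg: "((\<lambda>x. p x / g x) \<longlongrightarrow> 1) at_top"
  proof -
    have "((\<lambda>x. if p x = 0 \<and> g x = 0 then 1 else p x / g x) \<longlongrightarrow> 1) at_top"
      using p_asymp unfolding asymp_equiv_def g_def .
    then show ?thesis
      by (rule Lim_transform_eventually) (use eventually_gt_at_top[of 0] in \<open>eventually_elim, use g_pos in force\<close>)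
  qed
  have p_rv: "regvar p (- \<alpha> - 1)" by (rule regvar_equivalent[OF g_rv pg]) simp
  have m_rv: "regvar m (- \<alpha>)"
    using regvar_tail_integral[OF p_rv p_sint[of "{0..}"]] by (simp add: m_eq[abs_def])
  have m_pos: "\<forall>\<^sub>F x in at_top. 0 < m x" by (rule regvar_pos[OF m_rv])
  have Gm: "((\<lambda>x. lt.G x / m x) \<longlongrightarrow> 1) at_top"
    using c1.levy_tail_equivalent_of_regvar[OF m_rv[unfolded m_def]] by (simp add: m_def)
  have G_rv: "regvar lt.G (- \<alpha>)" by (rule regvar_equivalent[OF m_rv Gm]) simp
  have G_pos: "\<forall>\<^sub>F x in at_top. 0 < lt.G x" by (rule regvar_pos[OF G_rv])
  \<comment> \<open>Unimodality makes \<open>p\<close> eventually monotone, so the tail determines it to first order.\<close>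
  have xpm: "((\<lambda>x. x * p x / m x) \<longlongrightarrow> \<alpha>) at_top"
    unfolding m_eq
  proof (rule monotone_density[OF _ p_sint])
    show "antimono_on {c + 1..} p" using p_anti by (auto simp: monotone_on_def)
    show "regvar (\<lambda>x. LBINT u:{x..}. p u) (- \<alpha>)" using m_rv by (simp add: m_eq[abs_def])
  qed simp
  have xg: "x * g x = x powr (- \<alpha>) * l x" if "0 < x" for x
    using that by (simp add: g_def powr_diff)
  have tail_nu_ev: "\<forall>\<^sub>F x in at_top. tail \<nu> x = lt.G x"
    using eventually_gt_at_top[of 0] by eventually_elim (rule tail_nu)
  have nu_form: "\<exists>r\<in>A. \<forall>\<^sub>F x in at_top. tail \<nu> x = F r x" if ex: "\<exists>r\<in>A. \<forall>\<^sub>F x in at_top. lt.G x = F r x"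
    for A :: "(real \<Rightarrow> real) set" and F :: "(real \<Rightarrow> real) \<Rightarrow> real \<Rightarrow> real"
  proof -
    obtain r where r: "r \<in> A" "\<forall>\<^sub>F x in at_top. lt.G x = F r x" using ex by blast
    have "\<forall>\<^sub>F x in at_top. tail \<nu> x = F r x" using tail_nu_ev r(2) by eventually_elim simp
    with r(1) show ?thesis by blast
  qed
  have index_below_one: "?P1" if a1: "0 < \<alpha>" "\<alpha> < 1"
  proof -
    define \<delta> where "\<delta> x = x powr (- \<alpha>) * l x" for x
    have \<delta>: "\<forall>\<^sub>F x in at_top. 0 < \<delta> x" using eventually_gt_at_top[of 0] by eventually_elim (use l_pos in \<open>simp add: \<delta>_def\<close>)
    \<comment> \<open>\<open>G\<close>, the tail of \<open>\<mu>\<close> and \<open>x p(x)/\<alpha>\<close> are asymptotic to each other.\<close>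
    have "((\<lambda>x. lt.G x / m x / (x * p x / m x) * (p x / g x)) \<longlongrightarrow> 1 / \<alpha> * 1) at_top"
      using a1 by (intro tendsto_intros Gm xpm pg) auto
    then have D\<delta>: "((\<lambda>x. lt.G x / \<delta> x) \<longlongrightarrow> 1 / \<alpha> * 1) at_top"
    proof (rule Lim_transform_eventually)
      show "\<forall>\<^sub>F x in at_top. lt.G x / m x / (x * p x / m x) * (p x / g x) = lt.G x / \<delta> x"
        using m_pos regvar_pos[OF p_rv] eventually_gt_at_top[of 0]
        by eventually_elim (simp add: \<delta>_def flip: xg)
    qed
    define \<kappa> where "\<kappa> = (2 * \<alpha> - 1) * Beta (1 - \<alpha>) (1 - \<alpha>) / 2"
    have K: "\<kappa> * (1 / \<alpha> * 1) = K_const \<alpha>"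
    proof -
      have "Beta (1 - \<alpha>) (1 - \<alpha>) = (Gamma (1 - \<alpha>))\<^sup>2 / Gamma (2 - 2 * \<alpha>)"
        by (simp add: Beta_def power2_eq_square)
      then show ?thesis by (simp add: \<kappa>_def K_const_def)
    qed
    have so: "((\<lambda>x. (R x - t * lt.G x) / (lt.G x * lt.G x)) \<longlongrightarrow> t\<^sup>2 * \<kappa>) at_top" if "conv_tail k0 b R t" for R t
      using conv_tail.second_order_between_0_1[OF that G_rv a1] by (simp add: power2_eq_square \<kappa>_def)
    note tr = second_order_transfer[OF Gm m_pos G_pos G_pos \<delta> D\<delta> so[OF ct1, folded m_def]]
    show ?thesis
    proof (intro conjI allI impI)
      obtain r where r: "r \<in> o[at_top](\<delta>)" "\<forall>\<^sub>F x in at_top. lt.G x = m x * (1 - \<kappa> * (1 / \<alpha> * 1) * \<delta> x + r x)"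
        using tr(1) by auto
      show "\<exists>r \<in> o[at_top](\<lambda>x. x powr (- \<alpha>) * l x). \<forall>\<^sub>F x in at_top.
           tail \<nu> x = tail \<mu> x * (1 - K_const \<alpha> * x powr (- \<alpha>) * l x + r x)"
      proof (rule bexI)
        show "\<forall>\<^sub>F x in at_top. tail \<nu> x = tail \<mu> x * (1 - K_const \<alpha> * x powr (- \<alpha>) * l x + r x)"
          using tail_nu_ev r(2) by eventually_elim (simp only: K, simp add: \<delta>_def m_def mult.assoc)
      qed (use r(1) in \<open>simp add: \<delta>_def[abs_def]\<close>)
      fix t \<mu>t assume t: "0 < t" and cp: "is_conv_power t \<mu> \<mu>t"
      obtain r where r: "r \<in> o[at_top](\<delta>)" "\<forall>\<^sub>F x in at_top. tail \<mu>t x = t * m x * (1 + (t - 1) * (\<kappa> * (1 / \<alpha> * 1)) * \<delta> x + r x)"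
        using tr(2)[OF t so[OF ct[OF t cp]]] by auto
      show "\<exists>r \<in> o[at_top](\<lambda>x. x powr (- \<alpha>) * l x). \<forall>\<^sub>F x in at_top.
              tail \<mu>t x = t * tail \<mu> x * (1 + (t - 1) * K_const \<alpha> * x powr (- \<alpha>) * l x + r x)"
      proof (rule bexI)
        show "\<forall>\<^sub>F x in at_top. tail \<mu>t x = t * tail \<mu> x * (1 + (t - 1) * K_const \<alpha> * x powr (- \<alpha>) * l x + r x)"
          using r(2) by eventually_elim (simp only: K, simp add: \<delta>_def m_def mult.assoc)
      qed (use r(1) in \<open>simp add: \<delta>_def[abs_def]\<close>)
    qed
  qed
  define q where "q u = l u / u" for u
  have q_pos: "0 < q x" if "0 < x" for x using that l_pos by (simp add: q_def)
  have q_evpos: "\<forall>\<^sub>F x in at_top. 0 < q x" using eventually_gt_at_top[of 0] by eventually_elim (rule q_pos)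
  have q_meas: "set_borel_measurable lborel A q" if A: "A \<in> sets borel" "A \<subseteq> {0<..}" for A
  proof -
    have "(\<lambda>x. indicator {0<..} x *\<^sub>R l x) \<in> borel_measurable borel"
      using l_sv by (subst (asm) slowly_varying_def) (simp add: borel_measurable_restrict_space_iff)
    then have "(\<lambda>x. indicator A x *\<^sub>R ((indicator {0<..} x *\<^sub>R l x) / x)) \<in> borel_measurable borel"
      using A(1) by measurable
    also have "(\<lambda>x. indicator A x *\<^sub>R ((indicator {0<..} x *\<^sub>R l x) / x)) = (\<lambda>x. indicator A x *\<^sub>R q x)"
      using A(2) by (auto simp: indicator_def q_def fun_eq_iff)
    finally show ?thesis by (simp add: set_borel_measurable_def)
  qed
  have q_int: "set_integrable lborel {1..x} q" for x
  proof (cases "1 \<le> x")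
    case True
    show ?thesis
    proof (rule set_integrable_bound[OF l_int[OF True]])
      show "AE u in lborel. u \<in> {1..x} \<longrightarrow> norm (q u) \<le> norm (l u)"
      proof (intro AE_I2 impI)
        fix u assume "u \<in> {1..x}"
        then have u: "1 \<le> u" by simp
        then have "\<bar>l u\<bar> / u \<le> \<bar>l u\<bar> / 1" by (intro divide_left_mono) auto
        then show "norm (q u) \<le> norm (l u)" using u by (simp add: q_def abs_divide)
      qed
    qed (rule q_meas, auto)
  qed (simp add: set_integrable_def)
  have lu: "l_upper l = (\<lambda>x. LBINT u:{1..x}. q u)" by (simp add: l_upper_def[abs_def] q_def[abs_def])
  have lu_mono: "mono (l_upper l)"
  proof
    fix x y :: real assume xy: "x \<le> y"
    show "l_upper l x \<le> l_upper l y"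
      unfolding lu set_lebesgue_integral_def
      using q_int[of x] q_int[of y] xy q_pos
      by (intro integral_mono) (auto simp: set_integrable_def indicator_def intro!: less_imp_le)
  qed
  \<comment> \<open>For index one, \<open>k(x) \<sim> G(x) \<sim> x p(x) \<sim> l(x)/x\<close>, so \<open>M\<close> and \<open>l\<^sup>*\<close> diverge together.\<close>
  have kq: "((\<lambda>x. k0 x / q x) \<longlongrightarrow> 1) at_top" if a1: "\<alpha> = 1"
  proof -
    have kG: "((\<lambda>x. k0 x / lt.G x) \<longlongrightarrow> 1) at_top" using lt.k_div_G_lim[OF G_rv] a1 by simp
    have "((\<lambda>x. k0 x / lt.G x * (lt.G x / m x) / (x * p x / m x) * (p x / g x)) \<longlongrightarrow> 1 * 1 / \<alpha> * 1) at_top"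
      using a1 by (intro tendsto_intros kG Gm xpm pg) auto
    then have "((\<lambda>x. k0 x / q x) \<longlongrightarrow> 1 * 1 / \<alpha> * 1) at_top"
    proof (rule Lim_transform_eventually)
      show "\<forall>\<^sub>F x in at_top. k0 x / lt.G x * (lt.G x / m x) / (x * p x / m x) * (p x / g x) = k0 x / q x"
        using m_pos regvar_pos[OF p_rv] eventually_gt_at_top[of 0] G_pos
      proof eventually_elim
        case (elim x)
        have "x * g x = q x" using xg[of x] elim a1 by (simp add: q_def powr_minus field_simps)
        then show ?case using elim by (simp add: field_simps)
      qed
    qed
    then show ?thesis using a1 by simp
  qed
  have k_int1: "set_integrable lborel {1..x} k0" for x
    by (rule set_integrable_subset[OF lt.k_integrable[of x]]) auto
  have M_split: "lt.M x = lt.M 1 + (LBINT u:{1..x}. k0 u)" if "1 \<le> x" for x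
    by (rule lt.M_increment) (use that in auto)
  have so1: "((\<lambda>x. (R x - t * lt.G x) / (lt.G x * (lt.M x / x))) \<longlongrightarrow> t\<^sup>2 * 1) at_top" if "conv_tail k0 b R t" "\<alpha> = 1" for R t
    using conv_tail.second_order_1[OF that(1)] G_rv that(2) by simp
  have D1: "\<forall>\<^sub>F x in at_top. 0 < lt.M x / x"
    using eventually_gt_at_top[of 0] by eventually_elim (use lt.M_pos in simp)
  have index_one_infinite_mean: "?P2" if a1: "\<alpha> = 1" "l_upper_infinity l = \<infinity>"
  proof -
    have lu_lim: "filterlim (l_upper l) at_top at_top"
    proof (rule mono_at_top_cases[OF lu_mono])
      fix s assume "(l_upper l \<longlongrightarrow> s) at_top"
      then have "((\<lambda>x. ereal (l_upper l x)) \<longlongrightarrow> ereal s) at_top" by (rule tendsto_ereal)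
      then have "l_upper_infinity l = ereal s" unfolding l_upper_infinity_def by (intro tendsto_Lim) auto
      then show ?thesis using a1 by simp
    qed
    define \<delta> where "\<delta> x = l_upper l x / x" for x
    have lu_pos: "\<forall>\<^sub>F x in at_top. 0 < l_upper l x" using lu_lim by (simp add: filterlim_at_top_dense)
    have \<delta>: "\<forall>\<^sub>F x in at_top. 0 < \<delta> x"
      using lu_pos eventually_gt_at_top[of 0] by eventually_elim (simp add: \<delta>_def)
    have "((\<lambda>x. (LBINT u:{1..x}. k0 u) / (LBINT u:{1..x}. q u)) \<longlongrightarrow> 1) at_top"
      by (rule head_integral_ratio[OF kq[OF a1(1)] q_evpos q_int k_int1]) (use lu_lim[unfolded lu] in simp)
    then have "((\<lambda>x. lt.M 1 / l_upper l x + (LBINT u:{1..x}. k0 u) / l_upper l x) \<longlongrightarrow> 0 + 1) at_top"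
      by (intro tendsto_add tendsto_divide_0[OF tendsto_const] filterlim_at_top_imp_at_infinity lu_lim) (simp only: lu)
    then have D\<delta>: "((\<lambda>x. lt.M x / x / \<delta> x) \<longlongrightarrow> 0 + 1) at_top"
    proof (rule Lim_transform_eventually)
      show "\<forall>\<^sub>F x in at_top. lt.M 1 / l_upper l x + (LBINT u:{1..x}. k0 u) / l_upper l x = lt.M x / x / \<delta> x"
        using eventually_ge_at_top[of 1]
      proof eventually_elim
        case (elim x)
        have "lt.M x / x / \<delta> x = lt.M x / l_upper l x" using elim by (simp add: \<delta>_def)
        then show ?case by (simp only: M_split[OF elim] add_divide_distrib)
      qed
    qed
    note tr = second_order_transfer[OF Gm m_pos G_pos D1 \<delta> D\<delta> so1[OF ct1 a1(1), folded m_def]]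
    show ?thesis
    proof (intro conjI allI impI)
      show "\<exists>r \<in> o[at_top](\<lambda>x. l_upper l x / x). \<forall>\<^sub>F x in at_top.
           tail \<nu> x = tail \<mu> x * (1 - l_upper l x / x + r x)"
        using nu_form[OF tr(1)] unfolding \<delta>_def m_def by simp
      fix t \<mu>t assume t: "0 < t" and cp: "is_conv_power t \<mu> \<mu>t"
      show "\<exists>r \<in> o[at_top](\<lambda>x. l_upper l x / x). \<forall>\<^sub>F x in at_top.
              tail \<mu>t x = t * tail \<mu> x * (1 + (t - 1) * (l_upper l x / x) + r x)"
        using tr(2)[OF t so1[OF ct[OF t cp] a1(1)]] unfolding \<delta>_def m_def by simp
    qed
  qed
  have index_one_finite_mean: "?P3" if a1: "\<alpha> = 1" "l_upper_infinity l < \<infinity>"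
  proof -
    \<comment> \<open>If \<open>M\<close> diverged, so would \<open>l\<^sup>*\<close>; hence \<open>M\<close> converges, and its limit is the mean.\<close>
    have nlu: "\<not> filterlim (l_upper l) at_top at_top"
    proof
      assume "filterlim (l_upper l) at_top at_top"
      then have "((\<lambda>x. ereal (l_upper l x)) \<longlongrightarrow> \<infinity>) at_top" by (simp add: tendsto_PInfty_eq_at_top)
      then have "l_upper_infinity l = \<infinity>" unfolding l_upper_infinity_def by (intro tendsto_Lim) auto
      then show False using a1 by simp
    qed
    obtain s where s: "(lt.M \<longlongrightarrow> s) at_top"
    proof (rule mono_at_top_cases[OF lt.M_mono])
      assume M: "filterlim lt.M at_top at_top"
      have "filterlim (\<lambda>x. - lt.M 1 + lt.M x) at_top at_top"
        by (rule filterlim_tendsto_add_at_top[OF tendsto_const M])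
      then have kinf: "filterlim (\<lambda>x. LBINT u:{1..x}. k0 u) at_top at_top"
      proof (rule filterlim_cong[OF refl refl, THEN iffD1, rotated])
        show "\<forall>\<^sub>F x in at_top. - lt.M 1 + lt.M x = (LBINT u:{1..x}. k0 u)"
          using eventually_ge_at_top[of 1]
        proof eventually_elim
          case (elim x)
          then show ?case using M_split[OF elim] by simp
        qed
      qed
      have "((\<lambda>x. 1 / (k0 x / q x)) \<longlongrightarrow> 1 / 1) at_top" by (intro tendsto_divide tendsto_const kq a1) simp
      then have qk: "((\<lambda>x. q x / k0 x) \<longlongrightarrow> 1) at_top" by simp
      have "\<forall>\<^sub>F x in at_top. 0 < k0 x" using eventually_gt_at_top[of 0] by eventually_elim (rule lt.k_pos)
      from head_integral_ratio[OF qk this k_int1 q_int kinf]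
      have "((\<lambda>x. l_upper l x / (LBINT u:{1..x}. k0 u)) \<longlongrightarrow> 1) at_top" by (simp add: lu)
      from filterlim_tendsto_pos_mult_at_top[OF this zero_less_one kinf]
      have "filterlim (l_upper l) at_top at_top"
      proof (rule filterlim_cong[OF refl refl, THEN iffD1, rotated])
        have "\<forall>\<^sub>F x in at_top. 0 < (LBINT u:{1..x}. k0 u)" using kinf by (simp add: filterlim_at_top_dense)
        then show "\<forall>\<^sub>F x in at_top. l_upper l x / (LBINT u:{1..x}. k0 u) * (LBINT u:{1..x}. k0 u) = l_upper l x"
          by eventually_elim simp
      qed
      then show thesis using nlu by simp
    qed (rule that)
    have mean: "mean \<mu> = s" by (rule mean_lim[OF c1.S_lim_of_M_bounded[OF s]])
    define \<delta> where "\<delta> x = 1 / x" for x :: real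
    have \<delta>: "\<forall>\<^sub>F x in at_top. 0 < \<delta> x" using eventually_gt_at_top[of 0] by eventually_elim (simp add: \<delta>_def)
    have D\<delta>: "((\<lambda>x. lt.M x / x / \<delta> x) \<longlongrightarrow> mean \<mu>) at_top"
      using s unfolding mean by (rule Lim_transform_eventually) (use eventually_gt_at_top[of 0] in \<open>eventually_elim, simp add: \<delta>_def\<close>)
    note tr = second_order_transfer[OF Gm m_pos G_pos D1 \<delta> D\<delta> so1[OF ct1 a1(1), folded m_def]]
    show ?thesis
    proof (intro conjI allI impI)
      show "\<exists>r \<in> o[at_top](\<lambda>x. 1 / x). \<forall>\<^sub>F x in at_top.
           tail \<nu> x = tail \<mu> x * (1 - mean \<mu> / x + r x)"
        using nu_form[OF tr(1)] unfolding \<delta>_def m_def by simp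
      fix t \<mu>t assume t: "0 < t" and cp: "is_conv_power t \<mu> \<mu>t"
      show "\<exists>r \<in> o[at_top](\<lambda>x. 1 / x). \<forall>\<^sub>F x in at_top.
              tail \<mu>t x = t * tail \<mu> x * (1 + (t - 1) * (mean \<mu> / x) + r x)"
        using tr(2)[OF t so1[OF ct[OF t cp] a1(1)]] unfolding \<delta>_def m_def by simp
    qed
  qed
  have index_zero: "?P4" if a0: "\<alpha> = 0"
  proof -
    have G0: "regvar lt.G 0" using G_rv a0 by simp
    have gq: "g x = q x" if "0 < x" for x using that a0 by (simp add: g_def q_def powr_minus field_simps)
    have pq: "((\<lambda>x. p x / q x) \<longlongrightarrow> 1) at_top"
      using pg by (rule Lim_transform_eventually) (use eventually_gt_at_top[of 0] in \<open>eventually_elim, simp add: gq\<close>)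
    have "\<forall>\<^sub>F x in at_top. q x \<le> 2 * p x"
    proof -
      have "\<forall>\<^sub>F x in at_top. 1/2 < p x / q x" by (rule order_tendstoD(1)[OF pq]) simp
      with q_evpos show ?thesis by eventually_elim (simp add: field_simps)
    qed
    then obtain Y where Y: "\<And>x. Y \<le> x \<Longrightarrow> q x \<le> 2 * p x" by (auto simp: eventually_at_top_linorder)
    define X where "X = max 1 Y"
    have qi: "set_integrable lborel {X..} q"
    proof (rule set_integrable_bound[OF set_integrable_mult_right[of 2, OF p_sint]])
      show "AE x in lborel. x \<in> {X..} \<longrightarrow> norm (q x) \<le> norm (2 * p x)"
      proof (intro AE_I2 impI)
        fix x assume "x \<in> {X..}"
        then have "0 < q x" "q x \<le> 2 * p x" using q_pos[of x] Y[of x] by (auto simp: X_def)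
        then show "norm (q x) \<le> norm (2 * p x)" by simp
      qed
    qed (auto intro!: q_meas simp: X_def)
    have ll: "l_lower l x = (LBINT u:{x..}. q u)" if "0 < x" for x
      unfolding l_lower_def q_def[symmetric]
    proof (rule set_integral_cong_set)
      show "AE u in lborel. u \<in> {x..} \<longleftrightarrow> u \<in> {x<..}"
        using AE_lborel_singleton[of x] by eventually_elim auto
    qed (use that in \<open>auto intro!: q_meas\<close>)
    have \<delta>: "\<forall>\<^sub>F x in at_top. 0 < l_lower l x"
      using eventually_ge_at_top[of X]
    proof eventually_elim
      case (elim x)
      then have x: "0 < x" by (simp add: X_def)
      show ?case unfolding ll[OF x]
        using elim x by (intro tail_integral_pos set_integrable_subset[OF qi] q_pos) auto
    qed
    have "((\<lambda>x. (LBINT u:{x..}. p u) / (LBINT u:{x..}. q u)) \<longlongrightarrow> 1) at_top"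
      by (rule tail_integral_ratio[OF pq q_evpos qi p_sint]) simp
    then have "((\<lambda>x. lt.G x / m x * (m x / (LBINT u:{x..}. q u))) \<longlongrightarrow> 1 * 1) at_top"
      by (intro tendsto_mult Gm) (simp add: m_eq)
    then have D\<delta>: "((\<lambda>x. lt.G x / l_lower l x) \<longlongrightarrow> 1 * 1) at_top"
      by (rule Lim_transform_eventually) (use eventually_gt_at_top[of 0] m_pos in \<open>eventually_elim, simp add: ll\<close>)
    have so: "((\<lambda>x. (R x - t * lt.G x) / (lt.G x * lt.G x)) \<longlongrightarrow> t\<^sup>2 * (- (1 / 2))) at_top" if "conv_tail k0 b R t" for R t
      using conv_tail.second_order_0[OF that G0] by (simp add: power2_eq_square)
    note tr = second_order_transfer[OF Gm m_pos G_pos G_pos \<delta> D\<delta> so[OF ct1, folded m_def]]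
    show ?thesis
    proof (intro conjI allI impI)
      show "\<exists>r \<in> o[at_top](l_lower l). \<forall>\<^sub>F x in at_top.
           tail \<nu> x = tail \<mu> x * (1 + l_lower l x / 2 + r x)"
        using nu_form[OF tr(1)] unfolding m_def by simp
      fix t \<mu>t assume t: "0 < t" and cp: "is_conv_power t \<mu> \<mu>t"
      show "\<exists>r \<in> o[at_top](l_lower l). \<forall>\<^sub>F x in at_top.
              tail \<mu>t x = t * tail \<mu> x * (1 - (t - 1) * (l_lower l x / 2) + r x)"
        using tr(2)[OF t so[OF ct[OF t cp]]] unfolding m_def by simp
    qed
  qed
  show ?thesis using index_below_one index_one_infinite_mean index_one_finite_mean index_zero by blast
qed

end
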